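(* Let $(R,\mathfrak{m}, k)$ be a commutative noetherian local ring and let $\underline{x}=x_1,\ldots, x_n$ be a Lech-independent sequence in $R$ generating a proper ideal. Then $$\operatorname{level}^R K(\underline{x};R) =n+1.$$
   Context: A sequence $\underline{x}=x_1, \ldots, x_n$ in $R$ is called Lech-independent if, for $I=(x_1,\ldots, x_n)$, the natural surjection $(R/I)^n \to I/I^2$ (sending the $i$-th basis element to the class of $x_i$) is an isomorphism. $K(\underline{x};R)$ is the Koszul complex on $\underline{x}$ over $R$. Level: let $\mathsf{D}(R)$ be the derived category of $R$-modules with suspension $\Sigma$. Define recursively classes of objects of $\mathsf{D}(R)$: $\mathsf{T}^0$ consists of the complexes quasi-isomorphic to $0$; $\mathsf{T}^1$ consists of the complexes built from $R$ using (de)suspensions, finite direct sums and retracts (i.e. isomorphic in $\mathsf{D}(R)$ to direct summands of finite direct sums of complexes $\Sigma^j R$, $j\in\mathbb{Z}$); for $n\ge 2$, $\mathsf{T}^n$ consists of the complexes $M$ for which there are a complex $L$ and an exact triangle $K\to L\oplus M\to N\to \Sigma K$ in $\mathsf{D}(R)$ with $K\in\mathsf{T}^1$ and $N\in \mathsf{T}^{n-1}$. Then $\operatorname{level}^R M=\inf\{n\ge 0 : M\in \mathsf{T}^n\}$, which is $\infty$ if no such $n$ exists. *)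

theory Defs
  imports "HOL-Library.Extended_Nat" "HOL-Algebra.Module" "HOL-Algebra.Ring_Divisibility"
    "HOL-Algebra.Ideal_Product"
begin

section \<open>Complexes of modules\<close>

text \<open>
  The derived category is formed from modules whose carriers are sets of points of one fixed type,
  so that complexes can be quantified over.  The type of points below is closed under pairing (for
  direct sums and cones), contains the coordinate vectors used for free modules, and has an
  arbitrary type \<open>'b\<close> of further points: as \<open>'b\<close> is a free type variable in every statement,
  the modules may be arbitrarily large.
\<close>

datatype ('a, 'b) point =
    Scalar (the_scalar: 'a)
  | Coords (the_coords: "nat set \<Rightarrow> 'a")
  | Couple (point_fst: "('a, 'b) point") (point_snd: "('a, 'b) point")
  | Atom 'b

type_synonym ('a, 'b) pmodule = "('a, ('a, 'b) point) module"

text \<open>The fields \<open>mult\<close> and \<open>one\<close> of a module record carry no meaning.\<close>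

definition mk_module ::
    "'m set \<Rightarrow> ('m \<Rightarrow> 'm \<Rightarrow> 'm) \<Rightarrow> 'm \<Rightarrow> ('a \<Rightarrow> 'm \<Rightarrow> 'm) \<Rightarrow> ('a, 'm) module" where
  "mk_module C a z s =
     \<lparr>carrier = C, monoid.mult = (\<lambda>_ _. z), one = z, ring.zero = z, add = a, smult = s\<rparr>"

definition regular_module :: "('a, 'r) ring_scheme \<Rightarrow> ('a, 'b) pmodule" where
  "regular_module R = mk_module (Scalar ` carrier R)
     (\<lambda>x y. Scalar (the_scalar x \<oplus>\<^bsub>R\<^esub> the_scalar y))
     (Scalar \<zero>\<^bsub>R\<^esub>)
     (\<lambda>r x. Scalar (r \<otimes>\<^bsub>R\<^esub> the_scalar x))"

definition zero_module :: "('a, 'r) ring_scheme \<Rightarrow> ('a, 'b) pmodule" where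
  "zero_module R = (regular_module R)\<lparr>carrier := {Scalar \<zero>\<^bsub>R\<^esub>}\<rparr>"

text \<open>The free module on a finite set \<open>B\<close> of basis elements (which here are sets of naturals).\<close>

definition free_module :: "('a, 'r) ring_scheme \<Rightarrow> nat set set \<Rightarrow> ('a, 'b) pmodule" where
  "free_module R B = mk_module
     (Coords ` {v. (\<forall>S\<in>B. v S \<in> carrier R) \<and> (\<forall>S. S \<notin> B \<longrightarrow> v S = \<zero>\<^bsub>R\<^esub>)})
     (\<lambda>x y. Coords (\<lambda>S. the_coords x S \<oplus>\<^bsub>R\<^esub> the_coords y S))
     (Coords (\<lambda>S. \<zero>\<^bsub>R\<^esub>))
     (\<lambda>r x. Coords (\<lambda>S. r \<otimes>\<^bsub>R\<^esub> the_coords x S))"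

definition sum_module :: "('a, 'b) pmodule \<Rightarrow> ('a, 'b) pmodule \<Rightarrow> ('a, 'b) pmodule" where
  "sum_module M N = mk_module {Couple x y | x y. x \<in> carrier M \<and> y \<in> carrier N}
     (\<lambda>p q. Couple (point_fst p \<oplus>\<^bsub>M\<^esub> point_fst q) (point_snd p \<oplus>\<^bsub>N\<^esub> point_snd q))
     (Couple \<zero>\<^bsub>M\<^esub> \<zero>\<^bsub>N\<^esub>)
     (\<lambda>r p. Couple (r \<odot>\<^bsub>M\<^esub> point_fst p) (r \<odot>\<^bsub>N\<^esub> point_snd p))"

definition linear_maps :: "('a, 'r) ring_scheme \<Rightarrow> ('a, 'm) module \<Rightarrow> ('a, 'n) module \<Rightarrow> ('m \<Rightarrow> 'n) set"
  where
  "linear_maps R M N = {f \<in> carrier M \<rightarrow> carrier N.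
     (\<forall>x\<in>carrier M. \<forall>y\<in>carrier M. f (x \<oplus>\<^bsub>M\<^esub> y) = f x \<oplus>\<^bsub>N\<^esub> f y) \<and>
     (\<forall>r\<in>carrier R. \<forall>x\<in>carrier M. f (r \<odot>\<^bsub>M\<^esub> x) = r \<odot>\<^bsub>N\<^esub> f x)}"

text \<open>Grading is homological: \<open>dif X i\<close> maps \<open>obj X i\<close> to \<open>obj X (i - 1)\<close>.\<close>

record ('a, 'b) cpx =
  obj :: "int \<Rightarrow> ('a, 'b) pmodule"
  dif :: "int \<Rightarrow> ('a, 'b) point \<Rightarrow> ('a, 'b) point"

type_synonym ('a, 'b) gmap = "int \<Rightarrow> ('a, 'b) point \<Rightarrow> ('a, 'b) point"

definition chain_complex :: "('a, 'r) ring_scheme \<Rightarrow> ('a, 'b) cpx \<Rightarrow> bool" where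
  "chain_complex R X \<longleftrightarrow>
     (\<forall>i. module R (obj X i)) \<and>
     (\<forall>i. dif X i \<in> linear_maps R (obj X i) (obj X (i - 1))) \<and>
     (\<forall>i. \<forall>x\<in>carrier (obj X i). dif X (i - 1) (dif X i x) = \<zero>\<^bsub>obj X (i - 2)\<^esub>)"

definition chain_map ::
    "('a, 'r) ring_scheme \<Rightarrow> ('a, 'b) cpx \<Rightarrow> ('a, 'b) cpx \<Rightarrow> ('a, 'b) gmap \<Rightarrow> bool" where
  "chain_map R X Y f \<longleftrightarrow>
     (\<forall>i. f i \<in> linear_maps R (obj X i) (obj Y i)) \<and>
     (\<forall>i. \<forall>x\<in>carrier (obj X i). f (i - 1) (dif X i x) = dif Y i (f i x))"

definition gcomp :: "('a, 'b) gmap \<Rightarrow> ('a, 'b) gmap \<Rightarrow> ('a, 'b) gmap" where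
  "gcomp g f = (\<lambda>i. g i \<circ> f i)"

definition homotopic :: "('a, 'r) ring_scheme \<Rightarrow> ('a, 'b) cpx \<Rightarrow> ('a, 'b) cpx \<Rightarrow>
    ('a, 'b) gmap \<Rightarrow> ('a, 'b) gmap \<Rightarrow> bool" where
  "homotopic R X Y f g \<longleftrightarrow>
     (\<exists>h. (\<forall>i. h i \<in> linear_maps R (obj X i) (obj Y (i + 1))) \<and>
          (\<forall>i. \<forall>x\<in>carrier (obj X i).
             f i x \<ominus>\<^bsub>obj Y i\<^esub> g i x = dif Y (i + 1) (h i x) \<oplus>\<^bsub>obj Y i\<^esub> h (i - 1) (dif X i x)))"

definition cycles :: "('a, 'b) cpx \<Rightarrow> int \<Rightarrow> ('a, 'b) point set" where
  "cycles X i = {x \<in> carrier (obj X i). dif X i x = \<zero>\<^bsub>obj X (i - 1)\<^esub>}"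

definition boundaries :: "('a, 'b) cpx \<Rightarrow> int \<Rightarrow> ('a, 'b) point set" where
  "boundaries X i = dif X (i + 1) ` carrier (obj X (i + 1))"

definition homology :: "('a, 'b) cpx \<Rightarrow> int \<Rightarrow> ('a, 'b) point set set" where
  "homology X i = (\<lambda>z. boundaries X i +>\<^bsub>obj X i\<^esub> z) ` cycles X i"

text \<open>The class of \<open>z\<close> is sent to the class of \<open>f i z\<close>: adding the boundaries of \<open>Y\<close> to the
  image of a coset yields a full coset.\<close>

definition homology_map ::
    "('a, 'b) cpx \<Rightarrow> ('a, 'b) gmap \<Rightarrow> int \<Rightarrow> ('a, 'b) point set \<Rightarrow> ('a, 'b) point set" where
  "homology_map Y f i C = boundaries Y i <+>\<^bsub>obj Y i\<^esub> (f i ` C)"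

definition quasi_iso ::
    "('a, 'r) ring_scheme \<Rightarrow> ('a, 'b) cpx \<Rightarrow> ('a, 'b) cpx \<Rightarrow> ('a, 'b) gmap \<Rightarrow> bool" where
  "quasi_iso R X Y f \<longleftrightarrow>
     chain_map R X Y f \<and> (\<forall>i. bij_betw (homology_map Y f i) (homology X i) (homology Y i))"

definition zero_cpx :: "('a, 'r) ring_scheme \<Rightarrow> ('a, 'b) cpx" where
  "zero_cpx R = \<lparr>obj = (\<lambda>_. zero_module R), dif = (\<lambda>_ _. Scalar \<zero>\<^bsub>R\<^esub>)\<rparr>"

definition ring_cpx :: "('a, 'r) ring_scheme \<Rightarrow> ('a, 'b) cpx" where
  "ring_cpx R =
     \<lparr>obj = (\<lambda>i. if i = 0 then regular_module R else zero_module R),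
      dif = (\<lambda>_ _. Scalar \<zero>\<^bsub>R\<^esub>)\<rparr>"

definition sum_cpx :: "('a, 'b) cpx \<Rightarrow> ('a, 'b) cpx \<Rightarrow> ('a, 'b) cpx" where
  "sum_cpx X Y =
     \<lparr>obj = (\<lambda>i. sum_module (obj X i) (obj Y i)),
      dif = (\<lambda>i p. Couple (dif X i (point_fst p)) (dif Y i (point_snd p)))\<rparr>"

text \<open>The \<open>j\<close>-fold suspension, with differential multiplied by \<open>(-1)^j\<close>.\<close>

definition shift :: "int \<Rightarrow> ('a, 'b) cpx \<Rightarrow> ('a, 'b) cpx" where
  "shift j X =
     \<lparr>obj = (\<lambda>i. obj X (i - j)),
      dif = (\<lambda>i x. if even j then dif X (i - j) x
                   else \<ominus>\<^bsub>obj X (i - j - 1)\<^esub> dif X (i - j) x)\<rparr>"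

definition shift_map :: "int \<Rightarrow> ('a, 'b) gmap \<Rightarrow> ('a, 'b) gmap" where
  "shift_map j f = (\<lambda>i. f (i - j))"

text \<open>The mapping cone of \<open>f: X \<rightarrow> Y\<close>, with \<open>d (x, y) = (- d x, f x + d y)\<close>.\<close>

definition cone :: "('a, 'b) cpx \<Rightarrow> ('a, 'b) cpx \<Rightarrow> ('a, 'b) gmap \<Rightarrow> ('a, 'b) cpx" where
  "cone X Y f =
     \<lparr>obj = (\<lambda>i. sum_module (obj X (i - 1)) (obj Y i)),
      dif = (\<lambda>i p. Couple (\<ominus>\<^bsub>obj X (i - 2)\<^esub> dif X (i - 1) (point_fst p))
                          (f (i - 1) (point_fst p) \<oplus>\<^bsub>obj Y (i - 1)\<^esub> dif Y i (point_snd p)))\<rparr>"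

definition cone_incl :: "('a, 'b) cpx \<Rightarrow> ('a, 'b) gmap" where
  "cone_incl X = (\<lambda>i y. Couple \<zero>\<^bsub>obj X (i - 1)\<^esub> y)"

definition cone_proj :: "('a, 'b) gmap" where
  "cone_proj = (\<lambda>i. point_fst)"


section \<open>The derived category\<close>

text \<open>
  Morphisms from \<open>X\<close> to \<open>Y\<close> are fractions: classes of roofs \<open>(W, s, f)\<close>, i.e.
  \<open>X \<leftarrow>s\<midarrow> W \<midarrow>f\<rightarrow> Y\<close> with \<open>s\<close> a quasi-isomorphism, the class standing for \<open>f s\<^sup>-\<^sup>1\<close>.
  Fractions are calculated in the homotopy category.
\<close>

type_synonym ('a, 'b) roof = "('a, 'b) cpx \<times> ('a, 'b) gmap \<times> ('a, 'b) gmap"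

definition roofs ::
    "('a, 'r) ring_scheme \<Rightarrow> ('a, 'b) cpx \<Rightarrow> ('a, 'b) cpx \<Rightarrow> ('a, 'b) roof set" where
  "roofs R X Y = {(W, s, f). chain_complex R W \<and> quasi_iso R W X s \<and> chain_map R W Y f}"

definition roof_rel ::
    "('a, 'r) ring_scheme \<Rightarrow> ('a, 'b) cpx \<Rightarrow> ('a, 'b) cpx \<Rightarrow> (('a, 'b) roof \<times> ('a, 'b) roof) set"
  where
  "roof_rel R X Y = {((W, s, f), (W', s', f')).
     (W, s, f) \<in> roofs R X Y \<and> (W', s', f') \<in> roofs R X Y \<and>
     (\<exists>V p p'. chain_complex R V \<and> chain_map R V W p \<and> chain_map R V W' p' \<and>
        quasi_iso R V X (gcomp s p) \<and>
        homotopic R V X (gcomp s p) (gcomp s' p') \<and>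
        homotopic R V Y (gcomp f p) (gcomp f' p'))}"

definition derived_hom ::
    "('a, 'r) ring_scheme \<Rightarrow> ('a, 'b) cpx \<Rightarrow> ('a, 'b) cpx \<Rightarrow> ('a, 'b) roof set set" where
  "derived_hom R X Y = roofs R X Y // roof_rel R X Y"

text \<open>The image of a chain map in the derived category.\<close>

definition derived_map :: "('a, 'r) ring_scheme \<Rightarrow> ('a, 'b) cpx \<Rightarrow> ('a, 'b) cpx \<Rightarrow>
    ('a, 'b) gmap \<Rightarrow> ('a, 'b) roof set" where
  "derived_map R X Y f = roof_rel R X Y `` {(X, \<lambda>i x. x, f)}"

text \<open>
  The composite of \<open>X \<leftarrow>s\<midarrow> W \<midarrow>f\<rightarrow> Y\<close> and \<open>Y \<leftarrow>t\<midarrow> V \<midarrow>g\<rightarrow> Z\<close> is obtained from a completion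
  \<open>W \<leftarrow>p\<midarrow> U \<midarrow>q\<rightarrow> V\<close> of \<open>f\<close> and \<open>t\<close> to a square commuting up to homotopy, with \<open>p\<close> a
  quasi-isomorphism.
\<close>

definition derived_comp :: "('a, 'r) ring_scheme \<Rightarrow> ('a, 'b) cpx \<Rightarrow> ('a, 'b) cpx \<Rightarrow>
    ('a, 'b) cpx \<Rightarrow> ('a, 'b) roof set \<Rightarrow> ('a, 'b) roof set \<Rightarrow> ('a, 'b) roof set" where
  "derived_comp R X Y Z G F =
     roof_rel R X Z `` {(U, gcomp s p, gcomp g q) | U p q W s f V t g.
       (W, s, f) \<in> F \<and> (V, t, g) \<in> G \<and> chain_complex R U \<and>
       quasi_iso R U W p \<and> chain_map R U V q \<and>
       homotopic R U Y (gcomp f p) (gcomp t q)}"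

definition derived_shift :: "('a, 'r) ring_scheme \<Rightarrow> ('a, 'b) cpx \<Rightarrow> ('a, 'b) cpx \<Rightarrow>
    ('a, 'b) roof set \<Rightarrow> ('a, 'b) roof set" where
  "derived_shift R X Y F = roof_rel R (shift 1 X) (shift 1 Y) ``
     {(shift 1 W, shift_map 1 s, shift_map 1 f) | W s f. (W, s, f) \<in> F}"

definition derived_iso :: "('a, 'r) ring_scheme \<Rightarrow> ('a, 'b) cpx \<Rightarrow> ('a, 'b) cpx \<Rightarrow>
    ('a, 'b) roof set \<Rightarrow> bool" where
  "derived_iso R X Y F \<longleftrightarrow> F \<in> derived_hom R X Y \<and>
     (\<exists>G\<in>derived_hom R Y X.
        derived_comp R X Y X G F = derived_map R X X (\<lambda>i x. x) \<and>
        derived_comp R Y X Y F G = derived_map R Y Y (\<lambda>i x. x))"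

definition derived_isomorphic ::
    "('a, 'r) ring_scheme \<Rightarrow> ('a, 'b) cpx \<Rightarrow> ('a, 'b) cpx \<Rightarrow> bool" where
  "derived_isomorphic R X Y \<longleftrightarrow>
     chain_complex R X \<and> chain_complex R Y \<and> (\<exists>F. derived_iso R X Y F)"

text \<open>
  \<open>X \<midarrow>u\<rightarrow> Y \<midarrow>v\<rightarrow> Z \<midarrow>w\<rightarrow> \<Sigma>X\<close> is exact if it is isomorphic, in the derived category, to the triangle
  \<open>A \<midarrow>f\<rightarrow> B \<rightarrow> cone f \<rightarrow> \<Sigma>A\<close> of some chain map \<open>f\<close>.
\<close>

definition exact_triangle :: "('a, 'r) ring_scheme \<Rightarrow>
    ('a, 'b) cpx \<Rightarrow> ('a, 'b) cpx \<Rightarrow> ('a, 'b) cpx \<Rightarrow>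
    ('a, 'b) roof set \<Rightarrow> ('a, 'b) roof set \<Rightarrow> ('a, 'b) roof set \<Rightarrow> bool" where
  "exact_triangle R X Y Z u v w \<longleftrightarrow>
     chain_complex R X \<and> chain_complex R Y \<and> chain_complex R Z \<and>
     u \<in> derived_hom R X Y \<and> v \<in> derived_hom R Y Z \<and> w \<in> derived_hom R Z (shift 1 X) \<and>
     (\<exists>A B f \<alpha> \<beta> \<gamma>. chain_complex R A \<and> chain_complex R B \<and> chain_map R A B f \<and>
        derived_iso R X A \<alpha> \<and> derived_iso R Y B \<beta> \<and> derived_iso R Z (cone A B f) \<gamma> \<and>
        derived_comp R X Y B \<beta> u = derived_comp R X A B (derived_map R A B f) \<alpha> \<and>
        derived_comp R Y Z (cone A B f) \<gamma> v =
          derived_comp R Y B (cone A B f) (derived_map R B (cone A B f) (cone_incl A)) \<beta> \<and>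
        derived_comp R Z (shift 1 X) (shift 1 A) (derived_shift R X A \<alpha>) w =
          derived_comp R Z (cone A B f) (shift 1 A)
            (derived_map R (cone A B f) (shift 1 A) cone_proj) \<gamma>)"


section \<open>Level\<close>

fun sum_of_shifts :: "('a, 'r) ring_scheme \<Rightarrow> int list \<Rightarrow> ('a, 'b) cpx" where
  "sum_of_shifts R [] = zero_cpx R"
| "sum_of_shifts R (j # js) = sum_cpx (shift j (ring_cpx R)) (sum_of_shifts R js)"

fun thickening :: "('a, 'r) ring_scheme \<Rightarrow> nat \<Rightarrow> ('a, 'b) cpx set" where
  "thickening R 0 = {M. derived_isomorphic R M (zero_cpx R)}"
| "thickening R (Suc 0) =
     {M. chain_complex R M \<and>
         (\<exists>N js. chain_complex R N \<and> derived_isomorphic R (sum_cpx M N) (sum_of_shifts R js))}"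
| "thickening R (Suc (Suc n)) =
     {M. chain_complex R M \<and>
         (\<exists>K L N u v w. chain_complex R L \<and> exact_triangle R K (sum_cpx L M) N u v w \<and>
            K \<in> thickening R (Suc 0) \<and> N \<in> thickening R (Suc n))}"

definition level :: "('a, 'r) ring_scheme \<Rightarrow> ('a, 'b) cpx \<Rightarrow> enat" where
  "level R M = Inf {enat n | n. M \<in> thickening R n}"


section \<open>Local rings, Lech-independent sequences and the Koszul complex\<close>

definition local_ring :: "('a, 'r) ring_scheme \<Rightarrow> 'a set \<Rightarrow> bool" where
  "local_ring R m \<longleftrightarrow> cring R \<and> maximalideal m R \<and> (\<forall>m'. maximalideal m' R \<longrightarrow> m' = m)"

text \<open>
  The natural map \<open>(R/I)\<^sup>n \<rightarrow> I/I\<^sup>2\<close>, for \<open>I\<close> generated by \<open>xs\<close>: a tuple \<open>c\<close> of cosets of \<open>I\<close> with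
  representatives \<open>a i\<close> is sent to the class of \<open>\<Sum>i. a i * xs ! i\<close>.  The union is over all choices
  of representatives; they all give the same coset of \<open>I\<^sup>2\<close>.
\<close>

definition conormal_map :: "('a, 'r) ring_scheme \<Rightarrow> 'a list \<Rightarrow> (nat \<Rightarrow> 'a set) \<Rightarrow> 'a set" where
  "conormal_map R xs c =
     (let I = genideal R (set xs) in
      \<Union>a\<in>Pi {..<length xs} c.
        (I \<cdot>\<^bsub>R\<^esub> I) +>\<^bsub>R\<^esub> (\<Oplus>\<^bsub>R\<^esub>i\<in>{..<length xs}. a i \<otimes>\<^bsub>R\<^esub> xs ! i))"

text \<open>As the natural map is linear, it is an isomorphism precisely if it is bijective.\<close>

definition lech_independent :: "('a, 'r) ring_scheme \<Rightarrow> 'a list \<Rightarrow> bool" where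
  "lech_independent R xs \<longleftrightarrow> set xs \<subseteq> carrier R \<and>
     (let I = genideal R (set xs) in
      bij_betw (conormal_map R xs)
        ({..<length xs} \<rightarrow>\<^sub>E carrier (R Quot I))
        ((\<lambda>y. (I \<cdot>\<^bsub>R\<^esub> I) +>\<^bsub>R\<^esub> y) ` I))"

text \<open>
  The Koszul complex on \<open>xs\<close>: in degree \<open>i\<close> it is free on the basis \<open>e\<^sub>S\<close>, where \<open>S\<close> ranges over the
  subsets of \<open>{..<length xs}\<close> with \<open>i\<close> elements, and
  \<open>d e\<^sub>S = (\<Sum>j\<in>S. (-1)^card {k\<in>S. k < j} * xs ! j * e\<^bsub>S - {j}\<^esub>)\<close>.
  The definition gives the coordinates of \<open>d v\<close>.
\<close>

definition koszul :: "('a, 'r) ring_scheme \<Rightarrow> 'a list \<Rightarrow> ('a, 'b) cpx" where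
  "koszul R xs =
     \<lparr>obj = (\<lambda>i. free_module R {S. S \<subseteq> {..<length xs} \<and> int (card S) = i}),
      dif = (\<lambda>i v. Coords (\<lambda>T. \<Oplus>\<^bsub>R\<^esub>j\<in>{..<length xs} - T.
               (let c = xs ! j \<otimes>\<^bsub>R\<^esub> the_coords v (insert j T)
                in if even (card {k \<in> T. k < j}) then c else \<ominus>\<^bsub>R\<^esub> c)))\<rparr>"

end

theory Submission
  imports Defs
begin

text \<open>
  Upper bound: the brutal truncations of a complex of finite free modules in \<open>n + 1\<close> consecutive
  degrees build it from \<open>n + 1\<close> sums of shifts of \<open>R\<close>.

  Lower bound: Lech independence means that \<open>\<Sum> a\<^sub>i x\<^sub>i = 0\<close>, or even \<open>\<Sum> a\<^sub>i x\<^sub>i \<in> I\<^sup>2\<close>, forces \<open>a\<^sub>i \<in> I\<close>.  Hence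
  the coordinates of the differential modulo \<open>I\<close> give \<open>n\<close> classes in \<open>Ext\<^sup>1(R/I, R/I)\<close>, which act on
  the homology of \<open>P / I P\<close> for complexes \<open>P\<close> of free modules.  They act by zero if \<open>P\<close> is a sum of shifts
  of \<open>R\<close>, so a product of \<open>m\<close> of them vanishes on maps from \<open>P\<close> to objects of \<open>T\<^sup>m\<close>, in the sense that
  every such map factors through a complex of projectives in which the product becomes zero.  On
  the Koszul complex the product of all \<open>n\<close> of them takes the top class to \<open>1 \<in> R/I\<close>.
\<close>

section \<open>Modules and linear maps\<close>

text \<open>The homology of \<open>P / I P\<close> is no derived invariant of arbitrary complexes,
  and the objects of a thickening are arbitrary. So an object \<open>M\<close> is seen only through
  homotopy classes of chain maps \<open>P \<rightarrow> M\<close> from bounded below complexes of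
  projectives, on which the morphisms of the derived category act. The claim about \<open>M\<close>
  is a factorization of such maps, because a factorization survives the passage from
  \<open>L \<oplus> M\<close> to its summand \<open>M\<close> and can be continued along a triangle.
  The Ext classes appear as operations on elements: write \<open>d z\<close> as a sum of
  \<open>x_k t_k\<close> and pass to one \<open>t_k\<close>. Applying to such an equation the
  differential, or a chain map into a complex with zero differential, yields a relation with value
  zero. By the Lech property, which passes from \<open>R\<close> to free modules and finite sums,
  the coefficients of that relation then lie in \<open>I\<close> times the module. For the Koszul
  complex, a factorization of the identity would put the element \<open>1\<close> of degree 0,
  reached by the product, into \<open>I\<close>, which is proper.\<close>

context cring begin

lemma mod_group: "module R M \<Longrightarrow> abelian_group M"
  by (simp add: module_def)

lemma mod_monoid: "module R M \<Longrightarrow> abelian_monoid M"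
  by (simp add: module_def abelian_group_def)

text \<open>Modules change with the degree of a complex, so their laws are kept as rules conditional
  on \<open>module R M\<close>, which rewrite in every degree, instead of being interpreted at one
  module.\<close>

lemmas mod_add_closed = abelian_monoid.a_closed[OF mod_monoid]
lemmas mod_zero_closed = abelian_monoid.zero_closed[OF mod_monoid]
lemmas mod_inv_closed = abelian_group.a_inv_closed[OF mod_group]
lemmas mod_minus_closed = abelian_group.minus_closed[OF mod_group]
lemmas mod_smult_closed = module.smult_closed[of R]
lemmas mod_closed = mod_add_closed mod_zero_closed mod_inv_closed mod_minus_closed mod_smult_closed
lemmas mod_ac = abelian_monoid.a_assoc[OF mod_monoid] abelian_monoid.a_comm[OF mod_monoid]
  abelian_monoid.a_lcomm[OF mod_monoid]
lemmas mod_minus_eq = abelian_group.minus_eq[OF mod_group]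

lemma mod_minus_zero: "module R M \<Longrightarrow> \<ominus>\<^bsub>M\<^esub> \<zero>\<^bsub>M\<^esub> = \<zero>\<^bsub>M\<^esub>"
  by (metis abelian_group.r_neg abelian_monoid.l_zero mod_group mod_inv_closed mod_monoid
      mod_zero_closed)

lemma mod_smult_minus:
  "module R M \<Longrightarrow> a \<in> carrier R \<Longrightarrow> x \<in> carrier M \<Longrightarrow> a \<odot>\<^bsub>M\<^esub> (\<ominus>\<^bsub>M\<^esub> x) = \<ominus>\<^bsub>M\<^esub> (a \<odot>\<^bsub>M\<^esub> x)"
  by (rule module.smult_r_minus)

lemma mod_uminus_smult:
  "module R M \<Longrightarrow> a \<in> carrier R \<Longrightarrow> x \<in> carrier M \<Longrightarrow> (\<ominus> a) \<odot>\<^bsub>M\<^esub> x = \<ominus>\<^bsub>M\<^esub> (a \<odot>\<^bsub>M\<^esub> x)"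
  by (rule module.smult_l_minus)

lemma mod_l_neg: "module R M \<Longrightarrow> x \<in> carrier M \<Longrightarrow> \<ominus>\<^bsub>M\<^esub> x \<oplus>\<^bsub>M\<^esub> x = \<zero>\<^bsub>M\<^esub>"
  by (simp add: mod_group abelian_group.l_neg)

lemma mod_r_neg: "module R M \<Longrightarrow> x \<in> carrier M \<Longrightarrow> x \<oplus>\<^bsub>M\<^esub> \<ominus>\<^bsub>M\<^esub> x = \<zero>\<^bsub>M\<^esub>"
  by (simp add: mod_group abelian_group.r_neg)

lemmas mod_simps = mod_closed mod_minus_eq mod_minus_zero mod_smult_minus mod_uminus_smult
  mod_l_neg mod_r_neg
  abelian_monoid.l_zero[OF mod_monoid] abelian_monoid.r_zero[OF mod_monoid]
  abelian_group.minus_minus[OF mod_group] abelian_group.minus_add[OF mod_group]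
  abelian_group.r_neg1[OF mod_group] abelian_group.r_neg2[OF mod_group]
  module.smult_r_distr[of R] module.smult_l_null[of R] module.smult_r_null[of R]
  module.smult_one[of R]

lemma mod_eq_minus_iff:
  "\<lbrakk>module R M; x \<in> carrier M; y \<in> carrier M; z \<in> carrier M\<rbrakk> \<Longrightarrow>
    x \<ominus>\<^bsub>M\<^esub> y = z \<longleftrightarrow> x = y \<oplus>\<^bsub>M\<^esub> z"
  by (smt (verit, ccfv_SIG) abelian_group.r_neg2 mod_ac(2) mod_group mod_inv_closed mod_minus_eq mod_ac abelian_group.r_neg1)

lemma mod_neg_unique:
  "\<lbrakk>module R M; x \<in> carrier M; y \<in> carrier M; x \<oplus>\<^bsub>M\<^esub> y = \<zero>\<^bsub>M\<^esub>\<rbrakk> \<Longrightarrow> y = \<ominus>\<^bsub>M\<^esub> x"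
  by (metis abelian_group.minus_equality mod_ac(2) mod_group)

text \<open>Cancellations that the sorting by \<open>mod_ac\<close> can leave undone: the summand
  and its negative stand at opposite ends.\<close>

lemma mod_cancel:
  "\<lbrakk>module R M; x \<in> carrier M; y \<in> carrier M\<rbrakk> \<Longrightarrow> x \<oplus>\<^bsub>M\<^esub> (y \<oplus>\<^bsub>M\<^esub> \<ominus>\<^bsub>M\<^esub> x) = y"
  "\<lbrakk>module R M; x \<in> carrier M; y \<in> carrier M\<rbrakk> \<Longrightarrow> \<ominus>\<^bsub>M\<^esub> x \<oplus>\<^bsub>M\<^esub> (y \<oplus>\<^bsub>M\<^esub> x) = y"
  using mod_ac(3)[of M x y "\<ominus>\<^bsub>M\<^esub> x"] mod_ac(3)[of M "\<ominus>\<^bsub>M\<^esub> x" y x]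
  by (simp_all add: mod_simps)

section \<open>Linear maps\<close>

lemma linI:
  assumes "\<And>x. x \<in> carrier M \<Longrightarrow> f x \<in> carrier N"
    and "\<And>x y. x \<in> carrier M \<Longrightarrow> y \<in> carrier M \<Longrightarrow> f (x \<oplus>\<^bsub>M\<^esub> y) = f x \<oplus>\<^bsub>N\<^esub> f y"
    and "\<And>r x. r \<in> carrier R \<Longrightarrow> x \<in> carrier M \<Longrightarrow> f (r \<odot>\<^bsub>M\<^esub> x) = r \<odot>\<^bsub>N\<^esub> f x"
  shows "f \<in> linear_maps R M N"
  using assms by (auto simp: linear_maps_def)

lemma lin_closed: "f \<in> linear_maps R M N \<Longrightarrow> x \<in> carrier M \<Longrightarrow> f x \<in> carrier N"
  by (auto simp: linear_maps_def)

lemma lin_add: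
  "f \<in> linear_maps R M N \<Longrightarrow> x \<in> carrier M \<Longrightarrow> y \<in> carrier M \<Longrightarrow> f (x \<oplus>\<^bsub>M\<^esub> y) = f x \<oplus>\<^bsub>N\<^esub> f y"
  by (auto simp: linear_maps_def)

lemma lin_smult:
  "f \<in> linear_maps R M N \<Longrightarrow> r \<in> carrier R \<Longrightarrow> x \<in> carrier M \<Longrightarrow> f (r \<odot>\<^bsub>M\<^esub> x) = r \<odot>\<^bsub>N\<^esub> f x"
  by (auto simp: linear_maps_def)

lemma lin_zero:
  assumes "module R M" "module R N" "f \<in> linear_maps R M N" shows "f \<zero>\<^bsub>M\<^esub> = \<zero>\<^bsub>N\<^esub>"
proof -
  have "f (\<zero> \<odot>\<^bsub>M\<^esub> \<zero>\<^bsub>M\<^esub>) = \<zero> \<odot>\<^bsub>N\<^esub> f \<zero>\<^bsub>M\<^esub>"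
    using assms by (simp add: lin_smult mod_zero_closed)
  then show ?thesis
    using assms by (simp add: mod_simps lin_closed)
qed

lemma lin_minus:
  assumes "module R M" "module R N" "f \<in> linear_maps R M N" "x \<in> carrier M"
  shows "f (\<ominus>\<^bsub>M\<^esub> x) = \<ominus>\<^bsub>N\<^esub> f x"
proof (rule mod_neg_unique)
  show "f x \<oplus>\<^bsub>N\<^esub> f (\<ominus>\<^bsub>M\<^esub> x) = \<zero>\<^bsub>N\<^esub>"
    using assms by (simp add: lin_add[symmetric] lin_zero mod_simps)
qed (use assms in \<open>simp_all add: lin_closed mod_simps\<close>)

lemma lin_const_zero: "module R N \<Longrightarrow> (\<lambda>x. \<zero>\<^bsub>N\<^esub>) \<in> linear_maps R M N"
  by (rule linI) (simp_all add: mod_simps)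

lemma lin_id: "(\<lambda>x. x) \<in> linear_maps R M M"
  by (rule linI) auto

lemma lin_comp:
  "\<lbrakk>f \<in> linear_maps R M N; g \<in> linear_maps R N Q\<rbrakk> \<Longrightarrow> (\<lambda>x. g (f x)) \<in> linear_maps R M Q"
  by (rule linI) (simp_all add: lin_closed lin_add lin_smult)

lemma lin_sum:
  assumes "module R N" "f \<in> linear_maps R M N" "g \<in> linear_maps R M N"
  shows "(\<lambda>x. f x \<oplus>\<^bsub>N\<^esub> g x) \<in> linear_maps R M N"
  using assms by (intro linI) (simp_all add: lin_closed lin_add lin_smult mod_simps mod_ac)

lemma lin_neg:
  assumes "module R N" "f \<in> linear_maps R M N"
  shows "(\<lambda>x. \<ominus>\<^bsub>N\<^esub> f x) \<in> linear_maps R M N"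
  using assms by (intro linI) (simp_all add: lin_closed lin_add lin_smult mod_simps mod_ac)

lemma lin_diff:
  assumes "module R N" "f \<in> linear_maps R M N" "g \<in> linear_maps R M N"
  shows "(\<lambda>x. f x \<ominus>\<^bsub>N\<^esub> g x) \<in> linear_maps R M N"
  using lin_sum[OF assms(1,2) lin_neg[OF assms(1,3)]] assms
  by (intro linI) (simp_all add: lin_closed lin_add lin_smult mod_simps mod_ac)

text \<open>Only additivity between abelian monoids is asked for, since it is also applied to
  \<open>Scalar\<close> from the ring to a module and to coordinates from a module to the
  ring.\<close>

lemma additive_finsum:
  assumes "abelian_monoid M" "abelian_monoid N" "\<And>x. x \<in> carrier M \<Longrightarrow> f x \<in> carrier N"
    and "\<And>x y. x \<in> carrier M \<Longrightarrow> y \<in> carrier M \<Longrightarrow> f (x \<oplus>\<^bsub>M\<^esub> y) = f x \<oplus>\<^bsub>N\<^esub> f y"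
    and "f \<zero>\<^bsub>M\<^esub> = \<zero>\<^bsub>N\<^esub>" "finite A" "u \<in> A \<rightarrow> carrier M"
  shows "f (finsum M u A) = finsum N (\<lambda>i. f (u i)) A"
  using assms(6,7)
proof (induction A)
  case empty
  then show ?case
    using assms by (simp add: abelian_monoid.finsum_empty)
next
  case (insert a A)
  then have *: "u \<in> A \<rightarrow> carrier M" "u a \<in> carrier M" by auto
  have "f (finsum M u (insert a A)) = f (u a \<oplus>\<^bsub>M\<^esub> finsum M u A)"
    using insert * by (simp add: abelian_monoid.finsum_insert[OF assms(1)])
  also have "\<dots> = f (u a) \<oplus>\<^bsub>N\<^esub> finsum N (\<lambda>i. f (u i)) A"
    using insert * assms by (simp add: abelian_monoid.finsum_closed)
  also have "\<dots> = finsum N (\<lambda>i. f (u i)) (insert a A)"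
    using insert * assms(3) by (subst abelian_monoid.finsum_insert[OF assms(2)]) auto
  finally show ?case .
qed

lemma lin_finsum:
  assumes "module R M" "module R N" "f \<in> linear_maps R M N" "finite A" "u \<in> A \<rightarrow> carrier M"
  shows "f (finsum M u A) = finsum N (\<lambda>i. f (u i)) A"
  using assms by (intro additive_finsum) (auto simp: lin_closed lin_add lin_zero mod_monoid)

lemma mod_finsum_closed:
  "module R M \<Longrightarrow> u \<in> A \<rightarrow> carrier M \<Longrightarrow> finsum M u A \<in> carrier M"
  by (simp add: mod_monoid abelian_monoid.finsum_closed)

section \<open>The concrete modules: regular, zero, sum and free\<close>

lemma mk_module_simps [simp]:
  "carrier (mk_module C a z s) = C" "add (mk_module C a z s) = a"
  "ring.zero (mk_module C a z s) = z" "smult (mk_module C a z s) = s"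
  by (simp_all add: mk_module_def)

lemma regular_module_simps [simp]:
  "carrier (regular_module R) = Scalar ` carrier R"
  "Scalar a \<oplus>\<^bsub>regular_module R\<^esub> Scalar b = Scalar (a \<oplus> b)"
  "\<zero>\<^bsub>regular_module R\<^esub> = Scalar \<zero>"
  "r \<odot>\<^bsub>regular_module R\<^esub> Scalar a = Scalar (r \<otimes> a)"
  by (simp_all add: regular_module_def)

lemma zero_module_simps [simp]:
  "carrier (zero_module R) = {Scalar \<zero>}"
  "Scalar a \<oplus>\<^bsub>zero_module R\<^esub> Scalar b = Scalar (a \<oplus> b)"
  "\<zero>\<^bsub>zero_module R\<^esub> = Scalar \<zero>"
  "r \<odot>\<^bsub>zero_module R\<^esub> Scalar a = Scalar (r \<otimes> a)"
  by (simp_all add: zero_module_def regular_module_def mk_module_def)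

lemma sum_module_simps [simp]:
  "Couple x y \<in> carrier (sum_module M N) \<longleftrightarrow> x \<in> carrier M \<and> y \<in> carrier N"
  "Couple x y \<oplus>\<^bsub>sum_module M N\<^esub> Couple x' y' = Couple (x \<oplus>\<^bsub>M\<^esub> x') (y \<oplus>\<^bsub>N\<^esub> y')"
  "\<zero>\<^bsub>sum_module M N\<^esub> = Couple \<zero>\<^bsub>M\<^esub> \<zero>\<^bsub>N\<^esub>"
  "r \<odot>\<^bsub>sum_module M N\<^esub> Couple x y = Couple (r \<odot>\<^bsub>M\<^esub> x) (r \<odot>\<^bsub>N\<^esub> y)"
  by (simp_all add: sum_module_def)

lemma sum_module_cases:
  assumes "p \<in> carrier (sum_module M N)"
  obtains x y where "p = Couple x y" "x \<in> carrier M" "y \<in> carrier N"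
  using assms by (auto simp: sum_module_def)

lemma sum_module_carrierE:
  assumes "p \<in> carrier (sum_module M N)"
  shows "point_fst p \<in> carrier M" "point_snd p \<in> carrier N"
    "Couple (point_fst p) (point_snd p) = p"
  using assms by (auto simp: sum_module_def)

lemma regular_module: "module R (regular_module R)"
proof (rule moduleI)
  show "abelian_group (regular_module R)"
    by (rule abelian_groupI) (auto simp: a_ac intro: bexI[of _ "\<ominus> _"] l_neg)
qed (auto simp: is_cring l_distr r_distr m_assoc)

lemma zero_module: "module R (zero_module R)"
proof (rule moduleI)
  show "abelian_group (zero_module R)"
    by (rule abelian_groupI) (auto simp: a_ac)
qed (auto simp: is_cring l_distr r_distr m_assoc)

lemma sum_module:
  assumes "module R M" "module R N" shows "module R (sum_module M N)"
proof (rule moduleI)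
  show "abelian_group (sum_module M N)"
  proof (rule abelian_groupI)
    fix p assume "p \<in> carrier (sum_module M N)"
    then obtain x y where "p = Couple x y" "x \<in> carrier M" "y \<in> carrier N"
      by (rule sum_module_cases)
    then show "\<exists>q\<in>carrier (sum_module M N). q \<oplus>\<^bsub>sum_module M N\<^esub> p = \<zero>\<^bsub>sum_module M N\<^esub>"
      using assms by (intro bexI[of _ "Couple (\<ominus>\<^bsub>M\<^esub> x) (\<ominus>\<^bsub>N\<^esub> y)"]) (auto simp: mod_simps)
  qed (use assms in \<open>auto elim!: sum_module_cases simp: mod_simps mod_ac\<close>)
qed (use assms in \<open>auto elim!: sum_module_cases simp: mod_simps mod_ac is_cring
    module.smult_l_distr module.smult_assoc1\<close>)

lemma sum_module_inv [simp]:
  assumes "module R M" "module R N" "x \<in> carrier M" "y \<in> carrier N"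
  shows "\<ominus>\<^bsub>sum_module M N\<^esub> Couple x y = Couple (\<ominus>\<^bsub>M\<^esub> x) (\<ominus>\<^bsub>N\<^esub> y)"
  using assms by (intro mod_neg_unique[OF sum_module, symmetric]) (simp_all add: mod_simps)

lemma zero_module_inv [simp]: "\<ominus>\<^bsub>zero_module R\<^esub> Scalar \<zero> = Scalar \<zero>"
  using mod_minus_zero[OF zero_module] by simp

text \<open>The carrier of \<open>free_module\<close> without the wrapper \<open>Coords\<close>, so
  that membership can be simplified on coordinate vectors.\<close>

definition free_points :: "nat set set \<Rightarrow> (nat set \<Rightarrow> 'a) set" where
  "free_points B = {v. (\<forall>S\<in>B. v S \<in> carrier R) \<and> (\<forall>S. S \<notin> B \<longrightarrow> v S = \<zero>)}"

lemma free_module_simps [simp]: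
  "Coords v \<in> carrier (free_module R B) \<longleftrightarrow> v \<in> free_points B"
  "Coords v \<oplus>\<^bsub>free_module R B\<^esub> Coords w = Coords (\<lambda>S. v S \<oplus> w S)"
  "\<zero>\<^bsub>free_module R B\<^esub> = Coords (\<lambda>S. \<zero>)"
  "r \<odot>\<^bsub>free_module R B\<^esub> Coords v = Coords (\<lambda>S. r \<otimes> v S)"
  by (auto simp: free_module_def free_points_def)

lemma free_points_closed: "v \<in> free_points B \<Longrightarrow> v S \<in> carrier R"
  by (cases "S \<in> B") (auto simp: free_points_def)

lemma free_points_zero: "v \<in> free_points B \<Longrightarrow> S \<notin> B \<Longrightarrow> v S = \<zero>"
  by (auto simp: free_points_def)

lemma free_module_cases:
  assumes "p \<in> carrier (free_module R B)"
  obtains v where "p = Coords v" "v \<in> free_points B"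
  using assms by (auto simp: free_module_def free_points_def)

lemma free_module: "module R (free_module R B)"
proof (rule moduleI)
  show "abelian_group (free_module R B)"
  proof (rule abelian_groupI)
    fix p assume "p \<in> carrier (free_module R B)"
    then obtain v where "p = Coords v" "v \<in> free_points B"
      by (rule free_module_cases)
    then show "\<exists>q\<in>carrier (free_module R B). q \<oplus>\<^bsub>free_module R B\<^esub> p = \<zero>\<^bsub>free_module R B\<^esub>"
      by (intro bexI[of _ "Coords (\<lambda>S. \<ominus> v S)"])
        (auto simp: free_points_closed l_neg, auto simp: free_points_def)
  qed (auto elim!: free_module_cases simp: free_points_closed a_ac, auto simp: free_points_def)
qed (auto elim!: free_module_cases simp: free_points_closed l_distr r_distr m_assoc is_cring,
    auto simp: free_points_def)

lemma free_module_inv [simp]: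
  assumes "v \<in> free_points B"
  shows "\<ominus>\<^bsub>free_module R B\<^esub> Coords v = Coords (\<lambda>S. \<ominus> v S)"
  using assms
  by (intro mod_neg_unique[OF free_module, symmetric])
    (auto simp: free_points_closed r_neg, auto simp: free_points_def)

end

context cring begin

section \<open>Complexes, homotopies and cones\<close>

lemma cpxD:
  assumes "chain_complex R X"
  shows cpx_module: "module R (obj X i)"
    and cpx_dif: "dif X i \<in> linear_maps R (obj X i) (obj X (i - 1))"
    and cpx_dif_dif: "\<lbrakk>x \<in> carrier (obj X i); j = i - 1\<rbrakk> \<Longrightarrow> dif X j (dif X i x) = \<zero>\<^bsub>obj X (i - 2)\<^esub>"
  using assms unfolding chain_complex_def by blast+

lemma cpx_dif_closed:
  "\<lbrakk>chain_complex R X; x \<in> carrier (obj X i); j = i - 1\<rbrakk> \<Longrightarrow> dif X i x \<in> carrier (obj X j)"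
  by (simp add: cpx_dif[THEN lin_closed])

lemma cpx_dif_add:
  "\<lbrakk>chain_complex R X; x \<in> carrier (obj X i); y \<in> carrier (obj X i); j = i\<rbrakk> \<Longrightarrow>
    dif X i (x \<oplus>\<^bsub>obj X j\<^esub> y) = dif X i x \<oplus>\<^bsub>obj X (i - 1)\<^esub> dif X i y"
  by (simp add: cpx_dif[THEN lin_add])

lemma cpx_dif_smult:
  "\<lbrakk>chain_complex R X; x \<in> carrier (obj X i); r \<in> carrier R; j = i\<rbrakk> \<Longrightarrow>
    dif X i (r \<odot>\<^bsub>obj X j\<^esub> x) = r \<odot>\<^bsub>obj X (i - 1)\<^esub> dif X i x"
  by (simp add: cpx_dif[THEN lin_smult])

lemma cpx_dif_zero:
  "chain_complex R X \<Longrightarrow> j = i \<Longrightarrow> dif X i \<zero>\<^bsub>obj X j\<^esub> = \<zero>\<^bsub>obj X (i - 1)\<^esub>"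
  using lin_zero[OF cpx_module cpx_module cpx_dif] by simp

lemma cpx_dif_inv:
  "\<lbrakk>chain_complex R X; x \<in> carrier (obj X i); j = i\<rbrakk> \<Longrightarrow>
    dif X i (\<ominus>\<^bsub>obj X j\<^esub> x) = \<ominus>\<^bsub>obj X (i - 1)\<^esub> dif X i x"
  using lin_minus[OF cpx_module cpx_module cpx_dif] by simp

lemmas cpx_simps = cpx_module cpx_dif_closed cpx_dif_add cpx_dif_smult cpx_dif_zero cpx_dif_inv
  cpx_dif_dif

lemma chain_complexI:
  assumes "\<And>i. module R (obj X i)"
    and "\<And>i. dif X i \<in> linear_maps R (obj X i) (obj X (i - 1))"
    and "\<And>i x. x \<in> carrier (obj X i) \<Longrightarrow> dif X (i - 1) (dif X i x) = \<zero>\<^bsub>obj X (i - 2)\<^esub>"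
  shows "chain_complex R X"
  using assms by (simp add: chain_complex_def)

lemma chain_mapI:
  assumes "\<And>i. f i \<in> linear_maps R (obj X i) (obj Y i)"
    and "\<And>i x. x \<in> carrier (obj X i) \<Longrightarrow> f (i - 1) (dif X i x) = dif Y i (f i x)"
  shows "chain_map R X Y f"
  using assms by (simp add: chain_map_def)

lemma cmap_lin: "chain_map R X Y f \<Longrightarrow> f i \<in> linear_maps R (obj X i) (obj Y i)"
  by (simp add: chain_map_def)

lemma cmap_dif:
  "\<lbrakk>chain_map R X Y f; x \<in> carrier (obj X i); j = i - 1\<rbrakk> \<Longrightarrow> f j (dif X i x) = dif Y i (f i x)"
  by (simp add: chain_map_def)

lemma cmap_closed:
  "\<lbrakk>chain_map R X Y f; x \<in> carrier (obj X i); j = i\<rbrakk> \<Longrightarrow> f i x \<in> carrier (obj Y j)"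
  by (simp add: cmap_lin[THEN lin_closed])

lemma cmap_add:
  "\<lbrakk>chain_map R X Y f; x \<in> carrier (obj X i); y \<in> carrier (obj X i); j = i\<rbrakk> \<Longrightarrow>
    f i (x \<oplus>\<^bsub>obj X j\<^esub> y) = f i x \<oplus>\<^bsub>obj Y i\<^esub> f i y"
  by (simp add: cmap_lin[THEN lin_add])

lemma cmap_smult:
  "\<lbrakk>chain_map R X Y f; x \<in> carrier (obj X i); r \<in> carrier R; j = i\<rbrakk> \<Longrightarrow>
    f i (r \<odot>\<^bsub>obj X j\<^esub> x) = r \<odot>\<^bsub>obj Y i\<^esub> f i x"
  by (simp add: cmap_lin[THEN lin_smult])

lemma cmap_zero:
  "\<lbrakk>chain_map R X Y f; chain_complex R X; chain_complex R Y; j = i\<rbrakk> \<Longrightarrow>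
    f i \<zero>\<^bsub>obj X j\<^esub> = \<zero>\<^bsub>obj Y i\<^esub>"
  using lin_zero[OF cpx_module cpx_module cmap_lin] by simp

lemma cmap_inv:
  "\<lbrakk>chain_map R X Y f; chain_complex R X; chain_complex R Y; x \<in> carrier (obj X i); j = i\<rbrakk> \<Longrightarrow>
    f i (\<ominus>\<^bsub>obj X j\<^esub> x) = \<ominus>\<^bsub>obj Y i\<^esub> f i x"
  using lin_minus[OF cpx_module cpx_module cmap_lin] by simp

lemmas cmap_simps = cmap_closed cmap_add cmap_smult cmap_zero cmap_inv cmap_dif

lemma chain_map_id: "chain_map R X X (\<lambda>i x. x)"
  by (rule chain_mapI) (simp_all add: lin_id)

lemma gcomp_apply [simp]: "gcomp g f i x = g i (f i x)"
  by (simp add: gcomp_def)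

lemma gcomp_id [simp]: "gcomp f (\<lambda>i x. x) = f" "gcomp (\<lambda>i x. x) f = f"
  by (auto simp: fun_eq_iff)

lemma gcomp_assoc: "gcomp (gcomp h g) f = gcomp h (gcomp g f)"
  by (auto simp: fun_eq_iff)

lemma chain_map_gcomp:
  assumes "chain_map R X Y f" "chain_map R Y Z g" shows "chain_map R X Z (gcomp g f)"
proof (rule chain_mapI)
  show "gcomp g f i \<in> linear_maps R (obj X i) (obj Z i)" for i
    using lin_comp[OF cmap_lin cmap_lin] assms by (simp add: gcomp_def o_def)
qed (use assms in \<open>simp add: cmap_simps\<close>)

section \<open>Homotopies\<close>

definition zmap :: "('a, 'c) cpx \<Rightarrow> ('a, 'c) gmap" where
  "zmap Y = (\<lambda>i x. \<zero>\<^bsub>obj Y i\<^esub>)"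

lemma chain_map_zmap: "chain_complex R Y \<Longrightarrow> chain_map R X Y (zmap Y)"
  by (rule chain_mapI) (simp_all add: zmap_def lin_const_zero cpx_simps)

text \<open>The relation \<open>homotopic\<close> with its witness exposed and \<open>f\<close>
  isolated: in this form it rewrites \<open>f i x\<close> directly and contains no subtraction. On
  chain maps the two agree by \<open>homotopic_iff\<close>.\<close>

definition homotopy ::
    "('a, 'c) cpx \<Rightarrow> ('a, 'c) cpx \<Rightarrow> ('a, 'c) gmap \<Rightarrow> ('a, 'c) gmap \<Rightarrow> ('a, 'c) gmap \<Rightarrow> bool" where
  "homotopy X Y f g h \<longleftrightarrow>
     (\<forall>i. h i \<in> linear_maps R (obj X i) (obj Y (i + 1))) \<and>
     (\<forall>i. \<forall>x\<in>carrier (obj X i).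
        f i x = g i x \<oplus>\<^bsub>obj Y i\<^esub> (dif Y (i + 1) (h i x) \<oplus>\<^bsub>obj Y i\<^esub> h (i - 1) (dif X i x)))"

lemma homotopyI:
  assumes "\<And>i. h i \<in> linear_maps R (obj X i) (obj Y (i + 1))"
    and "\<And>i x. x \<in> carrier (obj X i) \<Longrightarrow>
      f i x = g i x \<oplus>\<^bsub>obj Y i\<^esub> (dif Y (i + 1) (h i x) \<oplus>\<^bsub>obj Y i\<^esub> h (i - 1) (dif X i x))"
  shows "homotopy X Y f g h"
  using assms by (simp add: homotopy_def)

lemma htp_lin: "homotopy X Y f g h \<Longrightarrow> h i \<in> linear_maps R (obj X i) (obj Y (i + 1))"
  by (simp add: homotopy_def)

lemma htp_closed:
  "\<lbrakk>homotopy X Y f g h; x \<in> carrier (obj X i); j = i + 1\<rbrakk> \<Longrightarrow> h i x \<in> carrier (obj Y j)"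
  by (simp add: htp_lin[THEN lin_closed])

lemma htp_eq:
  "\<lbrakk>homotopy X Y f g h; x \<in> carrier (obj X i)\<rbrakk> \<Longrightarrow>
    f i x = g i x \<oplus>\<^bsub>obj Y i\<^esub> (dif Y (i + 1) (h i x) \<oplus>\<^bsub>obj Y i\<^esub> h (i - 1) (dif X i x))"
  by (simp add: homotopy_def)

lemma htp_zero:
  "\<lbrakk>homotopy X Y f g h; chain_complex R X; chain_complex R Y; j = i\<rbrakk> \<Longrightarrow>
    h i \<zero>\<^bsub>obj X j\<^esub> = \<zero>\<^bsub>obj Y (i + 1)\<^esub>"
  using lin_zero[OF cpx_module cpx_module htp_lin] by simp

lemma htp_add:
  "\<lbrakk>homotopy X Y f g h; x \<in> carrier (obj X i); y \<in> carrier (obj X i); j = i\<rbrakk> \<Longrightarrow>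
    h i (x \<oplus>\<^bsub>obj X j\<^esub> y) = h i x \<oplus>\<^bsub>obj Y (i + 1)\<^esub> h i y"
  by (simp add: htp_lin[THEN lin_add])

lemma htp_smult:
  "\<lbrakk>homotopy X Y f g h; x \<in> carrier (obj X i); r \<in> carrier R; j = i\<rbrakk> \<Longrightarrow>
    h i (r \<odot>\<^bsub>obj X j\<^esub> x) = r \<odot>\<^bsub>obj Y (i + 1)\<^esub> h i x"
  by (simp add: htp_lin[THEN lin_smult])

lemma htp_inv:
  "\<lbrakk>homotopy X Y f g h; chain_complex R X; chain_complex R Y; x \<in> carrier (obj X i); j = i\<rbrakk> \<Longrightarrow>
    h i (\<ominus>\<^bsub>obj X j\<^esub> x) = \<ominus>\<^bsub>obj Y (i + 1)\<^esub> h i x"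
  using lin_minus[OF cpx_module cpx_module htp_lin] by simp

lemma homotopic_iff:
  assumes "chain_complex R X" "chain_complex R Y" "chain_map R X Y f" "chain_map R X Y g"
  shows "homotopic R X Y f g \<longleftrightarrow> (\<exists>h. homotopy X Y f g h)"
proof -
  have "f i x \<ominus>\<^bsub>obj Y i\<^esub> g i x = dif Y (i + 1) (h i x) \<oplus>\<^bsub>obj Y i\<^esub> h (i - 1) (dif X i x) \<longleftrightarrow>
      f i x = g i x \<oplus>\<^bsub>obj Y i\<^esub> (dif Y (i + 1) (h i x) \<oplus>\<^bsub>obj Y i\<^esub> h (i - 1) (dif X i x))"
    if h: "\<And>i. h i \<in> linear_maps R (obj X i) (obj Y (i + 1))" and x: "x \<in> carrier (obj X i)" for h i x
  proof (rule mod_eq_minus_iff)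
    have "h i x \<in> carrier (obj Y (i + 1))"
      using lin_closed[OF h x] .
    moreover have "h (i - 1) (dif X i x) \<in> carrier (obj Y (i - 1 + 1))"
      using lin_closed[OF h cpx_dif_closed[OF assms(1) x refl]] .
    ultimately show "dif Y (i + 1) (h i x) \<oplus>\<^bsub>obj Y i\<^esub> h (i - 1) (dif X i x) \<in> carrier (obj Y i)"
      using assms x by (simp add: mod_simps cpx_simps)
  qed (use assms x in \<open>simp_all add: cmap_simps cpx_simps\<close>)
  then have "(\<forall>i. \<forall>x\<in>carrier (obj X i).
        f i x \<ominus>\<^bsub>obj Y i\<^esub> g i x = dif Y (i + 1) (h i x) \<oplus>\<^bsub>obj Y i\<^esub> h (i - 1) (dif X i x)) \<longleftrightarrow>
      (\<forall>i. \<forall>x\<in>carrier (obj X i).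
        f i x = g i x \<oplus>\<^bsub>obj Y i\<^esub> (dif Y (i + 1) (h i x) \<oplus>\<^bsub>obj Y i\<^esub> h (i - 1) (dif X i x)))"
    if "\<forall>i. h i \<in> linear_maps R (obj X i) (obj Y (i + 1))" for h
    using that by (intro all_cong1 ball_cong refl) blast
  then show ?thesis
    unfolding homotopic_def homotopy_def by (intro ex_cong1 conj_cong refl)
qed

lemma homotopy_zero:
  assumes "chain_complex R X" "chain_complex R Y" "chain_map R X Y f"
  shows "homotopy X Y f f (\<lambda>i x. \<zero>\<^bsub>obj Y (i + 1)\<^esub>)"
  using assms by (intro homotopyI) (simp_all add: lin_const_zero cpx_simps mod_simps cmap_simps)

lemma homotopic_refl:
  "\<lbrakk>chain_complex R X; chain_complex R Y; chain_map R X Y f\<rbrakk> \<Longrightarrow> homotopic R X Y f f"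
  using homotopy_zero homotopic_iff by blast

lemma homotopic_cong:
  assumes "chain_complex R X" "chain_complex R Y" "chain_map R X Y f" "chain_map R X Y g"
    and "\<And>i x. x \<in> carrier (obj X i) \<Longrightarrow> f i x = g i x"
  shows "homotopic R X Y f g"
proof -
  have "homotopy X Y f g (\<lambda>i x. \<zero>\<^bsub>obj Y (i + 1)\<^esub>)"
    using homotopy_zero[OF assms(1,2,4)] assms(5) by (simp add: homotopy_def)
  then show ?thesis
    using homotopic_iff assms by blast
qed

lemma homotopic_sym:
  assumes "chain_complex R X" "chain_complex R Y" "chain_map R X Y f" "chain_map R X Y g"
    and "homotopic R X Y f g"
  shows "homotopic R X Y g f"
proof -
  obtain h where h: "homotopy X Y f g h"
    using assms homotopic_iff by blast
  have "homotopy X Y g f (\<lambda>i x. \<ominus>\<^bsub>obj Y (i + 1)\<^esub> h i x)"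
  proof (rule homotopyI)
    fix i x assume x: "x \<in> carrier (obj X i)"
    note closed = htp_closed[OF h x, of "i + 1"] htp_closed[OF h cpx_dif_closed[OF assms(1) x refl], of i]
      cmap_closed[OF assms(3) x] cmap_closed[OF assms(4) x]
    show "g i x = f i x \<oplus>\<^bsub>obj Y i\<^esub> (dif Y (i + 1) (\<ominus>\<^bsub>obj Y (i + 1)\<^esub> h i x) \<oplus>\<^bsub>obj Y i\<^esub>
        \<ominus>\<^bsub>obj Y (i - 1 + 1)\<^esub> h (i - 1) (dif X i x))"
      unfolding htp_eq[OF h x] using closed assms
      by (simp add: cpx_simps mod_simps mod_ac)
  qed (use h assms in \<open>simp add: lin_neg cpx_simps htp_lin\<close>)
  then show ?thesis
    using homotopic_iff assms by blast
qed

lemma homotopic_trans: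
  assumes "chain_complex R X" "chain_complex R Y" "chain_map R X Y f" "chain_map R X Y g"
    "chain_map R X Y k" and "homotopic R X Y f g" "homotopic R X Y g k"
  shows "homotopic R X Y f k"
proof -
  obtain h where h: "homotopy X Y f g h"
    using assms homotopic_iff by blast
  obtain h' where h': "homotopy X Y g k h'"
    using assms homotopic_iff by blast
  have "homotopy X Y f k (\<lambda>i x. h i x \<oplus>\<^bsub>obj Y (i + 1)\<^esub> h' i x)"
  proof (rule homotopyI)
    fix i x assume x: "x \<in> carrier (obj X i)"
    note closed = htp_closed[OF h x, of "i + 1"] htp_closed[OF h cpx_dif_closed[OF assms(1) x refl], of i]
      htp_closed[OF h' x, of "i + 1"] htp_closed[OF h' cpx_dif_closed[OF assms(1) x refl], of i]
      cmap_closed[OF assms(5) x]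
    show "f i x = k i x \<oplus>\<^bsub>obj Y i\<^esub> (dif Y (i + 1) (h i x \<oplus>\<^bsub>obj Y (i + 1)\<^esub> h' i x) \<oplus>\<^bsub>obj Y i\<^esub>
        (h (i - 1) (dif X i x) \<oplus>\<^bsub>obj Y (i - 1 + 1)\<^esub> h' (i - 1) (dif X i x)))"
      unfolding htp_eq[OF h x] htp_eq[OF h' x] using closed assms
      by (simp add: cpx_simps mod_simps mod_ac)
  qed (use h h' assms in \<open>simp add: lin_sum cpx_simps htp_lin\<close>)
  then show ?thesis
    using homotopic_iff assms by blast
qed

lemma homotopic_comp_left:
  assumes "chain_complex R X" "chain_complex R Y" "chain_complex R Z"
    "chain_map R X Y f" "chain_map R X Y g" "chain_map R Y Z k" and "homotopic R X Y f g"
  shows "homotopic R X Z (gcomp k f) (gcomp k g)"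
proof -
  obtain h where h: "homotopy X Y f g h"
    using assms homotopic_iff by blast
  have "homotopy X Z (gcomp k f) (gcomp k g) (\<lambda>i x. k (i + 1) (h i x))"
  proof (rule homotopyI)
    fix i x assume x: "x \<in> carrier (obj X i)"
    note closed = htp_closed[OF h x, of "i + 1"] htp_closed[OF h cpx_dif_closed[OF assms(1) x refl], of i]
      cmap_closed[OF assms(5) x]
    show "gcomp k f i x = gcomp k g i x \<oplus>\<^bsub>obj Z i\<^esub> (dif Z (i + 1) (k (i + 1) (h i x)) \<oplus>\<^bsub>obj Z i\<^esub>
        k (i - 1 + 1) (h (i - 1) (dif X i x)))"
      using closed assms x
      by (simp add: htp_eq[OF h x] cpx_simps mod_simps mod_ac cmap_simps[OF assms(6)])
  qed (use lin_comp[OF htp_lin[OF h] cmap_lin[OF assms(6)]] in simp)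
  then show ?thesis
    using homotopic_iff chain_map_gcomp assms by meson
qed

lemma homotopic_comp_right:
  assumes "chain_complex R X" "chain_complex R Y" "chain_complex R Z"
    "chain_map R Y Z f" "chain_map R Y Z g" "chain_map R X Y k" and "homotopic R Y Z f g"
  shows "homotopic R X Z (gcomp f k) (gcomp g k)"
proof -
  obtain h where h: "homotopy Y Z f g h"
    using assms homotopic_iff by blast
  have "homotopy X Z (gcomp f k) (gcomp g k) (\<lambda>i x. h i (k i x))"
  proof (rule homotopyI)
    fix i x assume x: "x \<in> carrier (obj X i)"
    show "gcomp f k i x = gcomp g k i x \<oplus>\<^bsub>obj Z i\<^esub> (dif Z (i + 1) (h i (k i x)) \<oplus>\<^bsub>obj Z i\<^esub>
        h (i - 1) (k (i - 1) (dif X i x)))"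
      using assms x by (simp add: htp_eq[OF h] cmap_simps[OF assms(6)])
  qed (use lin_comp[OF cmap_lin[OF assms(6)] htp_lin[OF h]] in simp)
  then show ?thesis
    using homotopic_iff chain_map_gcomp assms by meson
qed

text \<open>Turns a homotopy between two maps into a null homotopy of one map, the form to which
  acyclicity applies.\<close>

definition gdiff :: "('a, 'c) cpx \<Rightarrow> ('a, 'c) gmap \<Rightarrow> ('a, 'c) gmap \<Rightarrow> ('a, 'c) gmap" where
  "gdiff Y f g = (\<lambda>i x. f i x \<ominus>\<^bsub>obj Y i\<^esub> g i x)"

lemma chain_map_gdiff:
  assumes "chain_complex R X" "chain_complex R Y" "chain_map R X Y f" "chain_map R X Y g"
  shows "chain_map R X Y (gdiff Y f g)"
  using assms unfolding gdiff_def
  by (intro chain_mapI lin_diff) (simp_all add: cmap_lin cpx_simps cmap_simps mod_simps)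

lemma homotopic_gdiff_iff:
  assumes "chain_complex R X" "chain_complex R Y" "chain_map R X Y f" "chain_map R X Y g"
  shows "homotopic R X Y (gdiff Y f g) (zmap Y) \<longleftrightarrow> homotopic R X Y f g"
proof -
  have "gdiff Y f g i x \<ominus>\<^bsub>obj Y i\<^esub> zmap Y i x = f i x \<ominus>\<^bsub>obj Y i\<^esub> g i x" if "x \<in> carrier (obj X i)" for i x
    using assms that by (simp add: gdiff_def zmap_def mod_simps cpx_simps cmap_simps)
  then show ?thesis
    unfolding homotopic_def by (simp cong: ball_cong)
qed

section \<open>Shifts, sums and cones\<close>

lemma shift_simps [simp]:
  "obj (shift j X) i = obj X (i - j)"
  "dif (shift j X) i x = (if even j then dif X (i - j) x else \<ominus>\<^bsub>obj X (i - j - 1)\<^esub> dif X (i - j) x)"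
  by (simp_all add: shift_def)

lemma chain_complex_shift:
  assumes "chain_complex R X" shows "chain_complex R (shift j X)"
proof (rule chain_complexI)
  show "dif (shift j X) i \<in> linear_maps R (obj (shift j X) i) (obj (shift j X) (i - 1))" for i
    using lin_neg[OF cpx_module cpx_dif, OF assms assms, of "i - j"] cpx_dif[OF assms, of "i - j"]
    by (cases "even j") (simp_all add: shift_def algebra_simps)
qed (use assms in \<open>simp_all add: cpx_simps mod_simps algebra_simps\<close>)

lemma sum_cpx_simps [simp]:
  "obj (sum_cpx X Y) i = sum_module (obj X i) (obj Y i)"
  "dif (sum_cpx X Y) i (Couple x y) = Couple (dif X i x) (dif Y i y)"
  by (simp_all add: sum_cpx_def)

lemma chain_complex_sum_cpx:
  assumes "chain_complex R X" "chain_complex R Y" shows "chain_complex R (sum_cpx X Y)"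
  using assms
  by (intro chain_complexI linI) (auto simp: sum_module cpx_simps mod_simps elim!: sum_module_cases)

lemma cone_simps [simp]:
  "obj (cone X Y f) i = sum_module (obj X (i - 1)) (obj Y i)"
  "dif (cone X Y f) i (Couple x y) =
    Couple (\<ominus>\<^bsub>obj X (i - 2)\<^esub> dif X (i - 1) x) (f (i - 1) x \<oplus>\<^bsub>obj Y (i - 1)\<^esub> dif Y i y)"
  by (simp_all add: cone_def)

lemma chain_complex_cone:
  assumes "chain_complex R X" "chain_complex R Y" "chain_map R X Y f"
  shows "chain_complex R (cone X Y f)"
  using assms
  by (intro chain_complexI linI)
    (auto simp: sum_module cpx_simps mod_simps cmap_simps mod_ac elim!: sum_module_cases)

lemma cone_incl_apply [simp]: "cone_incl X i y = Couple \<zero>\<^bsub>obj X (i - 1)\<^esub> y"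
  by (simp add: cone_incl_def)

lemma cone_proj_apply [simp]: "cone_proj i (Couple x y) = x"
  by (simp add: cone_proj_def)

lemma chain_map_cone_incl:
  assumes "chain_complex R X" "chain_complex R Y" "chain_map R X Y f"
  shows "chain_map R Y (cone X Y f) (cone_incl X)"
  using assms
  by (intro chain_mapI linI)
    (auto simp: sum_module cpx_simps mod_simps cmap_simps mod_ac elim!: sum_module_cases)

lemma chain_map_cone_proj:
  assumes "chain_complex R X" "chain_complex R Y" "chain_map R X Y f"
  shows "chain_map R (cone X Y f) (shift 1 X) cone_proj"
  using assms
  by (intro chain_mapI linI)
    (auto simp: sum_module cpx_simps mod_simps cmap_simps mod_ac elim!: sum_module_cases)

text \<open>Exactness of \<open>X \<rightarrow> Y \<rightarrow> cone f\<close>: a null homotopy of the map into the cone has a component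
  in \<open>X\<close>, which is the factorization through \<open>f\<close>, and a component in \<open>Y\<close>, which is the homotopy.\<close>

lemma cone_exact:
  assumes P: "chain_complex R P" and X: "chain_complex R X" and Y: "chain_complex R Y"
    and f: "chain_map R X Y f" and b: "chain_map R P Y b"
    and null: "homotopic R P (cone X Y f) (gcomp (cone_incl X) b) (zmap (cone X Y f))"
  obtains a where "chain_map R P X a" "homotopic R P Y b (gcomp f a)"
proof -
  let ?C = "cone X Y f"
  note C = chain_complex_cone[OF X Y f]
  obtain H where H: "homotopy P ?C (gcomp (cone_incl X) b) (zmap ?C) H"
    using null homotopic_iff[OF P C chain_map_gcomp[OF b chain_map_cone_incl[OF X Y f]] chain_map_zmap[OF C]]
    by blast
  define a where "a = (\<lambda>i x. point_fst (H i x))"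
  define k where "k = (\<lambda>i x. point_snd (H i x))"
  have Hak: "H i x = Couple (a i x) (k i x)" and a_closed: "a i x \<in> carrier (obj X i)"
    and k_closed: "k i x \<in> carrier (obj Y (i + 1))" if "x \<in> carrier (obj P i)" for i x
    using sum_module_carrierE[of "H i x" "obj X i" "obj Y (i + 1)"] htp_closed[OF H that refl]
    by (simp_all add: a_def k_def)
  have a_lin: "a i \<in> linear_maps R (obj P i) (obj X i)"
    and k_lin: "k i \<in> linear_maps R (obj P i) (obj Y (i + 1))" for i
  proof -
    note Hadd = lin_add[OF htp_lin[OF H, of i]] and Hsmult = lin_smult[OF htp_lin[OF H, of i]]
    note cl = mod_closed[OF cpx_module[OF P]]
    show "a i \<in> linear_maps R (obj P i) (obj X i)"
      using Hadd Hsmult cl by (intro linI a_closed) (simp_all add: Hak)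
    show "k i \<in> linear_maps R (obj P i) (obj Y (i + 1))"
      using Hadd Hsmult cl by (intro linI k_closed) (simp_all add: Hak)
  qed
  have eq: "\<zero>\<^bsub>obj X (i - 1)\<^esub> = \<ominus>\<^bsub>obj X (i - 1)\<^esub> dif X i (a i x) \<oplus>\<^bsub>obj X (i - 1)\<^esub> a (i - 1) (dif P i x)"
    "b i x = f i (a i x) \<oplus>\<^bsub>obj Y i\<^esub> (dif Y (i + 1) (k i x) \<oplus>\<^bsub>obj Y i\<^esub> k (i - 1) (dif P i x))"
    if x: "x \<in> carrier (obj P i)" for i x
  proof -
    have dx: "dif P i x \<in> carrier (obj P (i - 1))"
      using P x by (simp add: cpx_simps)
    note cl = a_closed[OF x] k_closed[OF x] a_closed[OF dx] k_closed[OF dx]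
    have "Couple \<zero>\<^bsub>obj X (i - 1)\<^esub> (b i x) =
        Couple (\<ominus>\<^bsub>obj X (i - 1)\<^esub> dif X i (a i x) \<oplus>\<^bsub>obj X (i - 1)\<^esub> a (i - 1) (dif P i x))
          (f i (a i x) \<oplus>\<^bsub>obj Y i\<^esub> (dif Y (i + 1) (k i x) \<oplus>\<^bsub>obj Y i\<^esub> k (i - 1) (dif P i x)))"
      using htp_eq[OF H x] cl X Y f
      by (simp add: Hak[OF x] Hak[OF dx] zmap_def mod_simps cpx_simps cmap_simps mod_ac)
    then show "\<zero>\<^bsub>obj X (i - 1)\<^esub> = \<ominus>\<^bsub>obj X (i - 1)\<^esub> dif X i (a i x) \<oplus>\<^bsub>obj X (i - 1)\<^esub> a (i - 1) (dif P i x)"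
      "b i x = f i (a i x) \<oplus>\<^bsub>obj Y i\<^esub> (dif Y (i + 1) (k i x) \<oplus>\<^bsub>obj Y i\<^esub> k (i - 1) (dif P i x))"
      by simp_all
  qed
  have a: "chain_map R P X a"
  proof (rule chain_mapI[OF a_lin])
    fix i x assume x: "x \<in> carrier (obj P i)"
    have "dif P i x \<in> carrier (obj P (i - 1))"
      using P x by (simp add: cpx_simps)
    note cl = a_closed[OF x] a_closed[OF this]
    show "a (i - 1) (dif P i x) = dif X i (a i x)"
      using mod_neg_unique[OF cpx_module[OF X] _ _ eq(1)[OF x, symmetric]] cl X
      by (simp add: mod_simps cpx_simps)
  qed
  moreover have "homotopy P Y b (gcomp f a) k"
    using eq(2) by (intro homotopyI k_lin) simp
  then have "homotopic R P Y b (gcomp f a)"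
    using homotopic_iff[OF P Y b chain_map_gcomp[OF a f]] by blast
  ultimately show thesis ..
qed

text \<open>The cone is a weak cokernel: a null homotopy \<open>h\<close> of
  \<open>gcomp g f\<close> supplies the values on the \<open>X\<close> component, and
  \<open>(x, y)\<close> goes to \<open>g y + h x\<close>.\<close>

lemma cone_extend:
  assumes X: "chain_complex R X" and Y: "chain_complex R Y" and Z: "chain_complex R Z"
    and f: "chain_map R X Y f" and g: "chain_map R Y Z g"
    and null: "homotopic R X Z (gcomp g f) (zmap Z)"
  obtains k where "chain_map R (cone X Y f) Z k" "\<And>i y. y \<in> carrier (obj Y i) \<Longrightarrow> k i (cone_incl X i y) = g i y"
proof -
  obtain h where h: "homotopy X Z (gcomp g f) (zmap Z) h"
    using null homotopic_iff[OF X Z chain_map_gcomp[OF f g] chain_map_zmap[OF Z]] by blast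
  define k where "k = (\<lambda>i p. g i (point_snd p) \<oplus>\<^bsub>obj Z i\<^esub> h (i - 1) (point_fst p))"
  have "chain_map R (cone X Y f) Z k"
  proof (rule chain_mapI)
    show "k i \<in> linear_maps R (obj (cone X Y f) i) (obj Z i)" for i
      using X Y Z f g unfolding k_def
      by (intro linI) (auto simp: sum_module cpx_simps mod_simps cmap_simps[OF g] htp_closed[OF h] htp_add[OF h] htp_smult[OF h]
          mod_ac elim!: sum_module_cases)
    fix i p assume "p \<in> carrier (obj (cone X Y f) i)"
    then obtain x y where p: "p = Couple x y" "x \<in> carrier (obj X (i - 1))" "y \<in> carrier (obj Y i)"
      by (auto elim: sum_module_cases)
    have dx: "dif X (i - 1) x \<in> carrier (obj X (i - 2))"
      using X p by (simp add: cpx_simps)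
    have "g (i - 1) (f (i - 1) x) = dif Z i (h (i - 1) x) \<oplus>\<^bsub>obj Z (i - 1)\<^esub> h (i - 2) (dif X (i - 1) x)"
      using htp_eq[OF h p(2)] X Z p dx by (simp add: zmap_def cpx_simps mod_simps htp_closed[OF h])
    then show "k (i - 1) (dif (cone X Y f) i p) = dif Z i (k i p)"
      using X Y Z f g p dx by (simp add: k_def cpx_simps mod_simps cmap_simps htp_closed[OF h] htp_inv[OF h] mod_ac)
  qed
  moreover have "k i (cone_incl X i y) = g i y" if "y \<in> carrier (obj Y i)" for i y
    using that X Z g by (simp add: k_def htp_zero[OF h] cmap_simps mod_simps cpx_simps)
  ultimately show thesis ..
qed

end

context cring begin

section \<open>Lifting along quasi-isomorphisms\<close>

lemma cycles_iff: "z \<in> cycles X i \<longleftrightarrow> z \<in> carrier (obj X i) \<and> dif X i z = \<zero>\<^bsub>obj X (i - 1)\<^esub>"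
  by (simp add: cycles_def)

lemma boundariesI: "y \<in> carrier (obj X (i + 1)) \<Longrightarrow> dif X (i + 1) y \<in> boundaries X i"
  by (simp add: boundaries_def)

lemma boundaries_closed: "chain_complex R X \<Longrightarrow> b \<in> boundaries X i \<Longrightarrow> b \<in> carrier (obj X i)"
  by (auto simp: boundaries_def cpx_simps)

lemma boundaries_zero: "chain_complex R X \<Longrightarrow> \<zero>\<^bsub>obj X i\<^esub> \<in> boundaries X i"
  using boundariesI[of "\<zero>\<^bsub>obj X (i + 1)\<^esub>" X i] by (simp add: cpx_simps mod_simps)

lemma boundaries_add:
  "\<lbrakk>chain_complex R X; b \<in> boundaries X i; c \<in> boundaries X i\<rbrakk> \<Longrightarrow> b \<oplus>\<^bsub>obj X i\<^esub> c \<in> boundaries X i"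
proof -
  assume X: "chain_complex R X" and "b \<in> boundaries X i" "c \<in> boundaries X i"
  then obtain x y where "x \<in> carrier (obj X (i + 1))" "y \<in> carrier (obj X (i + 1))"
    "b = dif X (i + 1) x" "c = dif X (i + 1) y"
    by (auto simp: boundaries_def)
  then show "b \<oplus>\<^bsub>obj X i\<^esub> c \<in> boundaries X i"
    using X boundariesI[of "x \<oplus>\<^bsub>obj X (i + 1)\<^esub> y" X i] by (simp add: cpx_simps mod_simps)
qed

lemma boundaries_inv:
  "\<lbrakk>chain_complex R X; b \<in> boundaries X i\<rbrakk> \<Longrightarrow> \<ominus>\<^bsub>obj X i\<^esub> b \<in> boundaries X i"
proof -
  assume X: "chain_complex R X" and "b \<in> boundaries X i"
  then obtain x where "x \<in> carrier (obj X (i + 1))" "b = dif X (i + 1) x"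
    by (auto simp: boundaries_def)
  then show "\<ominus>\<^bsub>obj X i\<^esub> b \<in> boundaries X i"
    using X boundariesI[of "\<ominus>\<^bsub>obj X (i + 1)\<^esub> x" X i] by (simp add: cpx_simps mod_simps)
qed

lemma chain_map_boundaries:
  assumes "chain_complex R X" "chain_map R X Y f" "b \<in> boundaries X i"
  shows "f i b \<in> boundaries Y i"
proof -
  obtain x where x: "x \<in> carrier (obj X (i + 1))" "b = dif X (i + 1) x"
    using assms(3) by (auto simp: boundaries_def)
  then show ?thesis
    using assms boundariesI[OF cmap_closed[OF assms(2) x(1) refl]] by (simp add: cmap_dif)
qed

lemma chain_map_cycles:
  assumes "chain_complex R X" "chain_complex R Y" "chain_map R X Y f" "z \<in> cycles X i"
  shows "f i z \<in> cycles Y i"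
proof -
  have "dif Y i (f i z) = f (i - 1) (dif X i z)"
    using cmap_dif[OF assms(3), of z i "i - 1"] assms(4) by (simp add: cycles_iff)
  then show ?thesis
    using assms by (simp add: cycles_iff cmap_simps)
qed

lemma boundary_coset_eq_iff:
  assumes X: "chain_complex R X" and z: "z \<in> carrier (obj X i)" and w: "w \<in> carrier (obj X i)"
  shows "boundaries X i +>\<^bsub>obj X i\<^esub> z = boundaries X i +>\<^bsub>obj X i\<^esub> w \<longleftrightarrow>
    (\<exists>b\<in>boundaries X i. z = b \<oplus>\<^bsub>obj X i\<^esub> w)"
proof
  assume eq: "boundaries X i +>\<^bsub>obj X i\<^esub> z = boundaries X i +>\<^bsub>obj X i\<^esub> w"
  have "z \<in> boundaries X i +>\<^bsub>obj X i\<^esub> z"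
    using X z boundaries_zero[OF X]
    by (auto simp: a_r_coset_def' mod_simps cpx_simps intro!: bexI[of _ "\<zero>\<^bsub>obj X i\<^esub>"])
  then show "\<exists>b\<in>boundaries X i. z = b \<oplus>\<^bsub>obj X i\<^esub> w"
    unfolding eq by (auto simp: a_r_coset_def')
next
  assume "\<exists>b\<in>boundaries X i. z = b \<oplus>\<^bsub>obj X i\<^esub> w"
  then obtain b where b: "b \<in> boundaries X i" "z = b \<oplus>\<^bsub>obj X i\<^esub> w" by blast
  note M = cpx_module[OF X, of i] and cl = boundaries_closed[OF X]
  have "c \<oplus>\<^bsub>obj X i\<^esub> z = (c \<oplus>\<^bsub>obj X i\<^esub> b) \<oplus>\<^bsub>obj X i\<^esub> w" if "c \<in> boundaries X i" for c
    using that b cl w M by (simp add: mod_ac mod_simps)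
  moreover have "c \<oplus>\<^bsub>obj X i\<^esub> w = (c \<oplus>\<^bsub>obj X i\<^esub> \<ominus>\<^bsub>obj X i\<^esub> b) \<oplus>\<^bsub>obj X i\<^esub> z" if "c \<in> boundaries X i" for c
    using that b cl[of b i] cl[of c i] w M by (simp add: mod_ac(1) mod_simps)
  ultimately have eqs: "c \<in> boundaries X i \<Longrightarrow> c \<oplus>\<^bsub>obj X i\<^esub> z = (c \<oplus>\<^bsub>obj X i\<^esub> b) \<oplus>\<^bsub>obj X i\<^esub> w"
    "c \<in> boundaries X i \<Longrightarrow> c \<oplus>\<^bsub>obj X i\<^esub> w = (c \<oplus>\<^bsub>obj X i\<^esub> \<ominus>\<^bsub>obj X i\<^esub> b) \<oplus>\<^bsub>obj X i\<^esub> z" for c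
    by blast+
  show "boundaries X i +>\<^bsub>obj X i\<^esub> z = boundaries X i +>\<^bsub>obj X i\<^esub> w"
  proof (intro equalityI subsetI)
    fix y assume "y \<in> boundaries X i +>\<^bsub>obj X i\<^esub> z"
    then obtain c where c: "c \<in> boundaries X i" "y = c \<oplus>\<^bsub>obj X i\<^esub> z"
      by (auto simp: a_r_coset_def')
    show "y \<in> boundaries X i +>\<^bsub>obj X i\<^esub> w"
      unfolding a_r_coset_def' c(2) eqs(1)[OF c(1)] using boundaries_add[OF X c(1) b(1)] by blast
  next
    fix y assume "y \<in> boundaries X i +>\<^bsub>obj X i\<^esub> w"
    then obtain c where c: "c \<in> boundaries X i" "y = c \<oplus>\<^bsub>obj X i\<^esub> w"
      by (auto simp: a_r_coset_def')
    show "y \<in> boundaries X i +>\<^bsub>obj X i\<^esub> z"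
      unfolding a_r_coset_def' c(2) eqs(2)[OF c(1)]
      using boundaries_add[OF X c(1) boundaries_inv[OF X b(1)]] by blast
  qed
qed

text \<open>Chain maps send boundaries to boundaries, so adding the boundaries of \<open>Y\<close>
  absorbs the choice of a representative.\<close>

lemma homology_map_coset:
  assumes X: "chain_complex R X" and Y: "chain_complex R Y" and f: "chain_map R X Y f"
    and z: "z \<in> carrier (obj X i)"
  shows "homology_map Y f i (boundaries X i +>\<^bsub>obj X i\<^esub> z) = boundaries Y i +>\<^bsub>obj Y i\<^esub> f i z"
proof -
  have eq: "c \<oplus>\<^bsub>obj Y i\<^esub> f i (b \<oplus>\<^bsub>obj X i\<^esub> z) = (c \<oplus>\<^bsub>obj Y i\<^esub> f i b) \<oplus>\<^bsub>obj Y i\<^esub> f i z"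
    if "b \<in> boundaries X i" "c \<in> boundaries Y i" for b c
    using that X Y f z boundaries_closed[OF X that(1)] boundaries_closed[OF Y that(2)]
    by (simp add: cmap_simps cpx_simps mod_simps mod_ac)
  show ?thesis
  proof (intro equalityI subsetI)
    fix y assume "y \<in> homology_map Y f i (boundaries X i +>\<^bsub>obj X i\<^esub> z)"
    then obtain b c where bc: "b \<in> boundaries X i" "c \<in> boundaries Y i"
      "y = c \<oplus>\<^bsub>obj Y i\<^esub> f i (b \<oplus>\<^bsub>obj X i\<^esub> z)"
      by (auto simp: homology_map_def a_r_coset_def' set_add_def')
    show "y \<in> boundaries Y i +>\<^bsub>obj Y i\<^esub> f i z"
      unfolding a_r_coset_def' bc(3) eq[OF bc(1,2)]
      using boundaries_add[OF Y bc(2) chain_map_boundaries[OF X f bc(1)]] by blast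
  next
    fix y assume "y \<in> boundaries Y i +>\<^bsub>obj Y i\<^esub> f i z"
    then obtain c where c: "c \<in> boundaries Y i" "y = c \<oplus>\<^bsub>obj Y i\<^esub> f i z"
      by (auto simp: a_r_coset_def')
    have "z \<in> boundaries X i +>\<^bsub>obj X i\<^esub> z"
      using X z boundaries_zero[OF X]
      by (auto simp: a_r_coset_def' mod_simps cpx_simps intro!: bexI[of _ "\<zero>\<^bsub>obj X i\<^esub>"])
    then show "y \<in> homology_map Y f i (boundaries X i +>\<^bsub>obj X i\<^esub> z)"
      unfolding homology_map_def set_add_def' c(2) using c(1) by blast
  qed
qed

text \<open>Homology consists of cosets; injectivity and surjectivity on them become conditions on
  elements, which is how quasi-isomorphisms are handled below.\<close>

lemma quasi_iso_iff:
  assumes X: "chain_complex R X" and Y: "chain_complex R Y"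
  shows "quasi_iso R X Y f \<longleftrightarrow> chain_map R X Y f \<and>
    (\<forall>i. \<forall>z\<in>cycles X i. f i z \<in> boundaries Y i \<longrightarrow> z \<in> boundaries X i) \<and>
    (\<forall>i. \<forall>w\<in>cycles Y i. \<exists>z\<in>cycles X i. \<exists>b\<in>boundaries Y i. w = b \<oplus>\<^bsub>obj Y i\<^esub> f i z)"
    (is "_ \<longleftrightarrow> _ \<and> (\<forall>i. ?I i) \<and> (\<forall>i. ?S i)")
proof -
  have "bij_betw (homology_map Y f i) (homology X i) (homology Y i) \<longleftrightarrow> ?I i \<and> ?S i"
    if f: "chain_map R X Y f" for i
  proof -
    note MX = cpx_module[OF X, of i] and MY = cpx_module[OF Y, of i]
    have map: "homology_map Y f i (boundaries X i +>\<^bsub>obj X i\<^esub> z) = boundaries Y i +>\<^bsub>obj Y i\<^esub> f i z"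
      if "z \<in> cycles X i" for z
      using homology_map_coset[OF X Y f] that by (simp add: cycles_iff)
    have cyc: "f i z \<in> cycles Y i" "z \<in> carrier (obj X i)" "f i z \<in> carrier (obj Y i)"
      if "z \<in> cycles X i" for z
      using chain_map_cycles[OF X Y f that] that by (auto simp: cycles_iff)
    have cycY: "w \<in> carrier (obj Y i)" if "w \<in> cycles Y i" for w
      using that by (simp add: cycles_iff)
    have inj: "inj_on (homology_map Y f i) (homology X i) \<longleftrightarrow> ?I i"
    proof
      assume inj: "inj_on (homology_map Y f i) (homology X i)"
      show "?I i"
      proof (intro ballI impI)
        fix z assume z: "z \<in> cycles X i" "f i z \<in> boundaries Y i"
        have zero: "\<zero>\<^bsub>obj X i\<^esub> \<in> cycles X i"
          using X by (simp add: cycles_iff cpx_simps mod_simps)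
        have "boundaries Y i +>\<^bsub>obj Y i\<^esub> f i z = boundaries Y i +>\<^bsub>obj Y i\<^esub> f i \<zero>\<^bsub>obj X i\<^esub>"
          using z(2) cyc(3)[OF z(1)] boundary_coset_eq_iff[OF Y, of "f i z" i "f i \<zero>\<^bsub>obj X i\<^esub>"] X Y f MY
          by (simp add: cmap_simps mod_simps) (rule bexI[of _ "f i z"], simp_all add: mod_simps)
        then have "homology_map Y f i (boundaries X i +>\<^bsub>obj X i\<^esub> z) =
            homology_map Y f i (boundaries X i +>\<^bsub>obj X i\<^esub> \<zero>\<^bsub>obj X i\<^esub>)"
          by (simp only: map[OF z(1)] map[OF zero])
        then have "boundaries X i +>\<^bsub>obj X i\<^esub> z = boundaries X i +>\<^bsub>obj X i\<^esub> \<zero>\<^bsub>obj X i\<^esub>"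
          using inj_onD[OF inj] z(1) zero unfolding homology_def by blast
        then show "z \<in> boundaries X i"
          using boundary_coset_eq_iff[OF X, of z i "\<zero>\<^bsub>obj X i\<^esub>"] z cyc MX boundaries_closed[OF X]
          by (auto simp: mod_simps)
      qed
    next
      assume I: "?I i"
      show "inj_on (homology_map Y f i) (homology X i)"
      proof (rule inj_onI)
        fix A B assume "A \<in> homology X i" "B \<in> homology X i"
          and eq: "homology_map Y f i A = homology_map Y f i B"
        then obtain z w where z: "A = boundaries X i +>\<^bsub>obj X i\<^esub> z" "z \<in> cycles X i"
          and w: "B = boundaries X i +>\<^bsub>obj X i\<^esub> w" "w \<in> cycles X i"
          by (auto simp: homology_def)
        obtain b where b: "b \<in> boundaries Y i" "f i z = b \<oplus>\<^bsub>obj Y i\<^esub> f i w"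
          using eq map z w boundary_coset_eq_iff[OF Y cyc(3)[OF z(2)] cyc(3)[OF w(2)]] by auto
        have "f i (z \<ominus>\<^bsub>obj X i\<^esub> w) = b"
          using b boundaries_closed[OF Y b(1)] cyc[OF z(2)] cyc[OF w(2)] X Y f MX MY
          by (simp add: mod_simps cmap_simps mod_ac(1))
        moreover have "z \<ominus>\<^bsub>obj X i\<^esub> w \<in> cycles X i"
          using z(2) w(2) X by (simp add: cycles_iff mod_simps cpx_simps)
        ultimately have "z \<ominus>\<^bsub>obj X i\<^esub> w \<in> boundaries X i"
          using I b(1) by blast
        moreover have "z = (z \<ominus>\<^bsub>obj X i\<^esub> w) \<oplus>\<^bsub>obj X i\<^esub> w"
          using cyc[OF z(2)] cyc[OF w(2)] MX by (simp add: mod_simps mod_ac(1))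
        ultimately show "A = B"
          unfolding z w using boundary_coset_eq_iff[OF X] cyc(2)[OF z(2)] cyc(2)[OF w(2)] by blast
      qed
    qed
    \<comment> \<open>Cycles go to cycles, so the image always lies in the homology of
      \<open>Y\<close> and only the other inclusion is at stake.\<close>
    have "homology_map Y f i ` homology X i = homology Y i \<longleftrightarrow> homology Y i \<subseteq> homology_map Y f i ` homology X i"
      using cyc(1) map by (auto simp: homology_def)
    also have "\<dots> \<longleftrightarrow> (\<forall>w\<in>cycles Y i. \<exists>z\<in>cycles X i.
        boundaries Y i +>\<^bsub>obj Y i\<^esub> w = boundaries Y i +>\<^bsub>obj Y i\<^esub> f i z)"
      using map unfolding homology_def image_image by (auto simp: image_iff subset_iff)
    also have "\<dots> \<longleftrightarrow> ?S i"
      using boundary_coset_eq_iff[OF Y cycY cyc(3)] by (intro ball_cong bex_cong refl) blast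
    finally show ?thesis
      using inj by (simp add: bij_betw_def)
  qed
  then show ?thesis
    unfolding quasi_iso_def by blast
qed

lemma quasi_isoD:
  assumes "chain_complex R X" "chain_complex R Y" "quasi_iso R X Y f"
  shows quasi_iso_map: "chain_map R X Y f"
    and quasi_iso_inj: "\<lbrakk>z \<in> cycles X i; f i z \<in> boundaries Y i\<rbrakk> \<Longrightarrow> z \<in> boundaries X i"
    and quasi_iso_surj: "w \<in> cycles Y i \<Longrightarrow> \<exists>z\<in>cycles X i. \<exists>b\<in>boundaries Y i. w = b \<oplus>\<^bsub>obj Y i\<^esub> f i z"
  using assms quasi_iso_iff by blast+

lemma quasi_iso_id:
  assumes X: "chain_complex R X" shows "quasi_iso R X X (\<lambda>i x. x)"
proof -
  have "\<exists>z\<in>cycles X i. \<exists>b\<in>boundaries X i. w = b \<oplus>\<^bsub>obj X i\<^esub> z" if "w \<in> cycles X i" for i w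
    using that X boundaries_zero[OF X]
    by (intro bexI[of _ w] bexI[of _ "\<zero>\<^bsub>obj X i\<^esub>"]) (simp_all add: cycles_iff mod_simps cpx_simps)
  then show ?thesis
    by (simp add: quasi_iso_iff[OF X X] chain_map_id)
qed

lemma quasi_iso_gcomp:
  assumes X: "chain_complex R X" and Y: "chain_complex R Y" and Z: "chain_complex R Z"
    and f: "quasi_iso R X Y f" and g: "quasi_iso R Y Z g"
  shows "quasi_iso R X Z (gcomp g f)"
proof -
  note fm = quasi_iso_map[OF X Y f] and gm = quasi_iso_map[OF Y Z g]
  have "\<exists>z\<in>cycles X i. \<exists>b\<in>boundaries Z i. w = b \<oplus>\<^bsub>obj Z i\<^esub> g i (f i z)" if "w \<in> cycles Z i" for i w
  proof -
    from quasi_iso_surj[OF Y Z g that] obtain y b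
      where y: "y \<in> cycles Y i" "b \<in> boundaries Z i" "w = b \<oplus>\<^bsub>obj Z i\<^esub> g i y"
      by (elim bexE)
    from quasi_iso_surj[OF X Y f y(1)] obtain z c
      where z: "z \<in> cycles X i" "c \<in> boundaries Y i" "y = c \<oplus>\<^bsub>obj Y i\<^esub> f i z"
      by (elim bexE)
    have "w = (b \<oplus>\<^bsub>obj Z i\<^esub> g i c) \<oplus>\<^bsub>obj Z i\<^esub> g i (f i z)"
      using y z X Y Z fm gm boundaries_closed[OF Z y(2)] boundaries_closed[OF Y z(2)]
      by (simp add: cmap_simps mod_ac cpx_simps mod_simps cycles_iff)
    moreover have "b \<oplus>\<^bsub>obj Z i\<^esub> g i c \<in> boundaries Z i"
      using y z by (simp add: boundaries_add[OF Z] chain_map_boundaries[OF Y gm])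
    ultimately show ?thesis
      using z(1) by blast
  qed
  moreover have "z \<in> boundaries X i" if "z \<in> cycles X i" "g i (f i z) \<in> boundaries Z i" for i z
    using that quasi_iso_inj[OF X Y f] quasi_iso_inj[OF Y Z g] chain_map_cycles[OF X Y fm] by blast
  ultimately show ?thesis
    using chain_map_gcomp[OF fm gm] by (simp add: quasi_iso_iff[OF X Z])
qed

text \<open>On a cycle \<open>z\<close> the homotopy gives \<open>f z = z + d (h z)\<close>, so
  \<open>f\<close> induces the identity on homology.\<close>

lemma quasi_iso_homotopic_id:
  assumes X: "chain_complex R X" and f: "chain_map R X X f" and hom: "homotopic R X X f (\<lambda>i x. x)"
  shows "quasi_iso R X X f"
proof -
  obtain h where h: "homotopy X X f (\<lambda>i x. x) h"
    using hom homotopic_iff[OF X X f chain_map_id] by blast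
  have eq: "f i z = z \<oplus>\<^bsub>obj X i\<^esub> dif X (i + 1) (h i z)" "h i z \<in> carrier (obj X (i + 1))"
    if "z \<in> cycles X i" for z i
    using htp_eq[OF h] htp_closed[OF h, of z i] that X
    by (simp_all add: cycles_iff htp_zero[OF h] mod_simps cpx_simps)
  have "z \<in> boundaries X i" if z: "z \<in> cycles X i" "f i z \<in> boundaries X i" for z i
  proof -
    have "z = f i z \<oplus>\<^bsub>obj X i\<^esub> \<ominus>\<^bsub>obj X i\<^esub> dif X (i + 1) (h i z)"
      unfolding eq(1)[OF z(1)] using eq(2)[OF z(1)] z X
      by (simp add: cycles_iff mod_simps cpx_simps mod_ac(1))
    then show ?thesis
      using boundaries_add[OF X z(2) boundaries_inv[OF X boundariesI[OF eq(2)[OF z(1)]]]] by simp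
  qed
  moreover have "\<exists>z\<in>cycles X i. \<exists>b\<in>boundaries X i. w = b \<oplus>\<^bsub>obj X i\<^esub> f i z"
    if w: "w \<in> cycles X i" for w i
  proof (rule bexI[OF bexI[OF _ boundaries_inv[OF X boundariesI[OF eq(2)[OF w]]]] w])
    show "w = \<ominus>\<^bsub>obj X i\<^esub> dif X (i + 1) (h i w) \<oplus>\<^bsub>obj X i\<^esub> f i w"
      unfolding eq(1)[OF w] using eq(2)[OF w] w X
      by (simp add: cycles_iff mod_simps cpx_simps mod_ac)
  qed
  ultimately show ?thesis
    using f by (simp add: quasi_iso_iff[OF X X])
qed

text \<open>The sign of the differential affects neither cycles nor boundaries, so only the degree
  moves.\<close>

lemma quasi_iso_shift:
  assumes X: "chain_complex R X" and Y: "chain_complex R Y" and f: "quasi_iso R X Y f"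
  shows "quasi_iso R (shift j X) (shift j Y) (shift_map j f)"
proof -
  note fm = quasi_iso_map[OF X Y f]
  have cyc: "cycles (shift j Z) i = cycles Z (i - j)" if Z: "chain_complex R Z" for Z :: "('a, 'c) cpx" and i
  proof -
    have "\<ominus>\<^bsub>obj Z (i - j - 1)\<^esub> dif Z (i - j) z = \<zero>\<^bsub>obj Z (i - j - 1)\<^esub> \<longleftrightarrow>
        dif Z (i - j) z = \<zero>\<^bsub>obj Z (i - j - 1)\<^esub>" if "z \<in> carrier (obj Z (i - j))" for z
      using that Z
      by (metis abelian_group.minus_minus cpx_dif_closed cpx_module mod_group mod_minus_zero)
    then show ?thesis
      by (auto simp: cycles_def algebra_simps)
  qed
  have bnd: "boundaries (shift j Z) i = boundaries Z (i - j)" if Z: "chain_complex R Z" for Z :: "('a, 'c) cpx" and i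
  proof -
    have "(\<lambda>z. \<ominus>\<^bsub>obj Z (i - j)\<^esub> dif Z (i - j + 1) z) ` carrier (obj Z (i - j + 1)) =
        dif Z (i - j + 1) ` carrier (obj Z (i - j + 1))"
    proof (intro equalityI subsetI)
      fix b assume "b \<in> dif Z (i - j + 1) ` carrier (obj Z (i - j + 1))"
      then have "\<ominus>\<^bsub>obj Z (i - j)\<^esub> b \<in> dif Z (i - j + 1) ` carrier (obj Z (i - j + 1))"
        and b: "b \<in> carrier (obj Z (i - j))"
        using boundaries_inv[OF Z, of b "i - j"] boundaries_closed[OF Z, of b "i - j"]
        by (simp_all add: boundaries_def)
      then obtain y where y: "y \<in> carrier (obj Z (i - j + 1))"
        "\<ominus>\<^bsub>obj Z (i - j)\<^esub> b = dif Z (i - j + 1) y"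
        by blast
      have "b = \<ominus>\<^bsub>obj Z (i - j)\<^esub> dif Z (i - j + 1) y"
        unfolding y(2)[symmetric] using b Z by (simp add: mod_simps cpx_simps)
      then show "b \<in> (\<lambda>z. \<ominus>\<^bsub>obj Z (i - j)\<^esub> dif Z (i - j + 1) z) ` carrier (obj Z (i - j + 1))"
        using y(1) by (rule image_eqI)
    next
      fix b assume "b \<in> (\<lambda>z. \<ominus>\<^bsub>obj Z (i - j)\<^esub> dif Z (i - j + 1) z) ` carrier (obj Z (i - j + 1))"
      then show "b \<in> dif Z (i - j + 1) ` carrier (obj Z (i - j + 1))"
        using boundaries_inv[OF Z, of _ "i - j"] by (auto simp: boundaries_def)
    qed
    then show ?thesis
      by (simp add: boundaries_def algebra_simps)
  qed
  have "chain_map R (shift j X) (shift j Y) (shift_map j f)"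
  proof (rule chain_mapI)
    show "shift_map j f i \<in> linear_maps R (obj (shift j X) i) (obj (shift j Y) i)" for i
      using cmap_lin[OF fm] by (simp add: shift_map_def)
  qed (use X Y fm in \<open>simp add: shift_map_def cmap_simps cpx_simps algebra_simps\<close>)
  then show ?thesis
    using quasi_iso_inj[OF X Y f] quasi_iso_surj[OF X Y f] X Y
    by (simp add: quasi_iso_iff chain_complex_shift cyc bnd shift_map_def)
qed

section \<open>Acyclic cones and bounded below complexes of projectives\<close>

definition acyclic_cpx :: "('a, 'c) cpx \<Rightarrow> bool" where
  "acyclic_cpx Z \<longleftrightarrow> chain_complex R Z \<and> (\<forall>i. cycles Z i \<subseteq> boundaries Z i)"

text \<open>Injectivity on homology removes the \<open>X\<close> component of a cycle
  \<open>(x, y)\<close>, and surjectivity disposes of what is left in \<open>Y\<close>.\<close>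

lemma acyclic_cone:
  assumes X: "chain_complex R X" and Y: "chain_complex R Y" and s: "quasi_iso R X Y s"
  shows "acyclic_cpx (cone X Y s)"
  unfolding acyclic_cpx_def
proof (intro conjI allI subsetI)
  note sm = quasi_iso_map[OF X Y s]
  show C: "chain_complex R (cone X Y s)"
    using chain_complex_cone[OF X Y sm] .
  fix i p assume p: "p \<in> cycles (cone X Y s) i"
  obtain x y where xy: "p = Couple x y" "x \<in> carrier (obj X (i - 1))" "y \<in> carrier (obj Y i)"
    using p by (auto simp: cycles_iff elim: sum_module_cases)
  have eq: "\<ominus>\<^bsub>obj X (i - 2)\<^esub> dif X (i - 1) x = \<zero>\<^bsub>obj X (i - 2)\<^esub>"
    "s (i - 1) x \<oplus>\<^bsub>obj Y (i - 1)\<^esub> dif Y i y = \<zero>\<^bsub>obj Y (i - 1)\<^esub>"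
    using p xy by (simp_all add: cycles_iff)
  have dx: "dif X (i - 1) x \<in> carrier (obj X (i - 2))"
    using X xy by (simp add: cpx_simps)
  have "dif X (i - 1) x = \<zero>\<^bsub>obj X (i - 2)\<^esub>"
    using eq(1) dx cpx_module[OF X, of "i - 2"] by (metis abelian_group.minus_minus mod_group mod_minus_zero)
  then have x_cyc: "x \<in> cycles X (i - 1)"
    using xy by (simp add: cycles_iff)
  have "dif Y i (\<ominus>\<^bsub>obj Y i\<^esub> y) = s (i - 1) x"
    using eq(2) mod_neg_unique[OF cpx_module[OF Y], of "dif Y i y" "i - 1" "s (i - 1) x"] xy X Y sm
    by (simp add: cpx_simps cmap_simps mod_ac)
  then have "s (i - 1) x \<in> boundaries Y (i - 1)"
    using boundariesI[of "\<ominus>\<^bsub>obj Y i\<^esub> y" Y "i - 1"] xy Y by (simp add: cpx_simps mod_simps)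
  \<comment> \<open>The cycle \<open>x\<close> is sent by \<open>s\<close> to the boundary of
    \<open>- y\<close>, so it is a boundary itself.\<close>
  then obtain x' where x': "x' \<in> carrier (obj X i)" "x = dif X i x'"
    using quasi_iso_inj[OF X Y s x_cyc] by (auto simp: boundaries_def)
  \<comment> \<open>Subtracting the boundary of \<open>(- x', 0)\<close> from \<open>(x, y)\<close>
    leaves \<open>(0, y + s x')\<close>.\<close>
  have w_cl: "y \<oplus>\<^bsub>obj Y i\<^esub> s i x' \<in> carrier (obj Y i)"
    using xy x' Y sm by (simp add: mod_simps cpx_simps cmap_simps)
  moreover have "dif Y i (y \<oplus>\<^bsub>obj Y i\<^esub> s i x') = \<zero>\<^bsub>obj Y (i - 1)\<^esub>"
    using eq(2) xy x' X Y sm by (simp add: mod_simps cpx_simps cmap_simps mod_ac)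
  ultimately have "y \<oplus>\<^bsub>obj Y i\<^esub> s i x' \<in> cycles Y i"
    by (simp add: cycles_iff)
  then obtain z b where z: "z \<in> cycles X i" and b: "b \<in> carrier (obj Y (i + 1))"
    and w: "y \<oplus>\<^bsub>obj Y i\<^esub> s i x' = dif Y (i + 1) b \<oplus>\<^bsub>obj Y i\<^esub> s i z"
    using quasi_iso_surj[OF X Y s] by (fastforce simp: boundaries_def)
  have zc: "z \<in> carrier (obj X i)" "dif X i z = \<zero>\<^bsub>obj X (i - 1)\<^esub>"
    using z by (simp_all add: cycles_iff)
  have "y = (y \<oplus>\<^bsub>obj Y i\<^esub> s i x') \<oplus>\<^bsub>obj Y i\<^esub> \<ominus>\<^bsub>obj Y i\<^esub> s i x'"
    using xy x' Y sm by (simp add: mod_simps cpx_simps cmap_simps mod_ac(1))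
  also have "\<dots> = s i (z \<oplus>\<^bsub>obj X i\<^esub> \<ominus>\<^bsub>obj X i\<^esub> x') \<oplus>\<^bsub>obj Y i\<^esub> dif Y (i + 1) b"
    unfolding w using zc x' X Y sm b by (simp add: mod_simps cpx_simps cmap_simps mod_ac)
  finally have y: "y = s i (z \<oplus>\<^bsub>obj X i\<^esub> \<ominus>\<^bsub>obj X i\<^esub> x') \<oplus>\<^bsub>obj Y i\<^esub> dif Y (i + 1) b" .
  have x: "\<ominus>\<^bsub>obj X (i - 1)\<^esub> dif X i (z \<oplus>\<^bsub>obj X i\<^esub> \<ominus>\<^bsub>obj X i\<^esub> x') = x"
    using zc x' X by (simp add: mod_simps cpx_simps)
  have "dif (cone X Y s) (i + 1) (Couple (z \<oplus>\<^bsub>obj X i\<^esub> \<ominus>\<^bsub>obj X i\<^esub> x') b) = p"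
    using x y xy(1) by simp
  moreover have "Couple (z \<oplus>\<^bsub>obj X i\<^esub> \<ominus>\<^bsub>obj X i\<^esub> x') b \<in> carrier (obj (cone X Y s) (i + 1))"
    using zc x' b X by (simp add: mod_simps cpx_simps)
  ultimately show "p \<in> boundaries (cone X Y s) i"
    using boundariesI by metis
qed

text \<open>Lifting is demanded whenever the image of \<open>f\<close> lies in the image of
  \<open>g\<close>; it then applies to a differential and its boundaries without making these a
  module of their own. The test modules live on the point type that carries all complexes.\<close>

definition projective :: "('a, ('a, 'c) point) module \<Rightarrow> bool" where
  "projective P \<longleftrightarrow> module R P \<and>
     (\<forall>(M :: ('a, ('a, 'c) point) module) (N :: ('a, ('a, 'c) point) module) g f.
        module R M \<longrightarrow> module R N \<longrightarrow> g \<in> linear_maps R M N \<longrightarrow> f \<in> linear_maps R P N \<longrightarrow>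
        f ` carrier P \<subseteq> g ` carrier M \<longrightarrow>
        (\<exists>h\<in>linear_maps R P M. \<forall>x\<in>carrier P. g (h x) = f x))"

lemma projectiveD:
  fixes P M N :: "('a, ('a, 'c) point) module"
  assumes "projective P" "module R M" "module R N" "g \<in> linear_maps R M N" "f \<in> linear_maps R P N"
    and "\<And>x. x \<in> carrier P \<Longrightarrow> f x \<in> g ` carrier M"
  obtains h where "h \<in> linear_maps R P M" "\<And>x. x \<in> carrier P \<Longrightarrow> g (h x) = f x"
proof -
  have "f ` carrier P \<subseteq> g ` carrier M"
    using assms(6) by (rule image_subsetI)
  then show thesis
    using assms(1)[unfolded projective_def, THEN conjunct2, rule_format, OF assms(2-5)] that by blast
qed

text \<open>The bound \<open>b\<close> gives the degreewise construction of homotopies a first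
  degree.\<close>

definition kproj :: "('a, 'c) cpx \<Rightarrow> bool" where
  "kproj P \<longleftrightarrow> chain_complex R P \<and> (\<forall>i. projective (obj P i)) \<and>
     (\<exists>b. \<forall>i<b. carrier (obj P i) = {\<zero>\<^bsub>obj P i\<^esub>})"

lemma kprojI:
  "\<lbrakk>chain_complex R P; \<And>i. projective (obj P i); \<forall>i<b. carrier (obj P i) = {\<zero>\<^bsub>obj P i\<^esub>}\<rbrakk> \<Longrightarrow> kproj P"
  by (auto simp: kproj_def)

lemma kproj_cpx: "kproj P \<Longrightarrow> chain_complex R P"
  by (simp add: kproj_def)

text \<open>The homotopy is built upwards from the lowest degree: the part of
  \<open>\<theta>\<close> not yet accounted for takes values in cycles, these are boundaries, and
  projectivity lifts it through the differential.\<close>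

lemma kproj_acyclic_null:
  fixes P Z :: "('a, 'c) cpx"
  assumes P: "kproj P" and Z: "acyclic_cpx Z" and \<theta>: "chain_map R P Z \<theta>"
  shows "homotopic R P Z \<theta> (zmap Z)"
proof -
  note PC = kproj_cpx[OF P]
  have ZC: "chain_complex R Z"
    using Z by (simp add: acyclic_cpx_def)
  obtain b where b: "\<And>i. i < b \<Longrightarrow> carrier (obj P i) = {\<zero>\<^bsub>obj P i\<^esub>}"
    using P unfolding kproj_def by blast
  \<comment> \<open>Here \<open>h\<close> is the component of the homotopy in degree
    \<open>b + n - 1\<close>, and the condition says that \<open>\<theta> - h d\<close> takes values
    in the cycles of degree \<open>b + n\<close>. The relation \<open>B\<close> is the homotopy
    equation in that degree.\<close>
  define A where "A = (\<lambda>n h. h \<in> linear_maps R (obj P (b + int n - 1)) (obj Z (b + int n)) \<and>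
    (\<forall>x\<in>carrier (obj P (b + int n)).
       dif Z (b + int n) (h (dif P (b + int n) x)) = \<theta> (b + int n - 1) (dif P (b + int n) x)))"
  define B where "B = (\<lambda>n h h'. \<forall>x\<in>carrier (obj P (b + int n)).
    \<theta> (b + int n) x = dif Z (b + int n + 1) (h' x) \<oplus>\<^bsub>obj Z (b + int n)\<^esub> h (dif P (b + int n) x))"
  have "\<exists>F. \<forall>n. A n (F n) \<and> B n (F n) (F (Suc n))"
  proof (rule dependent_nat_choice)
    \<comment> \<open>Degree \<open>b - 1\<close> of \<open>P\<close> is trivial, so the zero map
      starts the construction.\<close>
    have "dif P b x = \<zero>\<^bsub>obj P (b - 1)\<^esub>" if "x \<in> carrier (obj P b)" for x
      using cpx_dif_closed[OF PC that refl] b[of "b - 1"] by simp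
    then have "A 0 (\<lambda>_. \<zero>\<^bsub>obj Z (b + int 0)\<^esub>)"
      unfolding A_def using PC ZC \<theta> by (simp add: lin_const_zero cpx_simps cmap_simps)
    then show "\<exists>h. A 0 h" by (intro exI)
  next
    fix h n assume "A n h"
    let ?i = "b + int n"
    have h: "h \<in> linear_maps R (obj P (?i - 1)) (obj Z ?i)"
      and hd: "\<And>x. x \<in> carrier (obj P ?i) \<Longrightarrow> dif Z ?i (h (dif P ?i x)) = \<theta> (?i - 1) (dif P ?i x)"
      using \<open>A n h\<close> by (auto simp: A_def)
    define f where "f = (\<lambda>x. \<theta> ?i x \<ominus>\<^bsub>obj Z ?i\<^esub> h (dif P ?i x))"
    have hcl: "h (dif P ?i x) \<in> carrier (obj Z ?i)" if "x \<in> carrier (obj P ?i)" for x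
      using lin_closed[OF h cpx_dif_closed[OF PC that refl]] .
    have "f x \<in> dif Z (?i + 1) ` carrier (obj Z (?i + 1))" if x: "x \<in> carrier (obj P ?i)" for x
    proof -
      have "f x \<in> cycles Z ?i"
        using x hcl[OF x] hd[OF x] PC ZC \<theta> by (simp add: cycles_iff f_def mod_simps cpx_simps cmap_simps)
      then show ?thesis
        using Z by (auto simp: acyclic_cpx_def boundaries_def)
    qed
    moreover have "f \<in> linear_maps R (obj P ?i) (obj Z ?i)"
      unfolding f_def using lin_diff[OF cpx_module[OF ZC] cmap_lin[OF \<theta>] lin_comp[OF cpx_dif[OF PC] h]] .
    moreover have "dif Z (?i + 1) \<in> linear_maps R (obj Z (?i + 1)) (obj Z ?i)"
      using cpx_dif[OF ZC, of "?i + 1"] by simp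
    moreover have "projective (obj P ?i)"
      using P by (simp add: kproj_def)
    ultimately obtain h' where h': "h' \<in> linear_maps R (obj P ?i) (obj Z (?i + 1))"
      and dh': "\<And>x. x \<in> carrier (obj P ?i) \<Longrightarrow> dif Z (?i + 1) (h' x) = f x"
      using projectiveD[OF _ cpx_module[OF ZC] cpx_module[OF ZC], of "obj P ?i" "dif Z (?i + 1)" "?i + 1" ?i f]
      by blast
    have "A (Suc n) h'"
    proof -
      have "dif Z (?i + 1) (h' (dif P (?i + 1) x)) = \<theta> ?i (dif P (?i + 1) x)"
        if x: "x \<in> carrier (obj P (?i + 1))" for x
      proof -
        have dx: "dif P (?i + 1) x \<in> carrier (obj P ?i)"
          using PC x by (simp add: cpx_simps)
        have "dif P ?i (dif P (?i + 1) x) = \<zero>\<^bsub>obj P (?i - 1)\<^esub>"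
          using PC x by (simp add: cpx_simps)
        then show ?thesis
          using dx dh'[OF dx] lin_zero[OF cpx_module[OF PC] cpx_module[OF ZC] h] ZC \<theta>
          by (simp add: f_def mod_simps cpx_simps cmap_closed)
      qed
      then show ?thesis
        using h' by (simp add: A_def algebra_simps)
    qed
    moreover have "B n h h'"
      using dh' hcl ZC \<theta> by (simp add: B_def f_def mod_simps cpx_simps cmap_closed mod_ac(1))
    ultimately show "\<exists>h'. A (Suc n) h' \<and> B n h h'" by blast
  qed
  then obtain F where FA: "\<And>n. A n (F n)" and FB: "\<And>n. B n (F n) (F (Suc n))" by blast
  \<comment> \<open>The sequence \<open>F\<close> starts in degree \<open>b - 1\<close>, whence the
    index \<open>i + 1 - b\<close>; in lower degrees \<open>P\<close> is trivial and the zero map is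
    the right value.\<close>
  define h where "h = (\<lambda>i. if b \<le> i + 1 then F (nat (i + 1 - b)) else (\<lambda>_. \<zero>\<^bsub>obj Z (i + 1)\<^esub>))"
  have h_lin: "h i \<in> linear_maps R (obj P i) (obj Z (i + 1))" for i
    using FA[of "nat (i + 1 - b)"] lin_const_zero[OF cpx_module[OF ZC]]
    by (cases "b \<le> i + 1") (simp_all add: h_def A_def)
  have "homotopy P Z \<theta> (zmap Z) h"
  proof (rule homotopyI[OF h_lin])
    fix i x assume x: "x \<in> carrier (obj P i)"
    have dx: "dif P i x \<in> carrier (obj P (i - 1))"
      using PC x by (simp add: cpx_simps)
    have cl: "h i x \<in> carrier (obj Z (i + 1))" "h (i - 1) (dif P i x) \<in> carrier (obj Z i)"
      using lin_closed[OF h_lin x] lin_closed[OF h_lin dx] by simp_all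
    have "\<theta> i x = dif Z (i + 1) (h i x) \<oplus>\<^bsub>obj Z i\<^esub> h (i - 1) (dif P i x)"
    proof (cases "b \<le> i")
      case True
      then show ?thesis
        using FB[of "nat (i - b)"] x by (simp add: B_def h_def Suc_nat_eq_nat_zadd1 algebra_simps)
    next
      case False
      then have "x = \<zero>\<^bsub>obj P i\<^esub>" "dif P i x = \<zero>\<^bsub>obj P (i - 1)\<^esub>"
        using b[of i] b[of "i - 1"] x dx by auto
      then show ?thesis
        using lin_zero[OF cpx_module[OF PC] cpx_module[OF ZC] h_lin] PC ZC \<theta>
        by (simp add: cpx_simps mod_simps cmap_simps)
    qed
    then show "\<theta> i x = zmap Z i x \<oplus>\<^bsub>obj Z i\<^esub> (dif Z (i + 1) (h i x) \<oplus>\<^bsub>obj Z i\<^esub> h (i - 1) (dif P i x))"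
      using cl ZC by (simp add: zmap_def cpx_simps mod_simps)
  qed
  then show ?thesis
    using homotopic_iff[OF PC ZC \<theta> chain_map_zmap[OF ZC]] by blast
qed

lemma projective_module: "projective P \<Longrightarrow> module R P"
  by (simp add: projective_def)

lemma projective_sum_module:
  fixes P Q :: "('a, ('a, 'c) point) module"
  assumes P: "projective P" and Q: "projective Q" shows "projective (sum_module P Q)"
  unfolding projective_def
proof (intro conjI allI impI)
  note PM = projective_module[OF P] and QM = projective_module[OF Q]
  show "module R (sum_module P Q)"
    using sum_module[OF PM QM] .
  fix M N :: "('a, ('a, 'c) point) module" and g f
  assume M: "module R M" and N: "module R N" and g: "g \<in> linear_maps R M N"
    and f: "f \<in> linear_maps R (sum_module P Q) N" and sub: "f ` carrier (sum_module P Q) \<subseteq> g ` carrier M"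
  have "(\<lambda>x. Couple x \<zero>\<^bsub>Q\<^esub>) \<in> linear_maps R P (sum_module P Q)"
    "(\<lambda>y. Couple \<zero>\<^bsub>P\<^esub> y) \<in> linear_maps R Q (sum_module P Q)"
    using PM QM by (auto intro!: linI simp: mod_simps)
  note lins = this[THEN lin_comp, OF f]
  have "f (Couple x \<zero>\<^bsub>Q\<^esub>) \<in> g ` carrier M" if "x \<in> carrier P" for x
    using sub that QM by (auto simp: image_subset_iff mod_simps)
  then obtain h where h: "h \<in> linear_maps R P M" "\<And>x. x \<in> carrier P \<Longrightarrow> g (h x) = f (Couple x \<zero>\<^bsub>Q\<^esub>)"
    using projectiveD[OF P M N g lins(1)] by blast
  have "f (Couple \<zero>\<^bsub>P\<^esub> y) \<in> g ` carrier M" if "y \<in> carrier Q" for y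
    using sub that PM by (auto simp: image_subset_iff mod_simps)
  then obtain k where k: "k \<in> linear_maps R Q M" "\<And>y. y \<in> carrier Q \<Longrightarrow> g (k y) = f (Couple \<zero>\<^bsub>P\<^esub> y)"
    using projectiveD[OF Q M N g lins(2)] by blast
  show "\<exists>h\<in>linear_maps R (sum_module P Q) M. \<forall>p\<in>carrier (sum_module P Q). g (h p) = f p"
  proof (intro bexI[of _ "\<lambda>p. h (point_fst p) \<oplus>\<^bsub>M\<^esub> k (point_snd p)"] ballI)
    show "(\<lambda>p. h (point_fst p) \<oplus>\<^bsub>M\<^esub> k (point_snd p)) \<in> linear_maps R (sum_module P Q) M"
      using h(1) k(1) M by (intro linI) (auto elim!: sum_module_cases simp: lin_closed lin_add lin_smult mod_simps mod_ac)
    fix p assume "p \<in> carrier (sum_module P Q)"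
    then obtain x y where p: "p = Couple x y" "x \<in> carrier P" "y \<in> carrier Q"
      by (rule sum_module_cases)
    have "f p = f (Couple x \<zero>\<^bsub>Q\<^esub> \<oplus>\<^bsub>sum_module P Q\<^esub> Couple \<zero>\<^bsub>P\<^esub> y)"
      using p PM QM by (simp add: mod_simps)
    also have "\<dots> = f (Couple x \<zero>\<^bsub>Q\<^esub>) \<oplus>\<^bsub>N\<^esub> f (Couple \<zero>\<^bsub>P\<^esub> y)"
      using p PM QM by (subst lin_add[OF f]) (simp_all add: mod_simps)
    finally show "g (h (point_fst p) \<oplus>\<^bsub>M\<^esub> k (point_snd p)) = f p"
      using p h k by (simp add: lin_add[OF g] lin_closed)
  qed
qed

lemma kproj_sum_cpx:
  assumes P: "kproj P" and Q: "kproj Q" shows "kproj (sum_cpx P Q)"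
proof -
  obtain b c where b: "\<And>i. i < b \<Longrightarrow> carrier (obj P i) = {\<zero>\<^bsub>obj P i\<^esub>}"
    and c: "\<And>i. i < c \<Longrightarrow> carrier (obj Q i) = {\<zero>\<^bsub>obj Q i\<^esub>}"
    using P Q unfolding kproj_def by blast
  have "\<forall>i < min b c. carrier (obj (sum_cpx P Q) i) = {\<zero>\<^bsub>obj (sum_cpx P Q) i\<^esub>}"
    using b c by (auto simp: elim!: sum_module_cases)
  then show ?thesis
    by (rule kprojI[rotated 2]) (use P Q in \<open>auto simp: kproj_def chain_complex_sum_cpx projective_sum_module\<close>)
qed

lemma kproj_cone:
  assumes P: "kproj P" and Q: "kproj Q" and f: "chain_map R P Q f" shows "kproj (cone P Q f)"
proof -
  obtain b c where b: "\<And>i. i < b \<Longrightarrow> carrier (obj P i) = {\<zero>\<^bsub>obj P i\<^esub>}"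
    and c: "\<And>i. i < c \<Longrightarrow> carrier (obj Q i) = {\<zero>\<^bsub>obj Q i\<^esub>}"
    using P Q unfolding kproj_def by blast
  have "\<forall>i < min b c. carrier (obj (cone P Q f) i) = {\<zero>\<^bsub>obj (cone P Q f) i\<^esub>}"
    using b c by (auto simp: elim!: sum_module_cases)
  then show ?thesis
    by (rule kprojI[rotated 2]) (use P Q f in \<open>auto simp: kproj_def chain_complex_cone projective_sum_module\<close>)
qed

lemma kproj_shift: 
  assumes P: "kproj P" shows "kproj (shift j P)"
proof -
  obtain b where "\<And>i. i < b \<Longrightarrow> carrier (obj P i) = {\<zero>\<^bsub>obj P i\<^esub>}"
    using P unfolding kproj_def by blast
  then have "\<forall>i < b + j. carrier (obj (shift j P) i) = {\<zero>\<^bsub>obj (shift j P) i\<^esub>}"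
    by simp
  then show ?thesis
    by (rule kprojI[rotated 2]) (use P in \<open>auto simp: kproj_def chain_complex_shift\<close>)
qed

text \<open>The obstruction to lifting \<open>a\<close> through \<open>s\<close> is its image in the
  cone of \<open>s\<close>. The cone is acyclic, so this image is null homotopic, and the null
  homotopy contains the lift.\<close>

lemma kproj_lift:
  fixes P X Y :: "('a, 'c) cpx"
  assumes P: "kproj P" and X: "chain_complex R X" and Y: "chain_complex R Y"
    and s: "quasi_iso R X Y s" and a: "chain_map R P Y a"
  obtains c where "chain_map R P X c" "homotopic R P Y (gcomp s c) a"
proof -
  note sm = quasi_iso_map[OF X Y s]
  have "homotopic R P (cone X Y s) (gcomp (cone_incl X) a) (zmap (cone X Y s))"
    using kproj_acyclic_null[OF P acyclic_cone[OF X Y s]] chain_map_gcomp[OF a chain_map_cone_incl[OF X Y sm]]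
    by blast
  from cone_exact[OF kproj_cpx[OF P] X Y sm a this] obtain c where "chain_map R P X c" "homotopic R P Y a (gcomp s c)" .
  then show thesis
    using homotopic_sym[OF kproj_cpx[OF P] Y a chain_map_gcomp] sm that by blast
qed

text \<open>A null homotopy \<open>h\<close> of \<open>gcomp s c\<close> combines with
  \<open>c\<close> into a chain map from the shift of \<open>P\<close> to the cone of
  \<open>s\<close>. The cone is acyclic, so this map is null homotopic, and the \<open>X\<close>
  component of its null homotopy serves, up to sign, for \<open>c\<close>.\<close>

lemma kproj_lift_null:
  fixes P X Y :: "('a, 'c) cpx"
  assumes P: "kproj P" and X: "chain_complex R X" and Y: "chain_complex R Y"
    and s: "quasi_iso R X Y s" and c: "chain_map R P X c"
    and null: "homotopic R P Y (gcomp s c) (zmap Y)"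
  shows "homotopic R P X c (zmap X)"
proof -
  note sm = quasi_iso_map[OF X Y s] and PC = kproj_cpx[OF P]
  let ?C = "cone X Y s" and ?S = "shift 1 P"
  note C = chain_complex_cone[OF X Y sm] and S = chain_complex_shift[OF PC, of 1]
  obtain h where h: "homotopy P Y (gcomp s c) (zmap Y) h"
    using null homotopic_iff[OF PC Y chain_map_gcomp[OF c sm] chain_map_zmap[OF Y]] by blast
  \<comment> \<open>The sign of \<open>h\<close> fits the cone differential
    \<open>(- d x, s x + d y)\<close> and the negated differential of
    \<open>shift 1 P\<close>.\<close>
  define \<theta> where "\<theta> = (\<lambda>i x. Couple (c (i - 1) x) (\<ominus>\<^bsub>obj Y i\<^esub> h (i - 1) x))"
  have \<theta>: "chain_map R ?S ?C \<theta>"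
  proof (rule chain_mapI)
    show "\<theta> i \<in> linear_maps R (obj ?S i) (obj ?C i)" for i
      using PC X Y c sm by (intro linI)
        (simp_all add: \<theta>_def cmap_simps mod_simps cpx_simps htp_closed[OF h] htp_add[OF h] htp_smult[OF h] mod_ac)
    fix i x assume "x \<in> carrier (obj ?S i)"
    then have x: "x \<in> carrier (obj P (i - 1))" by simp
    have dx: "dif P (i - 1) x \<in> carrier (obj P (i - 2))"
      using PC x by (simp add: cpx_simps)
    have "s (i - 1) (c (i - 1) x) = dif Y i (h (i - 1) x) \<oplus>\<^bsub>obj Y (i - 1)\<^esub> h (i - 2) (dif P (i - 1) x)"
      using htp_eq[OF h x] x dx Y by (simp add: zmap_def cpx_simps mod_simps htp_closed[OF h])
    then show "\<theta> (i - 1) (dif ?S i x) = dif ?C i (\<theta> i x)"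
      using x dx PC X Y c sm
      by (simp add: \<theta>_def cpx_simps mod_simps cmap_simps[OF c] htp_closed[OF h] htp_inv[OF h] mod_ac mod_cancel)
  qed
  have "homotopic R ?S ?C \<theta> (zmap ?C)"
    by (rule kproj_acyclic_null[OF kproj_shift[OF P] acyclic_cone[OF X Y s] \<theta>])
  then obtain H where H: "homotopy ?S ?C \<theta> (zmap ?C) H"
    using homotopic_iff[OF S C \<theta> chain_map_zmap[OF C]] by blast
  \<comment> \<open>Degree \<open>i + 1\<close> of the shift is degree \<open>i\<close> of
    \<open>P\<close>.\<close>
  define k where "k = (\<lambda>i x. point_fst (H (i + 1) x))"
  define l where "l = (\<lambda>i x. point_snd (H (i + 1) x))"
  have Hkl: "H (i + 1) x = Couple (k i x) (l i x)" and k_closed: "k i x \<in> carrier (obj X (i + 1))"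
    and l_closed: "l i x \<in> carrier (obj Y (i + 2))" if "x \<in> carrier (obj P i)" for i x
    using sum_module_carrierE[of "H (i + 1) x" "obj X (i + 1)" "obj Y (i + 2)"]
      htp_closed[OF H, of x "i + 1" "i + 2"] that
    by (simp_all add: k_def l_def add.commute)
  have k_lin: "k i \<in> linear_maps R (obj P i) (obj X (i + 1))" for i
  proof (rule linI)
    note cl = mod_closed[OF cpx_module[OF PC]]
    show "k i (x \<oplus>\<^bsub>obj P i\<^esub> y) = k i x \<oplus>\<^bsub>obj X (i + 1)\<^esub> k i y"
      if "x \<in> carrier (obj P i)" "y \<in> carrier (obj P i)" for x y
      using that cl lin_add[OF htp_lin[OF H, of "i + 1"], of x y] by (simp add: Hkl) (simp add: add.commute)
    show "k i (r \<odot>\<^bsub>obj P i\<^esub> x) = r \<odot>\<^bsub>obj X (i + 1)\<^esub> k i x"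
      if "r \<in> carrier R" "x \<in> carrier (obj P i)" for r x
      using that cl lin_smult[OF htp_lin[OF H, of "i + 1"], of r x] by (simp add: Hkl) (simp add: add.commute)
  qed (rule k_closed)
  have "homotopy P X c (zmap X) (\<lambda>i x. \<ominus>\<^bsub>obj X (i + 1)\<^esub> k i x)"
  proof (rule homotopyI)
    show "(\<lambda>x. \<ominus>\<^bsub>obj X (i + 1)\<^esub> k i x) \<in> linear_maps R (obj P i) (obj X (i + 1))" for i
      by (rule lin_neg[OF cpx_module[OF X] k_lin])
    fix i x assume x: "x \<in> carrier (obj P i)"
    have dx: "dif P i x \<in> carrier (obj P (i - 1))"
      using PC x by (simp add: cpx_simps)
    then have dx': "\<ominus>\<^bsub>obj P (i - 1)\<^esub> dif P i x \<in> carrier (obj P (i - 1))"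
      using PC by (simp add: cpx_simps mod_simps)
    have neg: "k (i - 1) (\<ominus>\<^bsub>obj P (i - 1)\<^esub> dif P i x) = \<ominus>\<^bsub>obj X i\<^esub> k (i - 1) (dif P i x)"
      using lin_minus[OF cpx_module[OF PC] cpx_module[OF X] k_lin dx] by simp
    have cl: "dif X (i + 1) (k i x) \<in> carrier (obj X i)" "k (i - 1) (dif P i x) \<in> carrier (obj X i)"
      using k_closed[OF x] k_closed[OF dx] X by (simp_all add: cpx_simps)
    have "Couple (c i x) (\<ominus>\<^bsub>obj Y (i + 1)\<^esub> h i x) = Couple \<zero>\<^bsub>obj X i\<^esub> \<zero>\<^bsub>obj Y (i + 1)\<^esub> \<oplus>\<^bsub>sum_module (obj X i) (obj Y (i + 1))\<^esub>
       (dif ?C (i + 2) (Couple (k i x) (l i x)) \<oplus>\<^bsub>sum_module (obj X i) (obj Y (i + 1))\<^esub> H i (\<ominus>\<^bsub>obj P (i - 1)\<^esub> dif P i x))"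
      using htp_eq[OF H, of x "i + 1"] x by (simp add: Hkl \<theta>_def zmap_def) (simp add: add.commute)
    moreover have "H i (\<ominus>\<^bsub>obj P (i - 1)\<^esub> dif P i x) =
        Couple (\<ominus>\<^bsub>obj X i\<^esub> k (i - 1) (dif P i x)) (l (i - 1) (\<ominus>\<^bsub>obj P (i - 1)\<^esub> dif P i x))"
      using Hkl[OF dx'] neg by simp
    ultimately have "c i x = \<zero>\<^bsub>obj X i\<^esub> \<oplus>\<^bsub>obj X i\<^esub>
        (\<ominus>\<^bsub>obj X i\<^esub> dif X (i + 1) (k i x) \<oplus>\<^bsub>obj X i\<^esub> \<ominus>\<^bsub>obj X i\<^esub> k (i - 1) (dif P i x))"
      by (simp add: add.commute)
    then show "c i x = zmap X i x \<oplus>\<^bsub>obj X i\<^esub> (dif X (i + 1) (\<ominus>\<^bsub>obj X (i + 1)\<^esub> k i x) \<oplus>\<^bsub>obj X i\<^esub>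
        \<ominus>\<^bsub>obj X (i - 1 + 1)\<^esub> k (i - 1) (dif P i x))"
      using k_closed[OF x] X by (simp add: zmap_def cpx_simps)
  qed
  then show ?thesis
    using homotopic_iff[OF PC X c chain_map_zmap[OF X]] by blast
qed

lemma kproj_lift_unique:
  fixes P X Y :: "('a, 'c) cpx"
  assumes P: "kproj P" and X: "chain_complex R X" and Y: "chain_complex R Y"
    and s: "quasi_iso R X Y s" and c: "chain_map R P X c" and c': "chain_map R P X c'"
    and hom: "homotopic R P Y (gcomp s c) (gcomp s c')"
  shows "homotopic R P X c c'"
proof -
  note PC = kproj_cpx[OF P] and sm = quasi_iso_map[OF X Y s]
  note sc = chain_map_gcomp[OF c sm] and sc' = chain_map_gcomp[OF c' sm]
  note d = chain_map_gdiff[OF PC X c c'] and sd = chain_map_gdiff[OF PC Y sc sc']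
  have "gcomp s (gdiff X c c') i x = gdiff Y (gcomp s c) (gcomp s c') i x" if "x \<in> carrier (obj P i)" for i x
    using that X Y sm c c' by (simp add: gdiff_def mod_simps cpx_simps cmap_simps)
  then have "homotopic R P Y (gcomp s (gdiff X c c')) (gdiff Y (gcomp s c) (gcomp s c'))"
    using homotopic_cong[OF PC Y chain_map_gcomp[OF d sm] sd] by blast
  moreover have "homotopic R P Y (gdiff Y (gcomp s c) (gcomp s c')) (zmap Y)"
    using homotopic_gdiff_iff[OF PC Y sc sc'] hom by blast
  ultimately have "homotopic R P Y (gcomp s (gdiff X c c')) (zmap Y)"
    using homotopic_trans[OF PC Y chain_map_gcomp[OF d sm] sd chain_map_zmap[OF Y]] by blast
  then have "homotopic R P X (gdiff X c c') (zmap X)"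
    by (rule kproj_lift_null[OF P X Y s d])
  then show ?thesis
    using homotopic_gdiff_iff[OF PC X c c'] by blast
qed

end

context cring begin

section \<open>Maps from complexes of projectives in the derived category\<close>

text \<open>Homotopy bundled with its side conditions, so that chains of homotopies compose without
  restating that everything is a complex or a chain map.\<close>

definition heq :: "('a, 'c) cpx \<Rightarrow> ('a, 'c) cpx \<Rightarrow> ('a, 'c) gmap \<Rightarrow> ('a, 'c) gmap \<Rightarrow> bool" where
  "heq X Y f g \<longleftrightarrow> chain_complex R X \<and> chain_complex R Y \<and> chain_map R X Y f \<and> chain_map R X Y g \<and>
     homotopic R X Y f g"

lemma heqD:
  assumes "heq X Y f g"
  shows "chain_complex R X" "chain_complex R Y" "chain_map R X Y f" "chain_map R X Y g"
    "homotopic R X Y f g"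
  using assms by (auto simp: heq_def)

lemma heq_refl: "\<lbrakk>chain_complex R X; chain_complex R Y; chain_map R X Y f\<rbrakk> \<Longrightarrow> heq X Y f f"
  by (simp add: heq_def homotopic_refl)

lemma heq_cong:
  assumes "chain_complex R X" "chain_complex R Y" "chain_map R X Y f" "chain_map R X Y g"
    and "\<And>i x. x \<in> carrier (obj X i) \<Longrightarrow> f i x = g i x"
  shows "heq X Y f g"
  using homotopic_cong[OF assms] assms by (simp add: heq_def)

lemma heq_sym: "heq X Y f g \<Longrightarrow> heq X Y g f"
  unfolding heq_def by (simp add: homotopic_sym)

lemma heq_trans [trans]: "\<lbrakk>heq X Y f g; heq X Y g k\<rbrakk> \<Longrightarrow> heq X Y f k"
  unfolding heq_def by (blast intro: homotopic_trans)

lemma heq_comp_left: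
  "\<lbrakk>heq X Y f g; chain_complex R Z; chain_map R Y Z k\<rbrakk> \<Longrightarrow> heq X Z (gcomp k f) (gcomp k g)"
  unfolding heq_def by (blast intro: homotopic_comp_left chain_map_gcomp)

lemma heq_comp_right:
  "\<lbrakk>heq Y Z f g; chain_complex R X; chain_map R X Y k\<rbrakk> \<Longrightarrow> heq X Z (gcomp f k) (gcomp g k)"
  unfolding heq_def by (blast intro: homotopic_comp_right chain_map_gcomp)

lemma heq_comp_zmap:
  assumes "chain_complex R X" "chain_complex R Y" "chain_complex R Z" "chain_map R Y Z k"
  shows "heq X Z (gcomp k (zmap Y)) (zmap Z)"
  using assms chain_map_gcomp[OF chain_map_zmap assms(4)]
  by (intro heq_cong) (simp_all add: chain_map_zmap, simp add: zmap_def cmap_zero)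

lemma heq_lift:
  fixes P X Y :: "('a, 'c) cpx"
  assumes "kproj P" "chain_complex R X" "chain_complex R Y" "quasi_iso R X Y s" "chain_map R P Y a"
  obtains c where "chain_map R P X c" "heq P Y (gcomp s c) a"
proof -
  obtain c where c: "chain_map R P X c" "homotopic R P Y (gcomp s c) a"
    using kproj_lift[OF assms] .
  then have "heq P Y (gcomp s c) a"
    using assms chain_map_gcomp[OF c(1) quasi_iso_map[OF assms(2-4)]] by (simp add: heq_def kproj_cpx)
  with c(1) show thesis ..
qed

lemma heq_lift_unique:
  fixes P X Y :: "('a, 'c) cpx"
  assumes "kproj P" "chain_complex R X" "quasi_iso R X Y s" "chain_map R P X c" "chain_map R P X c'"
    and "heq P Y (gcomp s c) (gcomp s c')"
  shows "heq P X c c'"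
  using kproj_lift_unique[OF assms(1,2) heqD(2)[OF assms(6)] assms(3-5) heqD(5)[OF assms(6)]] assms
  by (simp add: heq_def kproj_cpx)

section \<open>Roofs acting on homotopy classes of maps\<close>

lemma roofsD:
  assumes "(W, s, f) \<in> roofs R X Y"
  shows "chain_complex R W" "quasi_iso R W X s" "chain_map R W Y f" "chain_map R W X s"
  using assms by (auto simp: roofs_def quasi_iso_def)

lemma roof_rel_roofs:
  "(r, r') \<in> roof_rel R X Y \<Longrightarrow> r \<in> roofs R X Y \<and> r' \<in> roofs R X Y"
  by (auto simp: roof_rel_def)

lemma roof_rel_refl:
  assumes X: "chain_complex R X" and Y: "chain_complex R Y" and r: "r \<in> roofs R X Y"
  shows "(r, r) \<in> roof_rel R X Y"
proof -
  obtain W s f where W: "r = (W, s, f)" by (cases r)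
  note d = roofsD[OF r[unfolded W]]
  have "homotopic R W X s s" "homotopic R W Y f f" "quasi_iso R W X s"
    using d X Y by (simp_all add: homotopic_refl)
  then show ?thesis
    unfolding roof_rel_def using r d chain_map_id[of W]
    by (simp add: W) (rule exI[of _ W], auto intro!: exI[of _ "\<lambda>i x. x"])
qed

text \<open>The common value is lifted to the complex \<open>V\<close> over both roofs. Its images
  under \<open>p\<close> and \<open>p'\<close> agree with \<open>c\<close> and \<open>c'\<close>,
  because lifts along \<open>s\<close> and \<open>s'\<close> are unique up to homotopy.\<close>

lemma roof_rel_value:
  fixes P :: "('a, 'c) cpx"
  assumes P: "kproj P" and X: "chain_complex R X" and Y: "chain_complex R Y"
    and rel: "((W, s, f), (W', s', f')) \<in> roof_rel R X Y"
    and c: "chain_map R P W c" and c': "chain_map R P W' c'"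
    and eq: "heq P X (gcomp s c) (gcomp s' c')"
  shows "heq P Y (gcomp f c) (gcomp f' c')"
proof -
  note PC = kproj_cpx[OF P]
  have r: "(W, s, f) \<in> roofs R X Y" and r': "(W', s', f') \<in> roofs R X Y"
    using roof_rel_roofs[OF rel] by auto
  note d = roofsD[OF r] and d' = roofsD[OF r']
  obtain V p p' where V: "chain_complex R V" and p: "chain_map R V W p" and p': "chain_map R V W' p'"
    and qi: "quasi_iso R V X (gcomp s p)"
    and homX: "homotopic R V X (gcomp s p) (gcomp s' p')"
    and homY: "homotopic R V Y (gcomp f p) (gcomp f' p')"
    using rel unfolding roof_rel_def by blast
  have heqX: "heq V X (gcomp s p) (gcomp s' p')" and heqY: "heq V Y (gcomp f p) (gcomp f' p')"
    using V X Y p p' d d' homX homY by (simp_all add: heq_def chain_map_gcomp)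
  obtain e where e: "chain_map R P V e" and se: "heq P X (gcomp (gcomp s p) e) (gcomp s c)"
    using heq_lift[OF P V X qi heqD(3)[OF eq]] .
  have "heq P W (gcomp p e) c"
    using heq_lift_unique[OF P d(1,2) chain_map_gcomp[OF e p] c] se by (simp add: gcomp_assoc)
  moreover have "heq P W' (gcomp p' e) c'"
  proof (rule heq_lift_unique[OF P d'(1,2) chain_map_gcomp[OF e p'] c'])
    show "heq P X (gcomp s' (gcomp p' e)) (gcomp s' c')"
      using heq_trans[OF heq_trans[OF heq_sym[OF heq_comp_right[OF heqX PC e]] se] eq]
      by (simp add: gcomp_assoc)
  qed
  ultimately have "heq P Y (gcomp f (gcomp p e)) (gcomp f c)" "heq P Y (gcomp f' (gcomp p' e)) (gcomp f' c')"
    using heq_comp_left Y d(3) d'(3) by blast+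
  moreover have "heq P Y (gcomp f (gcomp p e)) (gcomp f' (gcomp p' e))"
    using heq_comp_right[OF heqY PC e] by (simp add: gcomp_assoc)
  ultimately show ?thesis
    using heq_sym heq_trans by meson
qed

text \<open>The action of a morphism of the derived category on \<open>[P, _]\<close>.\<close>

definition hrel :: "('a, 'c) cpx \<Rightarrow> ('a, 'c) cpx \<Rightarrow> ('a, 'c) cpx \<Rightarrow> ('a, 'c) roof set \<Rightarrow>
    ('a, 'c) gmap \<Rightarrow> ('a, 'c) gmap \<Rightarrow> bool" where
  "hrel P X Y F x y \<longleftrightarrow> (\<exists>W s f c. (W, s, f) \<in> F \<and> chain_map R P W c \<and>
     heq P X (gcomp s c) x \<and> heq P Y (gcomp f c) y)"

lemma hrelD: "hrel P X Y F x y \<Longrightarrow> chain_complex R P \<and> chain_complex R X \<and> chain_complex R Y \<and>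
    chain_map R P X x \<and> chain_map R P Y y"
  unfolding hrel_def heq_def by blast

lemma hrel_cong: "\<lbrakk>hrel P X Y F x y; heq P X x x'; heq P Y y y'\<rbrakk> \<Longrightarrow> hrel P X Y F x' y'"
  unfolding hrel_def by (meson heq_trans)

lemma hrel_precomp:
  assumes F: "hrel P X Y F x y" and Q: "chain_complex R Q" and a: "chain_map R Q P a"
  shows "hrel Q X Y F (gcomp x a) (gcomp y a)"
proof -
  obtain W s f c where c: "(W, s, f) \<in> F" "chain_map R P W c" "heq P X (gcomp s c) x" "heq P Y (gcomp f c) y"
    using F unfolding hrel_def by blast
  have "chain_map R Q W (gcomp c a)" "heq Q X (gcomp s (gcomp c a)) (gcomp x a)"
    "heq Q Y (gcomp f (gcomp c a)) (gcomp y a)"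
    using chain_map_gcomp[OF a c(2)] heq_comp_right[OF c(3) Q a] heq_comp_right[OF c(4) Q a]
    by (simp_all add: gcomp_assoc)
  then show ?thesis
    unfolding hrel_def using c(1) by blast
qed

lemma derived_homE:
  assumes "F \<in> derived_hom R X Y"
  obtains r where "r \<in> roofs R X Y" "F = roof_rel R X Y `` {r}"
  using assms by (auto simp: derived_hom_def elim: quotientE)

lemma derived_hom_roofs: "F \<in> derived_hom R X Y \<Longrightarrow> F \<subseteq> roofs R X Y"
  by (auto elim!: derived_homE dest: roof_rel_roofs)

lemma derived_hom_nonempty:
  assumes "chain_complex R X" "chain_complex R Y" "F \<in> derived_hom R X Y"
  obtains W s f where "(W, s, f) \<in> F"
  using derived_homE[OF assms(3)] roof_rel_refl[OF assms(1,2)] by (metis Image_singleton_iff prod_cases3)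

lemma hrel_ex:
  fixes P :: "('a, 'c) cpx"
  assumes P: "kproj P" and X: "chain_complex R X" and Y: "chain_complex R Y"
    and F: "F \<in> derived_hom R X Y" and x: "chain_map R P X x"
  obtains y where "hrel P X Y F x y"
proof -
  obtain W s f where W: "(W, s, f) \<in> F"
    using derived_hom_nonempty[OF X Y F] .
  then have d: "(W, s, f) \<in> roofs R X Y"
    using derived_hom_roofs[OF F] by blast
  obtain c where c: "chain_map R P W c" "heq P X (gcomp s c) x"
    using heq_lift[OF P roofsD(1)[OF d] X roofsD(2)[OF d] x] .
  have "heq P Y (gcomp f c) (gcomp f c)"
    using heq_refl[OF kproj_cpx[OF P] Y chain_map_gcomp[OF c(1) roofsD(3)[OF d]]] .
  then show thesis
    using W c that unfolding hrel_def by blast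
qed

text \<open>Every member of the class is related to one generating roof, so each value is compared
  with the one computed through that roof.\<close>

lemma hrel_unique:
  fixes P :: "('a, 'c) cpx"
  assumes P: "kproj P" and F: "F \<in> derived_hom R X Y"
    and y: "hrel P X Y F x y" and y': "hrel P X Y F x' y'" and eq: "heq P X x x'"
  shows "heq P Y y y'"
proof -
  have X: "chain_complex R X" and Y: "chain_complex R Y"
    using hrelD[OF y] by auto
  obtain r where r: "r \<in> roofs R X Y" "F = roof_rel R X Y `` {r}"
    using derived_homE[OF F] .
  obtain W0 s0 f0 where W0: "r = (W0, s0, f0)" by (cases r)
  note d0 = roofsD[OF r(1)[unfolded W0]]
  have val: "heq P Y (gcomp f0 c0) z"
    if u: "hrel P X Y F u z" and c0: "chain_map R P W0 c0" "heq P X (gcomp s0 c0) u" for c0 u z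
  proof -
    obtain W s f c where c: "(W, s, f) \<in> F" "chain_map R P W c" "heq P X (gcomp s c) u" "heq P Y (gcomp f c) z"
      using u unfolding hrel_def by blast
    then have "((W0, s0, f0), (W, s, f)) \<in> roof_rel R X Y"
      using r(2) W0 by blast
    from roof_rel_value[OF P X Y this c0(1) c(2) heq_trans[OF c0(2) heq_sym[OF c(3)]]]
    show ?thesis
      using heq_trans c(4) by blast
  qed
  obtain c0 where c0: "chain_map R P W0 c0" "heq P X (gcomp s0 c0) x"
    using heq_lift[OF P d0(1) X d0(2), of x] hrelD[OF y] by blast
  show ?thesis
    using val[OF y c0] val[OF y' c0(1) heq_trans[OF c0(2) eq]] heq_sym heq_trans by blast
qed

lemma hrel_zero:
  fixes P :: "('a, 'c) cpx"
  assumes P: "kproj P" and F: "F \<in> derived_hom R X Y" and y: "hrel P X Y F x y"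
    and x: "heq P X x (zmap X)"
  shows "heq P Y y (zmap Y)"
proof -
  have X: "chain_complex R X" and Y: "chain_complex R Y"
    using hrelD[OF y] by auto
  obtain W s f where W: "(W, s, f) \<in> F"
    using derived_hom_nonempty[OF X Y F] .
  then have d: "(W, s, f) \<in> roofs R X Y"
    using derived_hom_roofs[OF F] by blast
  have "hrel P X Y F (zmap X) (zmap Y)"
    unfolding hrel_def using W chain_map_zmap[of W P] roofsD[OF d] heq_comp_zmap[OF kproj_cpx[OF P]] X Y
    by blast
  then show ?thesis
    using hrel_unique[OF P F y _ x] by blast
qed

lemma derived_map_mem:
  assumes "chain_complex R X" "chain_complex R Y" "chain_map R X Y g"
  shows "(X, \<lambda>i x. x, g) \<in> derived_map R X Y g"
  using assms roof_rel_refl[OF assms(1,2)] unfolding derived_map_def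
  by (simp add: roofs_def quasi_iso_id)

lemma derived_map_hom:
  assumes "chain_complex R X" "chain_complex R Y" "chain_map R X Y g"
  shows "derived_map R X Y g \<in> derived_hom R X Y"
  using assms unfolding derived_map_def derived_hom_def
  by (intro quotientI) (simp add: roofs_def quasi_iso_id)

lemma hrel_map:
  assumes "chain_complex R P" "chain_complex R X" "chain_complex R Y" "chain_map R X Y g" "chain_map R P X x"
  shows "hrel P X Y (derived_map R X Y g) x (gcomp g x)"
  unfolding hrel_def using derived_map_mem[OF assms(2-4)] assms
  by (intro exI[of _ X] exI[of _ "\<lambda>i x. x"] exI[of _ g] exI[of _ x]) (simp add: heq_refl chain_map_gcomp)

text \<open>The map \<open>x\<close> lifts to the apex \<open>U\<close> of some composite roof, and
  the image of this lift in \<open>Y\<close> is the intermediate value.\<close>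

lemma hrel_decomp:
  fixes P :: "('a, 'c) cpx"
  assumes P: "kproj P" and Y: "chain_complex R Y"
    and F: "F \<subseteq> roofs R X Y" and G: "G \<subseteq> roofs R Y Z"
    and z: "hrel P X Z (derived_comp R X Y Z G F) x z"
  obtains y where "hrel P X Y F x y" "hrel P Y Z G y z"
proof -
  note PC = kproj_cpx[OF P]
  have X: "chain_complex R X" and Z: "chain_complex R Z" and x: "chain_map R P X x"
    using hrelD[OF z] by auto
  obtain W1 s1 f1 c where c: "(W1, s1, f1) \<in> derived_comp R X Y Z G F" "chain_map R P W1 c"
    "heq P X (gcomp s1 c) x" "heq P Z (gcomp f1 c) z"
    using z unfolding hrel_def by blast
  obtain U p q W s f V t g where
    rel: "((U, gcomp s p, gcomp g q), (W1, s1, f1)) \<in> roof_rel R X Z"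
    and W: "(W, s, f) \<in> F" and V: "(V, t, g) \<in> G" and U: "chain_complex R U"
    and p: "quasi_iso R U W p" and q: "chain_map R U V q" and pq: "homotopic R U Y (gcomp f p) (gcomp t q)"
    using c(1) unfolding derived_comp_def by blast
  note dW = roofsD[OF subsetD[OF F W]] and dV = roofsD[OF subsetD[OF G V]]
    and dU = roofsD[OF conjunct1[OF roof_rel_roofs[OF rel]]]
  note pm = quasi_iso_map[OF U dW(1) p]
  obtain e where e: "chain_map R P U e" "heq P X (gcomp (gcomp s p) e) x"
    using heq_lift[OF P U X dU(2) x] .
  have "heq P Z (gcomp (gcomp g q) e) (gcomp f1 c)"
    using roof_rel_value[OF P X Z rel e(1) c(2)] heq_trans[OF e(2) heq_sym[OF c(3)]] by blast
  then have gz: "heq P Z (gcomp g (gcomp q e)) z"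
    using c(4) heq_trans by (simp add: gcomp_assoc) blast
  have fptq: "heq U Y (gcomp f p) (gcomp t q)"
    using U Y pq pm q dW dV by (simp add: heq_def chain_map_gcomp)
  then have ty: "heq P Y (gcomp t (gcomp q e)) (gcomp f (gcomp p e))"
    using heq_comp_right[OF heq_sym[OF fptq] PC e(1)] by (simp add: gcomp_assoc)
  show thesis
  proof
    have "heq P Y (gcomp f (gcomp p e)) (gcomp f (gcomp p e))"
      using heq_refl[OF PC Y] heqD(4)[OF ty] by blast
    then show "hrel P X Y F x (gcomp f (gcomp p e))"
      unfolding hrel_def using W chain_map_gcomp[OF e(1) pm] e(2) by (auto simp: gcomp_assoc)
    show "hrel P Y Z G (gcomp f (gcomp p e)) z"
      unfolding hrel_def using V chain_map_gcomp[OF e(1) q] ty gz by blast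
  qed
qed

text \<open>For a chain map \<open>g\<close> the square that defines the composite is completed by
  identities, which exhibits an explicit member of the composite class.\<close>

lemma hrel_postcomp:
  assumes F: "F \<subseteq> roofs R X Y" and y: "hrel P X Y F x y"
    and Z: "chain_complex R Z" and g: "chain_map R Y Z g"
  shows "hrel P X Z (derived_comp R X Y Z (derived_map R Y Z g) F) x (gcomp g y)"
proof -
  have X: "chain_complex R X" and Y: "chain_complex R Y"
    using hrelD[OF y] by auto
  obtain W s f c where c: "(W, s, f) \<in> F" "chain_map R P W c" "heq P X (gcomp s c) x" "heq P Y (gcomp f c) y"
    using y unfolding hrel_def by blast
  note d = roofsD[OF subsetD[OF F c(1)]]
  have "\<exists>U p q W' s' f' V t g'. (W, s, gcomp g f) = (U, gcomp s' p, gcomp g' q) \<and> (W', s', f') \<in> F \<and>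
      (V, t, g') \<in> derived_map R Y Z g \<and> chain_complex R U \<and>
       quasi_iso R U W' p \<and> chain_map R U V q \<and> homotopic R U Y (gcomp f' p) (gcomp t q)"
    using c(1) d X Y Z g derived_map_mem[OF Y Z g]
    by (intro exI[of _ W] exI[of _ "\<lambda>i x. x"] exI[of _ f] exI[of _ s] exI[of _ Y] exI[of _ g])
      (simp add: quasi_iso_id homotopic_refl)
  moreover have "((W, s, gcomp g f), (W, s, gcomp g f)) \<in> roof_rel R X Z"
    using d chain_map_gcomp[OF d(3) g] by (intro roof_rel_refl[OF X Z]) (simp add: roofs_def)
  ultimately have "(W, s, gcomp g f) \<in> derived_comp R X Y Z (derived_map R Y Z g) F"
    unfolding derived_comp_def by blast
  moreover have "heq P Z (gcomp (gcomp g f) c) (gcomp g y)"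
    using heq_comp_left[OF c(4) Z g] by (simp add: gcomp_assoc)
  ultimately show ?thesis
    unfolding hrel_def using c by blast
qed

text \<open>Both composites with the inverse are classes of identities, which relate every map to
  itself; decomposing this relation yields the map in between.\<close>

lemma derived_isoE:
  fixes P :: "('a, 'c) cpx"
  assumes P: "kproj P" and X: "chain_complex R X" and Y: "chain_complex R Y" and iso: "derived_iso R X Y F"
  obtains G where "G \<in> derived_hom R Y X"
    "\<And>x. chain_map R P X x \<Longrightarrow> \<exists>y. hrel P X Y F x y \<and> hrel P Y X G y x"
    "\<And>y. chain_map R P Y y \<Longrightarrow> \<exists>x. hrel P Y X G y x \<and> hrel P X Y F x y"
proof -
  note PC = kproj_cpx[OF P]
  obtain G where F: "F \<in> derived_hom R X Y" and G: "G \<in> derived_hom R Y X"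
    and GF: "derived_comp R X Y X G F = derived_map R X X (\<lambda>i x. x)"
    and FG: "derived_comp R Y X Y F G = derived_map R Y Y (\<lambda>i x. x)"
    using iso unfolding derived_iso_def by blast
  show thesis
  proof (rule that[OF G])
    fix x assume x: "chain_map R P X x"
    have "hrel P X X (derived_comp R X Y X G F) x x"
      using hrel_map[OF PC X X chain_map_id x] unfolding GF by simp
    then show "\<exists>y. hrel P X Y F x y \<and> hrel P Y X G y x"
      using hrel_decomp[OF P Y derived_hom_roofs[OF F] derived_hom_roofs[OF G]] by blast
  next
    fix y assume y: "chain_map R P Y y"
    have "hrel P Y Y (derived_comp R Y X Y F G) y y"
      using hrel_map[OF PC Y Y chain_map_id y] unfolding FG by simp
    then show "\<exists>x. hrel P Y X G y x \<and> hrel P X Y F x y"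
      using hrel_decomp[OF P X derived_hom_roofs[OF G] derived_hom_roofs[OF F]] by blast
  qed
qed

lemma derived_iso_hrel_surj:
  fixes P :: "('a, 'c) cpx"
  assumes P: "kproj P" and X: "chain_complex R X" and Y: "chain_complex R Y"
    and iso: "derived_iso R X Y F" and y: "chain_map R P Y y"
  obtains x where "hrel P X Y F x y"
proof -
  have "\<exists>x. hrel P X Y F x y"
  proof (rule derived_isoE[OF P X Y iso])
    fix G assume "\<And>y. chain_map R P Y y \<Longrightarrow> \<exists>x. hrel P Y X G y x \<and> hrel P X Y F x y"
    from this[OF y] show ?thesis by blast
  qed
  then show thesis
    using that by blast
qed

lemma derived_iso_hrel_inj:
  fixes P :: "('a, 'c) cpx"
  assumes P: "kproj P" and iso: "derived_iso R X Y F"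
    and y: "hrel P X Y F x y" and y': "hrel P X Y F x' y'" and eq: "heq P Y y y'"
  shows "heq P X x x'"
proof -
  have X: "chain_complex R X" and Y: "chain_complex R Y" and x: "chain_map R P X x" and x': "chain_map R P X x'"
    using hrelD[OF y] hrelD[OF y'] by auto
  have F: "F \<in> derived_hom R X Y"
    using iso by (simp add: derived_iso_def)
  obtain G where G: "G \<in> derived_hom R Y X"
    "\<And>x. chain_map R P X x \<Longrightarrow> \<exists>y. hrel P X Y F x y \<and> hrel P Y X G y x"
    by (rule derived_isoE[OF P X Y iso]) (rule that)
  obtain z where z: "hrel P X Y F x z" "hrel P Y X G z x"
    using G(2)[OF x] by blast
  obtain z' where z': "hrel P X Y F x' z'" "hrel P Y X G z' x'"
    using G(2)[OF x'] by blast
  have "heq P Y z y" "heq P Y y' z'"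
    using hrel_unique[OF P F z(1) y] hrel_unique[OF P F y' z'(1)] heq_refl[OF kproj_cpx[OF P] X] x x'
    by blast+
  then have "heq P Y z z'"
    using eq heq_trans by blast
  then show ?thesis
    using hrel_unique[OF P G(1) z(2) z'(2)] by blast
qed

text \<open>Exactness of \<open>[P, X] \<rightarrow> [P, Y] \<rightarrow> [P, Z]\<close> at the
  middle. The isomorphisms move the question to a cone triangle, where \<open>cone_exact\<close>
  answers it; surjectivity of \<open>\<alpha>\<close> and injectivity of \<open>\<beta>\<close> on
  classes of maps bring the factorization back.\<close>

lemma exact_triangle_hrel:
  fixes P :: "('a, 'c) cpx"
  assumes P: "kproj P" and tri: "exact_triangle R X Y Z u v w"
    and y: "hrel P Y Z v y z" and z: "heq P Z z (zmap Z)"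
  obtains x where "hrel P X Y u x y"
proof -
  note PC = kproj_cpx[OF P]
  obtain A B f \<alpha> \<beta> \<gamma> where X: "chain_complex R X" and Y: "chain_complex R Y" and Z: "chain_complex R Z"
    and u: "u \<in> derived_hom R X Y" and v: "v \<in> derived_hom R Y Z"
    and A: "chain_complex R A" and B: "chain_complex R B" and f: "chain_map R A B f"
    and \<alpha>: "derived_iso R X A \<alpha>" and \<beta>: "derived_iso R Y B \<beta>" and \<gamma>: "derived_iso R Z (cone A B f) \<gamma>"
    and sq1: "derived_comp R X Y B \<beta> u = derived_comp R X A B (derived_map R A B f) \<alpha>"
    and sq2: "derived_comp R Y Z (cone A B f) \<gamma> v =
          derived_comp R Y B (cone A B f) (derived_map R B (cone A B f) (cone_incl A)) \<beta>"
    using tri unfolding exact_triangle_def by blast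
  let ?C = "cone A B f"
  note C = chain_complex_cone[OF A B f] and incl = chain_map_cone_incl[OF A B f]
  have \<alpha>h: "\<alpha> \<in> derived_hom R X A" and \<beta>h: "\<beta> \<in> derived_hom R Y B" and \<gamma>h: "\<gamma> \<in> derived_hom R Z ?C"
    using \<alpha> \<beta> \<gamma> by (simp_all add: derived_iso_def)
  have ym: "chain_map R P Y y"
    using hrelD[OF y] by simp
  obtain b where b: "hrel P Y B \<beta> y b"
    using hrel_ex[OF P Y B \<beta>h ym] .
  have bm: "chain_map R P B b"
    using hrelD[OF b] by simp
  have "hrel P Y ?C (derived_comp R Y Z ?C \<gamma> v) y (gcomp (cone_incl A) b)"
    using hrel_postcomp[OF derived_hom_roofs[OF \<beta>h] b C incl] unfolding sq2 .
  then obtain z' where z': "hrel P Y Z v y z'" "hrel P Z ?C \<gamma> z' (gcomp (cone_incl A) b)"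
    using hrel_decomp[OF P Z derived_hom_roofs[OF v] derived_hom_roofs[OF \<gamma>h]] by blast
  have "heq P Z z' z"
    using hrel_unique[OF P v z'(1) y heq_refl[OF PC Y ym]] .
  then have "heq P ?C (gcomp (cone_incl A) b) (zmap ?C)"
    using hrel_zero[OF P \<gamma>h z'(2) heq_trans[OF _ z]] by blast
  then obtain a where a: "chain_map R P A a" "homotopic R P B b (gcomp f a)"
    using cone_exact[OF PC A B f bm] by (blast dest: heqD(5))
  have ba: "heq P B (gcomp f a) b"
    using a PC B bm chain_map_gcomp[OF a(1) f] by (simp add: heq_def homotopic_sym)
  obtain x where x: "hrel P X A \<alpha> x a"
    using derived_iso_hrel_surj[OF P X A \<alpha> a(1)] .
  have "hrel P X B (derived_comp R X Y B \<beta> u) x (gcomp f a)"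
    using hrel_postcomp[OF derived_hom_roofs[OF \<alpha>h] x B f] unfolding sq1 .
  then obtain y' where y': "hrel P X Y u x y'" "hrel P Y B \<beta> y' (gcomp f a)"
    using hrel_decomp[OF P Y derived_hom_roofs[OF u] derived_hom_roofs[OF \<beta>h]] by blast
  have "heq P Y y' y"
    using derived_iso_hrel_inj[OF P \<beta> y'(2) b ba] .
  moreover have "heq P X x x"
    using heq_refl[OF PC X] hrelD[OF x] by blast
  ultimately show thesis
    using hrel_cong[OF y'(1)] that by blast
qed

end

section \<open>Lech-independent sequences and thickenings\<close>

lemma (in cring) regular_module_inv [simp]: "\<ominus>\<^bsub>regular_module R\<^esub> Scalar \<zero> = Scalar \<zero>"
  using mod_minus_zero[OF regular_module] by simp

text \<open>Stated for any module with one element, since zero modules occur in several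
  representations.\<close>

lemma (in cring) projective_trivial:
  fixes P :: "('a, ('a, 'c) point) module"
  assumes P: "module R P" and triv: "carrier P = {\<zero>\<^bsub>P\<^esub>}"
  shows "projective P"
  unfolding projective_def
proof (intro conjI allI impI)
  fix M N :: "('a, ('a, 'c) point) module" and g f
  assume M: "module R M" and N: "module R N" and g: "g \<in> linear_maps R M N"
    and f: "f \<in> linear_maps R P N"
  show "\<exists>h\<in>linear_maps R P M. \<forall>x\<in>carrier P. g (h x) = f x"
    using lin_zero[OF P N f] lin_zero[OF M N g] lin_const_zero[OF M] triv
    by (intro bexI[of _ "\<lambda>_. \<zero>\<^bsub>M\<^esub>"]) auto
qed (rule P)

lemma (in cring) projective_zero_module: "projective (zero_module R :: ('a, ('a, 'c) point) module)"
  by (rule projective_trivial[OF zero_module]) simp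

lemma (in cring) projective_regular_module: "projective (regular_module R :: ('a, ('a, 'c) point) module)"
  unfolding projective_def
proof (intro conjI allI impI)
  fix M N :: "('a, ('a, 'c) point) module" and g f
  assume M: "module R M" and N: "module R N" and g: "g \<in> linear_maps R M N"
    and f: "f \<in> linear_maps R (regular_module R :: ('a, ('a, 'c) point) module) N"
    and sub: "f ` carrier (regular_module R) \<subseteq> g ` carrier M"
  obtain m where m: "m \<in> carrier M" "f (Scalar \<one>) = g m"
    using sub by (auto simp: image_subset_iff)
  show "\<exists>h\<in>linear_maps R (regular_module R :: ('a, ('a, 'c) point) module) M.
      \<forall>x\<in>carrier (regular_module R). g (h x) = f x"
  proof (intro bexI[of _ "\<lambda>x. the_scalar x \<odot>\<^bsub>M\<^esub> m"] ballI)
    show "(\<lambda>x. the_scalar x \<odot>\<^bsub>M\<^esub> m) \<in> linear_maps R (regular_module R) M"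
      using M m by (intro linI) (auto simp: mod_simps module.smult_l_distr[of R] module.smult_assoc1[of R])
    fix x assume "x \<in> carrier (regular_module R :: ('a, ('a, 'c) point) module)"
    then obtain r where r: "x = Scalar r" "r \<in> carrier R" by auto
    have "f (r \<odot>\<^bsub>regular_module R\<^esub> Scalar \<one>) = r \<odot>\<^bsub>N\<^esub> f (Scalar \<one>)"
      using lin_smult[OF f r(2), of "Scalar \<one>"] by simp
    then show "g (the_scalar x \<odot>\<^bsub>M\<^esub> m) = f x"
      using r m lin_smult[OF g] by simp
  qed
qed (rule regular_module)

lemma (in cring) chain_complex_zero_cpx: "chain_complex R (zero_cpx R :: ('a, 'c) cpx)"
  by (rule chain_complexI) (auto simp: zero_cpx_def zero_module intro!: linI)

lemma (in cring) chain_complex_ring_cpx: "chain_complex R (ring_cpx R :: ('a, 'c) cpx)"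
  by (rule chain_complexI) (auto simp: ring_cpx_def zero_module regular_module intro!: linI)

lemma (in cring) kproj_zero_cpx: "kproj (zero_cpx R :: ('a, 'c) cpx)"
  by (rule kprojI[of _ 0])
    (auto simp: chain_complex_zero_cpx projective_zero_module, auto simp: zero_cpx_def projective_zero_module)

lemma (in cring) kproj_ring_cpx: "kproj (ring_cpx R :: ('a, 'c) cpx)"
  by (rule kprojI[of _ 0])
    (auto simp: chain_complex_ring_cpx,
     auto simp: ring_cpx_def projective_zero_module projective_regular_module)

section \<open>Maps of sums and homotopy fibers\<close>

lemma (in cring) chain_map_pair:
  assumes "chain_map R P X f" "chain_map R P Y g"
  shows "chain_map R P (sum_cpx X Y) (\<lambda>i x. Couple (f i x) (g i x))"
  using assms by (intro chain_mapI linI) (simp_all add: cmap_simps)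

lemma (in cring) chain_map_fst:
  assumes "chain_complex R X" "chain_complex R Y"
  shows "chain_map R (sum_cpx X Y) X (\<lambda>i. point_fst)"
  using assms by (intro chain_mapI linI) (auto elim!: sum_module_cases)

lemma (in cring) chain_map_snd:
  assumes "chain_complex R X" "chain_complex R Y"
  shows "chain_map R (sum_cpx X Y) Y (\<lambda>i. point_snd)"
  using assms by (intro chain_mapI linI) (auto elim!: sum_module_cases)

lemma (in cring) chain_map_copair:
  assumes "chain_complex R X" "chain_complex R Y" "chain_complex R Z"
    "chain_map R X Z f" "chain_map R Y Z g"
  shows "chain_map R (sum_cpx X Y) Z (\<lambda>i p. f i (point_fst p) \<oplus>\<^bsub>obj Z i\<^esub> g i (point_snd p))"
  using assms
  by (intro chain_mapI linI) (auto elim!: sum_module_cases simp: cmap_simps cpx_simps mod_simps mod_ac)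

lemma (in cring) chain_map_neg:
  assumes "chain_complex R X" "chain_complex R Y" "chain_map R X Y f"
  shows "chain_map R X Y (\<lambda>i x. \<ominus>\<^bsub>obj Y i\<^esub> f i x)"
  using assms
  by (intro chain_mapI linI) (simp_all add: cmap_simps cpx_simps mod_simps mod_ac)

text \<open>The homotopy fiber, a rotation of the cone: maps to \<open>X\<close> that become null
  homotopic under \<open>f\<close> factor through its projection, up to homotopy. With this sign
  convention the differential extends that of \<open>X\<close> unchanged, see
  \<open>dif_fiber\<close>.\<close>

definition (in cring) fiber :: "('a, 'c) cpx \<Rightarrow> ('a, 'c) cpx \<Rightarrow> ('a, 'c) gmap \<Rightarrow> ('a, 'c) cpx" where
  "fiber X Y f = shift (- 1) (cone X Y f)"

lemma (in cring) obj_fiber [simp]: "obj (fiber X Y f) i = sum_module (obj X i) (obj Y (i + 1))"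
  by (simp add: fiber_def)

lemma (in cring) dif_fiber:
  assumes "chain_complex R X" "chain_complex R Y" "chain_map R X Y f"
    and "x \<in> carrier (obj X i)" "y \<in> carrier (obj Y (i + 1))"
  shows "dif (fiber X Y f) i (Couple x y) =
    Couple (dif X i x) (\<ominus>\<^bsub>obj Y i\<^esub> (f i x \<oplus>\<^bsub>obj Y i\<^esub> dif Y (i + 1) y))"
proof -
  have "dif X i x \<in> carrier (obj X (i - 1))" "f i x \<oplus>\<^bsub>obj Y i\<^esub> dif Y (i + 1) y \<in> carrier (obj Y i)"
    using assms by (simp_all add: cpx_simps mod_simps cmap_simps)
  then show ?thesis
    using assms by (simp add: fiber_def cpx_module mod_inv_closed abelian_group.minus_minus[OF mod_group])
qed

lemma (in cring) kproj_fiber: "\<lbrakk>kproj X; kproj Y; chain_map R X Y f\<rbrakk> \<Longrightarrow> kproj (fiber X Y f)"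
  by (simp add: fiber_def kproj_shift kproj_cone)

lemma (in cring) chain_map_fiber_fst:
  assumes "chain_complex R X" "chain_complex R Y" "chain_map R X Y f"
  shows "chain_map R (fiber X Y f) X (\<lambda>i. point_fst)"
  using assms by (intro chain_mapI linI) (auto elim!: sum_module_cases simp: dif_fiber)

text \<open>The second coordinate of the fiber, negated, is the null homotopy.\<close>

lemma (in cring) fiber_fst_null:
  assumes X: "chain_complex R X" and Y: "chain_complex R Y" and f: "chain_map R X Y f"
  shows "heq (fiber X Y f) Y (gcomp f (\<lambda>i. point_fst)) (zmap Y)"
proof -
  have F: "chain_complex R (fiber X Y f)"
    using assms by (simp add: fiber_def chain_complex_shift chain_complex_cone)
  have "homotopy (fiber X Y f) Y (gcomp f (\<lambda>i. point_fst)) (zmap Y) (\<lambda>i p. \<ominus>\<^bsub>obj Y (i + 1)\<^esub> point_snd p)"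
    using assms
    by (intro homotopyI linI)
      (auto elim!: sum_module_cases simp: dif_fiber zmap_def cpx_simps mod_simps cmap_simps mod_ac mod_cancel)
  then show ?thesis
    using F Y chain_map_gcomp[OF chain_map_fiber_fst[OF X Y f] f] chain_map_zmap[OF Y] homotopic_iff
    unfolding heq_def by blast
qed

text \<open>The injectivity of the conormal map in terms of elements: a relation with value zero has
  its coefficients in the ideal. Membership is spelled out as a combination of the generators, a
  form that carries over to modules.\<close>

locale lech_sequence = cring R for R (structure) +
  fixes xs :: "'a list"
  assumes xs_closed: "set xs \<subseteq> carrier R"
    and lech: "\<And>a. \<lbrakk>a \<in> {..<length xs} \<rightarrow> carrier R;
        (\<Oplus>i\<in>{..<length xs}. a i \<otimes> xs ! i) = \<zero>\<rbrakk> \<Longrightarrow>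
      \<forall>i<length xs. \<exists>b\<in>{..<length xs} \<rightarrow> carrier R. a i = (\<Oplus>j\<in>{..<length xs}. b j \<otimes> xs ! j)"
begin

section \<open>Modules with the Lech property\<close>

lemma nth_closed: "i < length xs \<Longrightarrow> xs ! i \<in> carrier R"
  using xs_closed nth_mem by blast

abbreviation idx :: "nat set" where "idx \<equiv> {..<length xs}"

definition comb :: "('a, 'm) module \<Rightarrow> (nat \<Rightarrow> 'm) \<Rightarrow> 'm" where
  "comb M v = finsum M (\<lambda>k. xs ! k \<odot>\<^bsub>M\<^esub> v k) idx"

text \<open>This is \<open>I M\<close>: as \<open>I\<close> is generated by \<open>xs\<close>, one
  coefficient in \<open>M\<close> for each generator suffices.\<close>

definition imult :: "('a, 'm) module \<Rightarrow> 'm set" where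
  "imult M = {comb M v | v. v \<in> idx \<rightarrow> carrier M}"

text \<open>The Lech condition with coefficients in \<open>M\<close>; for the regular module it is
  the assumption of the locale.\<close>

definition lech_module :: "('a, 'm) module \<Rightarrow> bool" where
  "lech_module M \<longleftrightarrow> module R M \<and>
     (\<forall>u\<in>idx \<rightarrow> carrier M. comb M u = \<zero>\<^bsub>M\<^esub> \<longrightarrow> (\<forall>k\<in>idx. u k \<in> imult M))"

lemma smult_idx_closed: "module R M \<Longrightarrow> v \<in> idx \<rightarrow> carrier M \<Longrightarrow> (\<lambda>k. xs ! k \<odot>\<^bsub>M\<^esub> v k) \<in> idx \<rightarrow> carrier M"
  by (auto simp: nth_closed mod_simps Pi_iff)

lemma comb_closed: "module R M \<Longrightarrow> v \<in> idx \<rightarrow> carrier M \<Longrightarrow> comb M v \<in> carrier M"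
  unfolding comb_def by (intro mod_finsum_closed smult_idx_closed)

lemma comb_cong: "module R M \<Longrightarrow> v \<in> idx \<rightarrow> carrier M \<Longrightarrow> (\<And>k. k \<in> idx \<Longrightarrow> u k = v k) \<Longrightarrow> comb M u = comb M v"
  unfolding comb_def using smult_idx_closed[of M v]
  by (intro abelian_monoid.finsum_cong'[OF mod_monoid]) auto

lemma lin_comb:
  assumes "module R M" "module R N" "f \<in> linear_maps R M N" "v \<in> idx \<rightarrow> carrier M"
  shows "f (comb M v) = comb N (\<lambda>k. f (v k))"
proof -
  have "f (comb M v) = finsum N (\<lambda>k. f (xs ! k \<odot>\<^bsub>M\<^esub> v k)) idx"
    unfolding comb_def using assms smult_idx_closed by (intro lin_finsum) auto
  also have "\<dots> = comb N (\<lambda>k. f (v k))"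
    unfolding comb_def using assms smult_idx_closed[OF assms(2), of "\<lambda>k. f (v k)"]
    by (intro abelian_monoid.finsum_cong'[OF mod_monoid]) (auto simp: lin_smult lin_closed nth_closed Pi_iff)
  finally show ?thesis .
qed

lemma imultI: "v \<in> idx \<rightarrow> carrier M \<Longrightarrow> comb M v \<in> imult M"
  by (auto simp: imult_def)

lemma imultE:
  assumes "x \<in> imult M" obtains v where "v \<in> idx \<rightarrow> carrier M" "x = comb M v"
  using assms by (auto simp: imult_def)

lemma imult_closed: "module R M \<Longrightarrow> x \<in> imult M \<Longrightarrow> x \<in> carrier M"
  by (auto simp: imult_def comb_closed)

lemma lin_imult:
  assumes "module R M" "module R N" "f \<in> linear_maps R M N" "x \<in> imult M" shows "f x \<in> imult N"
proof -
  obtain v where v: "v \<in> idx \<rightarrow> carrier M" "x = comb M v"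
    using assms(4) by (rule imultE)
  then have "(\<lambda>k. f (v k)) \<in> idx \<rightarrow> carrier N"
    using lin_closed[OF assms(3)] by auto
  then show ?thesis
    using v lin_comb[OF assms(1-3)] imultI[of "\<lambda>k. f (v k)"] by simp
qed

lemma imult_zero: "module R M \<Longrightarrow> \<zero>\<^bsub>M\<^esub> \<in> imult M"
  using imultI[of "\<lambda>_. \<zero>\<^bsub>M\<^esub>" M] lin_comb[OF _ _ lin_const_zero, of M M "\<lambda>_. \<zero>\<^bsub>M\<^esub>"]
  by (simp add: mod_simps)

lemma imult_inv: "module R M \<Longrightarrow> x \<in> imult M \<Longrightarrow> \<ominus>\<^bsub>M\<^esub> x \<in> imult M"
  using lin_imult[OF _ _ lin_neg[OF _ lin_id]] .

lemma lin_fst: "point_fst \<in> linear_maps R (sum_module M N) M"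
  by (intro linI) (auto elim!: sum_module_cases)

lemma lin_snd: "point_snd \<in> linear_maps R (sum_module M N) N"
  by (intro linI) (auto elim!: sum_module_cases)

lemma comb_sum_module:
  assumes "module R M" "module R N" "u \<in> idx \<rightarrow> carrier M" "v \<in> idx \<rightarrow> carrier N"
  shows "comb (sum_module M N) (\<lambda>k. Couple (u k) (v k)) = Couple (comb M u) (comb N v)"
proof -
  note S = sum_module[OF assms(1,2)]
  have cl: "(\<lambda>k. Couple (u k) (v k)) \<in> idx \<rightarrow> carrier (sum_module M N)"
    using assms(3,4) by (auto simp: Pi_iff)
  have "point_fst (comb (sum_module M N) (\<lambda>k. Couple (u k) (v k))) = comb M u"
    "point_snd (comb (sum_module M N) (\<lambda>k. Couple (u k) (v k))) = comb N v"
    using lin_comb[OF S assms(1) lin_fst cl] lin_comb[OF S assms(2) lin_snd cl] by simp_all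
  then show ?thesis
    using sum_module_carrierE(3)[OF comb_closed[OF S cl]] by simp
qed

lemma imult_sum_module:
  assumes "module R M" "module R N" "x \<in> imult M" "y \<in> imult N"
  shows "Couple x y \<in> imult (sum_module M N)"
proof -
  obtain u v where "u \<in> idx \<rightarrow> carrier M" "x = comb M u" "v \<in> idx \<rightarrow> carrier N" "y = comb N v"
    using assms(3,4) by (auto elim!: imultE)
  then show ?thesis
    using comb_sum_module[OF assms(1,2)] imultI[of "\<lambda>k. Couple (u k) (v k)" "sum_module M N"]
    by (simp add: Pi_iff)
qed

lemma lech_moduleD: "lech_module M \<Longrightarrow> u \<in> idx \<rightarrow> carrier M \<Longrightarrow> comb M u = \<zero>\<^bsub>M\<^esub> \<Longrightarrow> k \<in> idx \<Longrightarrow> u k \<in> imult M"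
  by (auto simp: lech_module_def)

lemma lech_moduleI:
  "module R M \<Longrightarrow> (\<And>u k. \<lbrakk>u \<in> idx \<rightarrow> carrier M; comb M u = \<zero>\<^bsub>M\<^esub>; k \<in> idx\<rbrakk> \<Longrightarrow> u k \<in> imult M) \<Longrightarrow> lech_module M"
  by (auto simp: lech_module_def)

lemma lech_sum_module:
  assumes M: "lech_module M" and N: "lech_module N" shows "lech_module (sum_module M N)"
proof (rule lech_moduleI)
  have MM: "module R M" and NM: "module R N"
    using M N by (simp_all add: lech_module_def)
  show S: "module R (sum_module M N)"
    using sum_module[OF MM NM] .
  fix u k assume u: "u \<in> idx \<rightarrow> carrier (sum_module M N)" "comb (sum_module M N) u = \<zero>\<^bsub>sum_module M N\<^esub>"
    and k: "k \<in> idx"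
  have "comb M (\<lambda>k. point_fst (u k)) = \<zero>\<^bsub>M\<^esub>" "comb N (\<lambda>k. point_snd (u k)) = \<zero>\<^bsub>N\<^esub>"
    using lin_comb[OF S MM lin_fst u(1)] lin_comb[OF S NM lin_snd u(1)] u(2) by simp_all
  moreover have "(\<lambda>k. point_fst (u k)) \<in> idx \<rightarrow> carrier M" "(\<lambda>k. point_snd (u k)) \<in> idx \<rightarrow> carrier N"
    using u(1) by (auto simp: Pi_iff dest: sum_module_carrierE)
  ultimately have "point_fst (u k) \<in> imult M" "point_snd (u k) \<in> imult N"
    using lech_moduleD[OF M _ _ k, of "\<lambda>k. point_fst (u k)"]
      lech_moduleD[OF N _ _ k, of "\<lambda>k. point_snd (u k)"] by simp_all
  then show "u k \<in> imult (sum_module M N)"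
    using imult_sum_module[OF MM NM] sum_module_carrierE(3)[OF funcset_mem[OF u(1) k]] by metis
qed

lemma lech_zero_module: "lech_module (zero_module R)"
proof (rule lech_moduleI[OF zero_module])
  fix u and k :: nat assume "u \<in> idx \<rightarrow> carrier (zero_module R)" "k \<in> idx"
  then have "u k = \<zero>\<^bsub>zero_module R\<^esub>" by (auto simp: Pi_iff)
  then show "u k \<in> imult (zero_module R)"
    using imult_zero[OF zero_module] by simp
qed

lemma comb_regular:
  assumes "a \<in> idx \<rightarrow> carrier R"
  shows "comb (regular_module R :: ('a, ('a, 'c) point) module) (\<lambda>k. Scalar (a k)) =
    Scalar (\<Oplus>i\<in>idx. a i \<otimes> xs ! i)"
proof -
  let ?A = "regular_module R :: ('a, ('a, 'c) point) module"

  have cl: "(\<lambda>i. a i \<otimes> xs ! i) \<in> idx \<rightarrow> carrier R"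
    using assms nth_closed by (auto simp: Pi_iff)
  have "Scalar (finsum R (\<lambda>i. a i \<otimes> xs ! i) idx) =
      finsum ?A (\<lambda>i. Scalar (a i \<otimes> xs ! i)) idx"
    using cl by (intro additive_finsum) (auto simp: abelian_monoid_axioms mod_monoid[OF regular_module])
  also have "\<dots> = comb ?A (\<lambda>k. Scalar (a k))"
    unfolding comb_def using assms nth_closed
    by (intro abelian_monoid.finsum_cong'[OF mod_monoid[OF regular_module]])
      (auto simp: Pi_iff m_comm)
  finally show ?thesis by (rule sym)
qed

lemma lech_regular_module: "lech_module (regular_module R :: ('a, ('a, 'c) point) module)"
proof (rule lech_moduleI[OF regular_module])
  let ?A = "regular_module R :: ('a, ('a, 'c) point) module"
  fix u k assume u: "u \<in> idx \<rightarrow> carrier ?A" "comb ?A u = \<zero>\<^bsub>?A\<^esub>"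
    and k: "k \<in> idx"
  define a where "a = (\<lambda>k. the_scalar (u k))"
  have "Scalar (a k) = u k \<and> a k \<in> carrier R" if "k \<in> idx" for k
    using funcset_mem[OF u(1) that] by (auto simp: a_def)
  then have a: "a \<in> idx \<rightarrow> carrier R" "\<And>k. k \<in> idx \<Longrightarrow> u k = Scalar (a k)"
    by auto
  have "Scalar (\<Oplus>i\<in>idx. a i \<otimes> xs ! i) = comb ?A (\<lambda>k. Scalar (a k))"
    by (rule comb_regular[OF a(1), symmetric])
  also have "\<dots> = comb ?A u"
    using a(2) by (intro comb_cong[OF regular_module u(1)]) simp
  finally have "(\<Oplus>i\<in>idx. a i \<otimes> xs ! i) = \<zero>"
    using u(2) by simp
  then obtain b where "b \<in> idx \<rightarrow> carrier R" "a k = (\<Oplus>j\<in>idx. b j \<otimes> xs ! j)"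
    using lech[OF a(1)] k by blast
  then show "u k \<in> imult ?A"
    using a(2)[OF k] comb_regular[of b, where 'c = 'c] imultI[of "\<lambda>k. Scalar (b k)" ?A]
    by (auto simp: Pi_iff)
qed

lemma lin_coord:
  fixes B :: "nat set set"
  defines "F \<equiv> free_module R B :: ('a, ('a, 'c) point) module"
    and "A \<equiv> regular_module R :: ('a, ('a, 'c) point) module"
  shows "(\<lambda>p. Scalar (the_coords p S)) \<in> linear_maps R F A"
  unfolding F_def A_def
  by (intro linI) (auto elim!: free_module_cases simp: free_points_closed)

text \<open>Membership in \<open>I F\<close> is tested in each coordinate: the coefficients found
  for the separate coordinates are assembled into one vector for each generator. As there are
  finitely many generators, \<open>B\<close> may be infinite.\<close>

lemma lech_free_module: "lech_module (free_module R B :: ('a, ('a, 'c) point) module)"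
proof (rule lech_moduleI[OF free_module])
  let ?F = "free_module R B :: ('a, ('a, 'c) point) module"
  let ?A = "regular_module R :: ('a, ('a, 'c) point) module"
  fix u k assume u: "u \<in> idx \<rightarrow> carrier ?F" "comb ?F u = \<zero>\<^bsub>?F\<^esub>" and k: "k \<in> idx"
  have "\<exists>b\<in>idx \<rightarrow> carrier R. the_coords (u k) S = (\<Oplus>j\<in>idx. b j \<otimes> xs ! j)" for S
  proof -
    have "(\<lambda>k. Scalar (the_coords (u k) S)) \<in> idx \<rightarrow> carrier ?A"
      using lin_closed[OF lin_coord funcset_mem[OF u(1)], of _ S] by (auto simp del: regular_module_simps)
    moreover have "comb ?A (\<lambda>k. Scalar (the_coords (u k) S)) = \<zero>\<^bsub>?A\<^esub>"
      using lin_comb[OF free_module regular_module lin_coord u(1), of S] u(2) by simp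
    ultimately have "Scalar (the_coords (u k) S) \<in> imult ?A"
      using lech_moduleD[OF lech_regular_module _ _ k, of "\<lambda>k. Scalar (the_coords (u k) S)"] by simp
    then obtain v where v: "v \<in> idx \<rightarrow> carrier ?A"
      "Scalar (the_coords (u k) S) = comb ?A v"
      by (rule imultE)
    define b where "b = (\<lambda>k. the_scalar (v k))"
    have "Scalar (b k) = v k \<and> b k \<in> carrier R" if "k \<in> idx" for k
      using funcset_mem[OF v(1) that] by (auto simp: b_def)
    then have b: "b \<in> idx \<rightarrow> carrier R" "\<And>k. k \<in> idx \<Longrightarrow> v k = Scalar (b k)"
      by auto
    have "Scalar (the_coords (u k) S) = comb ?A (\<lambda>k. Scalar (b k))"
      unfolding v(2) using b(2) by (intro comb_cong[OF regular_module v(1), symmetric]) simp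
    from trans[OF this comb_regular[OF b(1)]] show ?thesis
      using b(1) by blast
  qed
  then obtain b where b: "\<And>S. b S \<in> idx \<rightarrow> carrier R"
    "\<And>S. the_coords (u k) S = (\<Oplus>j\<in>idx. b S j \<otimes> xs ! j)"
    by metis
  \<comment> \<open>Cut off outside \<open>B\<close>, where elements of the free module
    vanish.\<close>
  define v :: "nat \<Rightarrow> ('a, 'c) point" where "v = (\<lambda>j. Coords (\<lambda>S. if S \<in> B then b S j else \<zero>))"
  have v: "v \<in> idx \<rightarrow> carrier ?F"
    using b(1) by (auto simp: v_def free_points_def Pi_iff)
  have coord: "the_coords (u k) S = the_coords (comb ?F v) S" for S
  proof (cases "S \<in> B")
    case True
    then have "Scalar (the_coords (comb ?F v) S) = comb ?A (\<lambda>k. Scalar (b S k))"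
      using lin_comb[OF free_module regular_module lin_coord v, of S] by (simp add: v_def)
    from trans[OF this comb_regular[OF b(1)]] show ?thesis
      using b(2) by simp
  next
    case False
    have "the_coords p S = \<zero>" if "p \<in> carrier ?F" for p :: "('a, 'c) point"
      using that False by (auto elim!: free_module_cases simp: free_points_zero)
    then show ?thesis
      using comb_closed[OF free_module v] funcset_mem[OF u(1) k] by simp
  qed
  have "u k = comb ?F v"
    using comb_closed[OF free_module v] funcset_mem[OF u(1) k] coord
    by (auto elim!: free_module_cases simp: fun_eq_iff)
  then show "u k \<in> imult ?F"
    using imultI[OF v] by simp
qed

text \<open>On these complexes both the lifting of maps and the reduction modulo \<open>I\<close>
  work, and the sums, fibers and cones formed in the induction stay among them.\<close>

definition good :: "('a, 'c) cpx \<Rightarrow> bool" where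
  "good P \<longleftrightarrow> kproj P \<and> (\<forall>i. lech_module (obj P i))"

lemma goodD: "good P \<Longrightarrow> kproj P" "good P \<Longrightarrow> chain_complex R P" "good P \<Longrightarrow> lech_module (obj P i)"
  by (simp_all add: good_def kproj_cpx)

lemma good_sum_cpx: "good P \<Longrightarrow> good Q \<Longrightarrow> good (sum_cpx P Q)"
  by (simp add: good_def kproj_sum_cpx lech_sum_module)

lemma good_cone: "good P \<Longrightarrow> good Q \<Longrightarrow> chain_map R P Q f \<Longrightarrow> good (cone P Q f)"
  by (simp add: good_def kproj_cone lech_sum_module)

lemma good_fiber: "good P \<Longrightarrow> good Q \<Longrightarrow> chain_map R P Q f \<Longrightarrow> good (fiber P Q f)"
  by (simp add: good_def kproj_fiber lech_sum_module)

lemma good_shift: "good P \<Longrightarrow> good (shift j P)"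
  by (simp add: good_def kproj_shift)

lemma good_zero_cpx: "good (zero_cpx R :: ('a, 'c) cpx)"
  unfolding good_def by (simp add: kproj_zero_cpx) (simp add: zero_cpx_def lech_zero_module)

lemma good_ring_cpx: "good (ring_cpx R :: ('a, 'c) cpx)"
  unfolding good_def
  by (simp add: kproj_ring_cpx) (simp add: ring_cpx_def lech_zero_module lech_regular_module)

lemma good_sum_of_shifts: "good (sum_of_shifts R js :: ('a, 'c) cpx)"
  by (induction js) (auto simp: good_zero_cpx good_ring_cpx good_shift good_sum_cpx)

text \<open>A chain map into such a complex kills \<open>d z\<close>; this is why a single Ext class
  already acts by zero there.\<close>

lemma sum_of_shifts_dif:
  fixes x :: "('a, 'c) point"
  shows "x \<in> carrier (obj (sum_of_shifts R js) i) \<Longrightarrow>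
    dif (sum_of_shifts R js) i x = \<zero>\<^bsub>obj (sum_of_shifts R js) (i - 1)\<^esub>"
proof (induction js arbitrary: x)
  case Nil
  then show ?case by (simp add: zero_cpx_def)
next
  case (Cons j js)
  have "dif (shift j (ring_cpx R)) i y = \<zero>\<^bsub>obj (shift j (ring_cpx R)) (i - 1)\<^esub>"
    if "y \<in> carrier (obj (shift j (ring_cpx R)) i)" for y :: "('a, 'c) point"
    using that
    by (cases "i - 1 = j") (auto simp: ring_cpx_def)
  then show ?case
    using Cons by (auto elim!: sum_module_cases)
qed

text \<open>\<open>x\<close> vanishes in the homology of \<open>P / I P\<close> if it is a cycle there; \<open>imult (obj P i)\<close> is \<open>I P\<^sub>i\<close>.\<close>

definition reduces :: "('a, 'c) cpx \<Rightarrow> int \<Rightarrow> ('a, 'c) point \<Rightarrow> bool" where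
  "reduces P i x \<longleftrightarrow> (\<exists>v\<in>carrier (obj P (i + 1)). \<exists>w\<in>imult (obj P i).
     x = dif P (i + 1) v \<oplus>\<^bsub>obj P i\<^esub> w)"

text \<open>Passing from \<open>z\<close> to the coefficient of \<open>x\<^sub>k\<close> in a representation of \<open>d z\<close> is the action of an
  element of \<open>Ext\<^sup>1(R/I, R/I)\<close> on the homology of \<open>P / I P\<close>; the deep elements of level \<open>n\<close> are
  obtained by \<open>n\<close> such steps.\<close>

inductive deep :: "('a, 'c) cpx \<Rightarrow> nat \<Rightarrow> int \<Rightarrow> ('a, 'c) point \<Rightarrow> bool" for P where
  deep_0: "z \<in> carrier (obj P i) \<Longrightarrow> deep P 0 i z"
| deep_Suc: "\<lbrakk>deep P n (i + 1) z; z \<in> carrier (obj P (i + 1)); t \<in> idx \<rightarrow> carrier (obj P i);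
    dif P (i + 1) z = comb (obj P i) t; k \<in> idx\<rbrakk> \<Longrightarrow> deep P (Suc n) i (t k)"

lemma deep_SucE:
  assumes "deep P (Suc n) i z"
  obtains z' t k where "deep P n (i + 1) z'" "z' \<in> carrier (obj P (i + 1))"
    "t \<in> idx \<rightarrow> carrier (obj P i)" "dif P (i + 1) z' = comb (obj P i) t" "k \<in> idx" "z = t k"
  using assms by (cases rule: deep.cases) auto

lemma chain_map_imult:
  "\<lbrakk>chain_complex R X; chain_complex R Y; chain_map R X Y f; w \<in> imult (obj X i)\<rbrakk> \<Longrightarrow> f i w \<in> imult (obj Y i)"
  using lin_imult[OF cpx_module cpx_module cmap_lin] .

text \<open>Because \<open>p z\<close> vanishes in homology modulo \<open>I\<close>,
  \<open>z\<close> lifts to an element \<open>y\<close> of the fiber whose boundary is a combination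
  of elements \<open>\<omega> k\<close> over \<open>t k\<close>. In the cone,
  \<open>\<omega> k\<close> bounds the image of \<open>t k\<close> up to the errors
  \<open>d (\<omega> k)\<close> and \<open>e (\<omega> k)\<close>, and the Lech property puts both
  into \<open>I\<close> times the module.\<close>

lemma reduces_step:
  fixes P Q E :: "('a, 'c) cpx"
  defines "F \<equiv> \<lambda>p. fiber P Q p"
  assumes P: "good P" and Q: "good Q" and p: "chain_map R P Q p" and E: "good E"
    and E0: "\<And>i x. x \<in> carrier (obj E i) \<Longrightarrow> dif E i x = \<zero>\<^bsub>obj E (i - 1)\<^esub>"
    and e: "chain_map R (F p) E e"
    and z: "z \<in> carrier (obj P (i + 1))" and t: "t \<in> idx \<rightarrow> carrier (obj P i)"
    and dz: "dif P (i + 1) z = comb (obj P i) t" and red: "reduces Q (i + 1) (p (i + 1) z)" and k: "k \<in> idx"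
  shows "reduces (cone (F p) (sum_cpx P E) (\<lambda>i x. Couple (point_fst x) (\<ominus>\<^bsub>obj E i\<^esub> e i x))) i
    (Couple \<zero>\<^bsub>obj (F p) (i - 1)\<^esub> (Couple (t k) \<zero>\<^bsub>obj E i\<^esub>))"
proof -
  note PC = goodD(2)[OF P] and QC = goodD(2)[OF Q] and EC = goodD(2)[OF E]
  have Fg: "good (F p)"
    unfolding F_def using good_fiber[OF P Q p] .
  note FC = goodD(2)[OF Fg]
  have obj_F: "obj (F p) i = sum_module (obj P i) (obj Q (i + 1))" for i
    by (simp add: F_def)
  obtain v w where v: "v \<in> carrier (obj Q (i + 2))" and w: "w \<in> imult (obj Q (i + 1))"
    and pz: "p (i + 1) z = dif Q (i + 2) v \<oplus>\<^bsub>obj Q (i + 1)\<^esub> w"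
    using red unfolding reduces_def by (auto simp: add.assoc)
  have "\<ominus>\<^bsub>obj Q (i + 1)\<^esub> w \<in> imult (obj Q (i + 1))"
    using imult_inv[OF cpx_module[OF QC] w] .
  then obtain s where s: "s \<in> idx \<rightarrow> carrier (obj Q (i + 1))" "\<ominus>\<^bsub>obj Q (i + 1)\<^esub> w = comb (obj Q (i + 1)) s"
    by (rule imultE)
  \<comment> \<open>Since \<open>p z = d v + w\<close> with \<open>w\<close> in \<open>I Q\<close>,
    the second coordinate of \<open>d y\<close> is \<open>- w\<close>, again a combination of the
    generators.\<close>
  define y where "y = Couple z (\<ominus>\<^bsub>obj Q (i + 2)\<^esub> v)"
  define \<omega> where "\<omega> = (\<lambda>k. Couple (t k) (s k))"
  have \<omega>: "\<omega> \<in> idx \<rightarrow> carrier (obj (F p) i)"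
    using t s(1) by (auto simp: \<omega>_def obj_F Pi_iff)
  have y: "y \<in> carrier (obj (F p) (i + 1))"
    using z v mod_inv_closed[OF cpx_module[OF QC] v] by (simp add: y_def obj_F add.assoc)
  have wc: "w \<in> carrier (obj Q (i + 1))"
    using imult_closed[OF cpx_module[OF QC] w] .
  have i2: "i + 1 + 1 = i + 2" by simp
  have vi: "\<ominus>\<^bsub>obj Q (i + 2)\<^esub> v \<in> carrier (obj Q (i + 2))"
    using mod_inv_closed[OF cpx_module[OF QC] v] .
  have dv: "dif Q (i + 2) v \<in> carrier (obj Q (i + 1))"
    using cpx_dif_closed[OF QC v, of "i + 1"] by simp
  have dvi: "dif Q (i + 2) (\<ominus>\<^bsub>obj Q (i + 2)\<^esub> v) = \<ominus>\<^bsub>obj Q (i + 1)\<^esub> dif Q (i + 2) v"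
    using cpx_dif_inv[OF QC v refl] by (simp add: add.commute)
  have "dif (F p) (i + 1) y = Couple (comb (obj P i) t) (\<ominus>\<^bsub>obj Q (i + 1)\<^esub> (p (i + 1) z \<oplus>\<^bsub>obj Q (i + 1)\<^esub> dif Q (i + 2) (\<ominus>\<^bsub>obj Q (i + 2)\<^esub> v)))"
    using dif_fiber[OF PC QC p z, unfolded i2, OF vi] dz by (simp add: y_def F_def)
  also have "p (i + 1) z \<oplus>\<^bsub>obj Q (i + 1)\<^esub> dif Q (i + 2) (\<ominus>\<^bsub>obj Q (i + 2)\<^esub> v) = w"
    unfolding pz dvi using dv wc QC by (simp add: cpx_module mod_simps mod_ac mod_cancel)
  also have "Couple (comb (obj P i) t) (\<ominus>\<^bsub>obj Q (i + 1)\<^esub> w) = comb (obj (F p) i) \<omega>"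
    using comb_sum_module[OF cpx_module[OF PC] cpx_module[OF QC] t s(1)] s(2) by (simp add: \<omega>_def obj_F)
  finally have dy: "dif (F p) (i + 1) y = comb (obj (F p) i) \<omega>" .
  \<comment> \<open>Applying the differential once more turns \<open>d y = comb \<omega>\<close>
    into a relation with value zero between the \<open>d (\<omega> k)\<close>.\<close>
  have "comb (obj (F p) (i - 1)) (\<lambda>k. dif (F p) i (\<omega> k)) = dif (F p) i (dif (F p) (i + 1) y)"
    using lin_comb[OF cpx_module[OF FC] cpx_module[OF FC] cpx_dif[OF FC] \<omega>] dy by simp
  also have "\<dots> = \<zero>\<^bsub>obj (F p) (i - 1)\<^esub>"
    using cpx_dif_dif[OF FC y, of i] by simp
  finally have "comb (obj (F p) (i - 1)) (\<lambda>k. dif (F p) i (\<omega> k)) = \<zero>\<^bsub>obj (F p) (i - 1)\<^esub>" .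
  moreover have "(\<lambda>k. dif (F p) i (\<omega> k)) \<in> idx \<rightarrow> carrier (obj (F p) (i - 1))"
    using \<omega> cpx_dif_closed[OF FC] by (auto simp: Pi_iff)
  ultimately have d\<omega>: "dif (F p) i (\<omega> k) \<in> imult (obj (F p) (i - 1))"
    using lech_moduleD[OF goodD(3)[OF Fg] _ _ k] by blast
  \<comment> \<open>The differential of \<open>E\<close> is zero, so \<open>e\<close> kills
    \<open>d y\<close>, and the \<open>e (\<omega> k)\<close> satisfy such a relation too.\<close>
  have "comb (obj E i) (\<lambda>k. e i (\<omega> k)) = e i (dif (F p) (i + 1) y)"
    using lin_comb[OF cpx_module[OF FC] cpx_module[OF EC] cmap_lin[OF e] \<omega>] dy by simp
  also have "\<dots> = \<zero>\<^bsub>obj E i\<^esub>"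
    using cmap_dif[OF e y, of i] E0[OF cmap_closed[OF e y refl]] by simp
  finally have "comb (obj E i) (\<lambda>k. e i (\<omega> k)) = \<zero>\<^bsub>obj E i\<^esub>" .
  moreover have "(\<lambda>k. e i (\<omega> k)) \<in> idx \<rightarrow> carrier (obj E i)"
    using \<omega> cmap_closed[OF e] by (auto simp: Pi_iff)
  ultimately have e\<omega>: "e i (\<omega> k) \<in> imult (obj E i)"
    using lech_moduleD[OF goodD(3)[OF E] _ _ k] by blast
  have \<omega>k: "\<omega> k \<in> carrier (obj (F p) i)" and tk: "t k \<in> carrier (obj P i)"
    using \<omega> t k by (auto simp: Pi_iff)
  note e\<omega>c = imult_closed[OF cpx_module[OF EC] e\<omega>] and d\<omega>c = imult_closed[OF cpx_module[OF FC] d\<omega>]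
  let ?S = "sum_cpx P E"
  let ?f = "\<lambda>i x. Couple (point_fst x) (\<ominus>\<^bsub>obj E i\<^esub> e i x)"
  let ?C = "cone (F p) ?S ?f"
  have SC: "chain_complex R ?S"
    using chain_complex_sum_cpx[OF PC EC] .
  \<comment> \<open>The boundary of \<open>V\<close> is
    \<open>(- d (\<omega> k), (t k, - e (\<omega> k)))\<close>; adding \<open>W\<close> cancels the
    first and the last entry.\<close>
  define V where "V = Couple (\<omega> k) \<zero>\<^bsub>obj ?S (i + 1)\<^esub>"
  define W where "W = Couple (dif (F p) i (\<omega> k)) (Couple \<zero>\<^bsub>obj P i\<^esub> (e i (\<omega> k)))"
  have "V \<in> carrier (obj ?C (i + 1))"
    using \<omega>k PC EC by (simp add: V_def cpx_simps mod_simps)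
  moreover have "W \<in> imult (obj ?C i)"
    unfolding W_def using imult_sum_module[OF cpx_module[OF FC] cpx_module[OF SC] d\<omega>]
      imult_sum_module[OF cpx_module[OF PC] cpx_module[OF EC] imult_zero[OF cpx_module[OF PC]] e\<omega>]
    by simp
  moreover have "Couple \<zero>\<^bsub>obj (F p) (i - 1)\<^esub> (Couple (t k) \<zero>\<^bsub>obj E i\<^esub>) = dif ?C (i + 1) V \<oplus>\<^bsub>obj ?C i\<^esub> W"
    using \<omega>k tk e\<omega>c d\<omega>c cpx_module[OF FC, of "i - 1"] PC EC
    by (simp add: V_def W_def cpx_simps mod_simps) (simp add: \<omega>_def cpx_simps mod_simps)
  ultimately show ?thesis
    unfolding reduces_def by blast
qed

text \<open>\<open>K\<close> is a summand of \<open>K \<oplus> N\<close>, which is isomorphic to a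
  sum \<open>E\<close> of shifts. As \<open>E\<close> consists of projectives, the inverse
  isomorphism is represented by a chain map out of \<open>E\<close>, and projecting it to
  \<open>K\<close> gives \<open>r\<close>.\<close>

lemma thickening_1_factor:
  fixes P K :: "('a, 'c) cpx"
  assumes P: "kproj P" and K: "K \<in> thickening R (Suc 0)" and \<kappa>: "chain_map R P K \<kappa>"
  obtains js e r where "chain_map R P (sum_of_shifts R js) e" "chain_map R (sum_of_shifts R js) K r"
    "heq P K (gcomp r e) \<kappa>"
proof -
  obtain N js F where KC: "chain_complex R K" and N: "chain_complex R N"
    and iso: "derived_iso R (sum_cpx K N) (sum_of_shifts R js) F"
    using K by (auto simp: derived_isomorphic_def)
  let ?E = "sum_of_shifts R js :: ('a, 'c) cpx" and ?S = "sum_cpx K N"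
  note S = chain_complex_sum_cpx[OF KC N] and PC = kproj_cpx[OF P]
  have E: "kproj ?E" and EC: "chain_complex R ?E"
    using goodD[OF good_sum_of_shifts] by auto
  have Fh: "F \<in> derived_hom R ?S ?E"
    using iso by (simp add: derived_iso_def)
  note fst = chain_map_fst[OF KC N]
  have \<kappa>1: "chain_map R P ?S (\<lambda>i x. Couple (\<kappa> i x) (zmap N i x))"
    using chain_map_pair[OF \<kappa> chain_map_zmap[OF N]] .
  obtain e where e: "hrel P ?S ?E F (\<lambda>i x. Couple (\<kappa> i x) (zmap N i x)) e"
    using hrel_ex[OF P S EC Fh \<kappa>1] .
  have em: "chain_map R P ?E e"
    using hrelD[OF e] by simp
  obtain x where x: "hrel ?E ?S ?E F x (\<lambda>i x. x)"
    using derived_iso_hrel_surj[OF E S EC iso chain_map_id] .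
  have xm: "chain_map R ?E ?S x"
    using hrelD[OF x] by simp
  have "hrel P ?S ?E F (gcomp x e) e"
    using hrel_precomp[OF x PC em] by simp
  then have "heq P ?S (gcomp x e) (\<lambda>i x. Couple (\<kappa> i x) (zmap N i x))"
    using derived_iso_hrel_inj[OF P iso _ e heq_refl[OF PC EC em]] by blast
  then have "heq P K (gcomp (\<lambda>i. point_fst) (gcomp x e)) (gcomp (\<lambda>i. point_fst) (\<lambda>i x. Couple (\<kappa> i x) (zmap N i x)))"
    by (rule heq_comp_left[OF _ KC fst])
  moreover have "gcomp (\<lambda>i. point_fst) (\<lambda>i x. Couple (\<kappa> i x) (zmap N i x)) = \<kappa>"
    by (simp add: fun_eq_iff)
  ultimately have "heq P K (gcomp (gcomp (\<lambda>i. point_fst) x) e) \<kappa>"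
    by (simp add: gcomp_assoc)
  then show thesis
    using that[OF em chain_map_gcomp[OF xm fst]] by blast
qed

lemma thickening_chain_complex:
  "M \<in> thickening R n \<Longrightarrow> chain_complex R M"
  by (cases "(R, n)" rule: thickening.cases) (auto simp: derived_isomorphic_def)

text \<open>In the step, \<open>P \<rightarrow> M \<rightarrow> N\<close> factors through some \<open>Q\<close> by induction.  On the fiber \<open>F\<close> of
  \<open>P \<rightarrow> Q\<close> the map to \<open>L \<oplus> M\<close> lifts to \<open>K\<close>, hence factors through a sum \<open>E\<close> of shifts of \<open>R\<close>,
  and the homotopy pushout of \<open>P\<close> and \<open>E\<close> along \<open>F\<close> is the required complex.\<close>

lemma thickening_reduces:
  fixes P M :: "('a, 'c) cpx"
  assumes "M \<in> thickening R n" "good P" "chain_map R P M a" "deep P n i z"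
  shows "\<exists>Q \<phi> b. good Q \<and> chain_map R P Q \<phi> \<and> chain_map R Q M b \<and> heq P M (gcomp b \<phi>) a \<and>
    reduces Q i (\<phi> i z)"
  using assms
proof (induction n arbitrary: M P a i z)
  case 0
  note P = \<open>good P\<close> and a = \<open>chain_map R P M a\<close>
  let ?O = "zero_cpx R :: ('a, 'c) cpx"
  obtain F where M: "chain_complex R M" and iso: "derived_iso R M ?O F"
    using 0 by (auto simp: derived_isomorphic_def)
  note OC = chain_complex_zero_cpx[where 'c = 'c] and PC = goodD(2)[OF P]
  have F: "F \<in> derived_hom R M ?O"
    using iso by (simp add: derived_iso_def)
  obtain y where y: "hrel P M ?O F a y"
    using hrel_ex[OF goodD(1)[OF P] M OC F a] .
  obtain y' where y': "hrel P M ?O F (zmap M) y'"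
    using hrel_ex[OF goodD(1)[OF P] M OC F chain_map_zmap[OF M]] .
  \<comment> \<open>All carriers of the zero complex are singletons, so \<open>a\<close> and the
    zero map have the same image under the isomorphism; hence \<open>a\<close> is null homotopic and
    factors through zero.\<close>
  have "heq P ?O y y'"
  proof (rule heq_cong[OF PC OC])
    show "y j x = y' j x" if "x \<in> carrier (obj P j)" for j x
      using cmap_closed[of P ?O y x j j] cmap_closed[of P ?O y' x j j] hrelD[OF y] hrelD[OF y'] that
      by (simp add: zero_cpx_def)
  qed (use hrelD[OF y] hrelD[OF y'] in auto)
  then have "heq P M (zmap M) a"
    using derived_iso_hrel_inj[OF goodD(1)[OF P] iso y y'] heq_sym by blast
  then have "heq P M (gcomp (zmap M) (zmap ?O)) a"
    by (simp add: gcomp_def zmap_def o_def)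
  moreover have "reduces ?O i (zmap ?O i z)"
    using imult_zero[of "zero_module R :: ('a, ('a, 'c) point) module", OF zero_module]
    by (auto simp: reduces_def zero_cpx_def zmap_def intro!: bexI[of _ "Scalar \<zero>"])
  ultimately show ?case
    using good_zero_cpx chain_map_zmap[OF OC] chain_map_zmap[OF M] by blast
next
  case (Suc n)
  note P = \<open>good P\<close> and a = \<open>chain_map R P M a\<close>
  note PK = goodD(1)[OF P] and PC = goodD(2)[OF P]
  obtain z' t k where z'd: "deep P n (i + 1) z'" and z': "z' \<in> carrier (obj P (i + 1))"
    and t: "t \<in> idx \<rightarrow> carrier (obj P i)" and dz': "dif P (i + 1) z' = comb (obj P i) t"
    and k: "k \<in> idx" and z: "z = t k"
    using Suc.prems(4) by (rule deep_SucE)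
  show ?case
  proof (cases n)
    case 0
    obtain js e r where e: "chain_map R P (sum_of_shifts R js) e" and r: "chain_map R (sum_of_shifts R js) M r"
      and re: "heq P M (gcomp r e) a"
      using thickening_1_factor[OF PK _ a] Suc.prems(1) 0 by blast
    let ?E = "sum_of_shifts R js :: ('a, 'c) cpx"
    note E = good_sum_of_shifts[of js, where 'c = 'c]
    note EC = goodD(2)[OF E]
    \<comment> \<open>The differential of \<open>?E\<close> is zero, so \<open>e\<close> kills
      \<open>d z'\<close>, and the images of the \<open>t k\<close> form a relation with value
      zero.\<close>
    have "comb (obj ?E i) (\<lambda>k. e i (t k)) = e i (dif P (i + 1) z')"
      using lin_comb[OF cpx_module[OF PC] cpx_module[OF EC] cmap_lin[OF e] t] dz' by simp
    also have "\<dots> = \<zero>\<^bsub>obj ?E i\<^esub>"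
      using cmap_dif[OF e z', of i] sum_of_shifts_dif[OF cmap_closed[OF e z' refl]] by simp
    finally have "comb (obj ?E i) (\<lambda>k. e i (t k)) = \<zero>\<^bsub>obj ?E i\<^esub>" .
    moreover have "(\<lambda>k. e i (t k)) \<in> idx \<rightarrow> carrier (obj ?E i)"
      using t cmap_closed[OF e] by (auto simp: Pi_iff)
    ultimately have ez: "e i z \<in> imult (obj ?E i)"
      unfolding z using lech_moduleD[OF goodD(3)[OF E] _ _ k] by blast
    have "e i z = dif ?E (i + 1) \<zero>\<^bsub>obj ?E (i + 1)\<^esub> \<oplus>\<^bsub>obj ?E i\<^esub> e i z"
      using imult_closed[OF cpx_module[OF EC] ez] EC by (simp add: cpx_simps mod_simps)
    then have "reduces ?E i (e i z)"
      using ez mod_zero_closed[OF cpx_module[OF EC]] unfolding reduces_def by blast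
    then show ?thesis
      using E e r re by blast
  next
    case (Suc l)
    obtain K L N u v w where L: "chain_complex R L" and tri: "exact_triangle R K (sum_cpx L M) N u v w"
      and K: "K \<in> thickening R (Suc 0)" and N: "N \<in> thickening R n"
      using \<open>M \<in> thickening R (Suc n)\<close> unfolding Suc thickening.simps by blast
    have M: "chain_complex R M"
      using thickening_chain_complex[OF \<open>M \<in> thickening R (Suc n)\<close>] .
    let ?Y = "sum_cpx L M"
    note Y = chain_complex_sum_cpx[OF L M]
    have KC: "chain_complex R K" and NC: "chain_complex R N" and u: "u \<in> derived_hom R K ?Y"
      and v: "v \<in> derived_hom R ?Y N"
      using tri by (simp_all add: exact_triangle_def)
    \<comment> \<open>Zero in the summand \<open>L\<close>, which the projection to \<open>M\<close>
      discards again at the end.\<close>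
    define y where "y = (\<lambda>i x. Couple (zmap L i x) (a i x))"
    have y: "chain_map R P ?Y y"
      unfolding y_def using chain_map_pair[OF chain_map_zmap[OF L] a] .
    obtain c where c: "hrel P ?Y N v y c"
      using hrel_ex[OF PK Y NC v y] .
    then have cm: "chain_map R P N c"
      using hrelD by blast
    obtain Q p b where Q: "good Q" and p: "chain_map R P Q p" and b: "chain_map R Q N b"
      and bp: "heq P N (gcomp b p) c" and red: "reduces Q (i + 1) (p (i + 1) z')"
      using Suc.IH[OF N P cm z'd] by blast
    note QC = goodD(2)[OF Q]
    let ?F = "fiber P Q p" and ?q = "\<lambda>i::int. point_fst :: ('a, 'c) point \<Rightarrow> ('a, 'c) point"
    note Fg = good_fiber[OF P Q p]
    note FK = goodD(1)[OF Fg] and FC = goodD(2)[OF Fg]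
    note q = chain_map_fiber_fst[OF PC QC p] and pq = fiber_fst_null[OF PC QC p]
    \<comment> \<open>On the fiber \<open>p\<close> is null homotopic, and therefore so is the map
      to \<open>N\<close>, which factors through \<open>p\<close>. Exactness then lifts the map into
      \<open>?Y\<close> to \<open>K\<close>.\<close>
    have "heq ?F N (gcomp c ?q) (gcomp (gcomp b p) ?q)"
      using heq_comp_right[OF heq_sym[OF bp] FC q] .
    moreover have "heq ?F N (gcomp b (gcomp p ?q)) (gcomp b (zmap Q))"
      using heq_comp_left[OF pq NC b] .
    moreover have "heq ?F N (gcomp b (zmap Q)) (zmap N)"
      using heq_comp_zmap[OF FC QC NC b] .
    ultimately have "heq ?F N (gcomp c ?q) (zmap N)"
      using heq_trans unfolding gcomp_assoc by blast
    then obtain \<kappa> where \<kappa>: "hrel ?F K ?Y u \<kappa> (gcomp y ?q)"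
      using exact_triangle_hrel[OF FK tri hrel_precomp[OF c FC q]] by blast
    then have \<kappa>m: "chain_map R ?F K \<kappa>"
      using hrelD by blast
    obtain js e r where e: "chain_map R ?F (sum_of_shifts R js) e" and r: "chain_map R (sum_of_shifts R js) K r"
      and re: "heq ?F K (gcomp r e) \<kappa>"
      using thickening_1_factor[OF FK K \<kappa>m] .
    let ?E = "sum_of_shifts R js :: ('a, 'c) cpx"
    note E = good_sum_of_shifts[of js, where 'c = 'c]
    note EK = goodD(1)[OF E] and EC = goodD(2)[OF E]
    obtain \<rho> where \<rho>: "hrel ?E K ?Y u r \<rho>"
      using hrel_ex[OF EK KC Y u r] .
    then have \<rho>m: "chain_map R ?E ?Y \<rho>"
      using hrelD by blast
    have \<rho>e: "heq ?F ?Y (gcomp \<rho> e) (gcomp y ?q)"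
      using hrel_unique[OF FK u hrel_precomp[OF \<rho> FC e] \<kappa> re] .
    let ?S = "sum_cpx P ?E" and ?f = "\<lambda>i x. Couple (point_fst x) (\<ominus>\<^bsub>obj ?E i\<^esub> e i x)"
    note S = chain_complex_sum_cpx[OF PC EC] and Sg = good_sum_cpx[OF P E]
    have f: "chain_map R ?F ?S ?f"
      using chain_map_pair[OF q chain_map_neg[OF FC EC e]] .
    \<comment> \<open>The two maps from the fiber to \<open>?Y\<close>, through \<open>P\<close> and
      through \<open>?E\<close>, are homotopic. The sign in \<open>?f\<close> turns this into a null
      homotopy of \<open>gcomp g ?f\<close>, so \<open>g\<close> extends to the cone.\<close>
    define g where "g = (\<lambda>i x. y i (point_fst x) \<oplus>\<^bsub>obj ?Y i\<^esub> \<rho> i (point_snd x))"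
    have g: "chain_map R ?S ?Y g"
      unfolding g_def using chain_map_copair[OF PC EC Y y \<rho>m] .
    have gf: "gcomp g ?f j x = gdiff ?Y (gcomp y ?q) (gcomp \<rho> e) j x" if "x \<in> carrier (obj ?F j)" for j x
      using that cmap_inv[OF \<rho>m EC Y cmap_closed[OF e that refl] refl] cpx_module[OF Y]
      by (simp add: g_def gdiff_def mod_minus_eq del: sum_cpx_simps)
    have gf0: "homotopic R ?F ?Y (gcomp g ?f) (zmap ?Y)"
    proof -
      note m1 = chain_map_gcomp[OF q y] and m2 = chain_map_gcomp[OF e \<rho>m]
      have "heq ?F ?Y (gcomp g ?f) (gdiff ?Y (gcomp y ?q) (gcomp \<rho> e))"
        using heq_cong[OF FC Y chain_map_gcomp[OF f g] chain_map_gdiff[OF FC Y m1 m2] gf] .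
      moreover have "heq ?F ?Y (gdiff ?Y (gcomp y ?q) (gcomp \<rho> e)) (zmap ?Y)"
        using homotopic_gdiff_iff[OF FC Y m1 m2] heqD(5)[OF heq_sym[OF \<rho>e]]
          FC Y chain_map_gdiff[OF FC Y m1 m2] chain_map_zmap[OF Y] by (simp add: heq_def)
      ultimately show ?thesis
        using heq_trans heqD(5) by blast
    qed
    let ?C = "cone ?F ?S ?f"
    note C = chain_complex_cone[OF FC S f] and Cg = good_cone[OF Fg Sg f]
    obtain h where h: "chain_map R ?C ?Y h"
      and hg: "\<And>j x. x \<in> carrier (obj ?S j) \<Longrightarrow> h j (cone_incl ?F j x) = g j x"
      using cone_extend[OF FC S Y f g gf0] by blast
    define \<phi> where "\<phi> = gcomp (cone_incl ?F) (\<lambda>i x. Couple x (zmap ?E i x))"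
    have \<phi>: "chain_map R P ?C \<phi>"
      unfolding \<phi>_def
      using chain_map_gcomp[OF chain_map_pair[OF chain_map_id chain_map_zmap[OF EC]] chain_map_cone_incl[OF FC S f]] .
    let ?b = "gcomp (\<lambda>i. point_snd) h"
    note b' = chain_map_gcomp[OF h chain_map_snd[OF L M]]
    have "gcomp ?b \<phi> j x = a j x" if x: "x \<in> carrier (obj P j)" for j x
    proof -
      have "h j (\<phi> j x) = g j (Couple x (zmap ?E j x))"
        unfolding \<phi>_def gcomp_apply using x EC by (intro hg) (simp add: zmap_def cpx_simps mod_simps)
      also have "\<dots> = y j x"
        using x cmap_zero[OF \<rho>m EC Y refl, of j] cmap_closed[OF y x refl] cpx_module[OF Y, of j]
        by (simp add: g_def zmap_def mod_simps del: sum_cpx_simps)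
      finally show ?thesis
        by (simp add: y_def)
    qed
    then have "heq P M (gcomp ?b \<phi>) a"
      using heq_cong[OF PC M chain_map_gcomp[OF \<phi> b'] a] by blast
    moreover have "reduces ?C i (\<phi> i z)"
      using reduces_step[OF P Q p E sum_of_shifts_dif e z' t dz' red k]
      by (simp add: \<phi>_def z zmap_def)
    ultimately show ?thesis
      using Cg \<phi> b' by blast
  qed
qed

end

section \<open>The Koszul complex\<close>

lemma (in ideal) finsum_mem:
  assumes "finite A" "f \<in> A \<rightarrow> I" shows "finsum R f A \<in> I"
  using assms
proof (induction A)
  case (insert a A)
  moreover from insert have "f \<in> A \<rightarrow> carrier R" "f a \<in> carrier R" "f a \<in> I" "f \<in> A \<rightarrow> I"
    by (simp_all add: Pi_iff Icarr)
  ultimately show ?case by simp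
qed simp

text \<open>The combinations of the generators form an ideal that contains them, and the generated
  ideal is the least such.\<close>

lemma (in cring) genideal_span:
  assumes xs: "set xs \<subseteq> carrier R" and y: "y \<in> Idl (set xs)"
  shows "\<exists>b\<in>{..<length xs} \<rightarrow> carrier R. y = (\<Oplus>j\<in>{..<length xs}. b j \<otimes> xs ! j)"
proof -
  define J where "J = {(\<Oplus>j\<in>{..<length xs}. b j \<otimes> xs ! j) | b. b \<in> {..<length xs} \<rightarrow> carrier R}"
  have nth: "xs ! j \<in> carrier R" if "j < length xs" for j
    using xs that nth_mem by blast
  have cl: "(\<lambda>j. b j \<otimes> xs ! j) \<in> {..<length xs} \<rightarrow> carrier R" if "b \<in> {..<length xs} \<rightarrow> carrier R" for b
    using that nth by (auto simp: Pi_iff)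
  have JI: "y \<in> J" if "y = (\<Oplus>j\<in>{..<length xs}. b j \<otimes> xs ! j)" "b \<in> {..<length xs} \<rightarrow> carrier R" for b y
    unfolding J_def mem_Collect_eq by (intro exI[of _ b] conjI that)
  have J_carr: "J \<subseteq> carrier R"
    using cl by (auto simp: J_def intro!: finsum_closed)
  have J_add: "s \<oplus> t \<in> J" if st: "s \<in> J" "t \<in> J" for s t
  proof -
    obtain b c where bc: "b \<in> {..<length xs} \<rightarrow> carrier R" "c \<in> {..<length xs} \<rightarrow> carrier R"
      "s = (\<Oplus>j\<in>{..<length xs}. b j \<otimes> xs ! j)" "t = (\<Oplus>j\<in>{..<length xs}. c j \<otimes> xs ! j)"
      using st unfolding J_def by blast
    have "s \<oplus> t = (\<Oplus>j\<in>{..<length xs}. (b j \<oplus> c j) \<otimes> xs ! j)"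
      unfolding bc(3,4) finsum_addf[OF cl[OF bc(1)] cl[OF bc(2)], symmetric]
      using bc(1,2) nth by (intro finsum_cong') (auto simp: l_distr Pi_iff)
    moreover have "(\<lambda>j. b j \<oplus> c j) \<in> {..<length xs} \<rightarrow> carrier R"
      using bc(1,2) by (auto simp: Pi_iff)
    ultimately show ?thesis
      by (rule JI)
  qed
  have J_mult: "r \<otimes> s \<in> J" if r: "r \<in> carrier R" and s: "s \<in> J" for r s
  proof -
    obtain b where b: "b \<in> {..<length xs} \<rightarrow> carrier R" "s = (\<Oplus>j\<in>{..<length xs}. b j \<otimes> xs ! j)"
      using s unfolding J_def by blast
    have "r \<otimes> s = (\<Oplus>j\<in>{..<length xs}. (r \<otimes> b j) \<otimes> xs ! j)"
      unfolding b(2) finsum_rdistr[OF finite_lessThan r cl[OF b(1)]]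
      using b(1) nth r by (intro finsum_cong') (auto simp: m_assoc Pi_iff)
    moreover have "(\<lambda>j. r \<otimes> b j) \<in> {..<length xs} \<rightarrow> carrier R"
      using b(1) r by (auto simp: Pi_iff)
    ultimately show ?thesis
      by (rule JI)
  qed
  have mem: "xs ! i \<in> J" if i: "i < length xs" for i
  proof -
    have "(\<Oplus>j\<in>{..<length xs}. (if i = j then \<one> else \<zero>) \<otimes> xs ! j) =
        (\<Oplus>j\<in>{..<length xs}. if i = j then xs ! j else \<zero>)"
      using nth by (intro finsum_cong') auto
    also have "\<dots> = xs ! i"
      using i nth by (intro finsum_singleton) auto
    finally have "xs ! i = (\<Oplus>j\<in>{..<length xs}. (if i = j then \<one> else \<zero>) \<otimes> xs ! j)" ..
    moreover have "(\<lambda>j. if i = j then \<one> else \<zero>) \<in> {..<length xs} \<rightarrow> carrier R" by auto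
    ultimately show ?thesis
      by (rule JI)
  qed
  have "(\<Oplus>j\<in>{..<length xs}. \<zero> \<otimes> xs ! j) = \<zero>"
    using finsum_cong'[of "{..<length xs}" "{..<length xs}" "\<lambda>_. \<zero>" "\<lambda>j. \<zero> \<otimes> xs ! j"] nth
    by (simp add: finsum_zero)
  then have "\<zero> \<in> J"
    by (intro JI[of _ "\<lambda>_. \<zero>"]) auto
  moreover have "\<ominus> s \<in> J" if "s \<in> J" for s
    using J_mult[OF _ that, of "\<ominus> \<one>"] J_carr that by (auto simp: l_minus)
  moreover have "s \<otimes> r \<in> J" if "r \<in> carrier R" "s \<in> J" for r s
    using J_mult[OF that] m_comm[of r s] J_carr that by auto
  ultimately have "ideal J R"
    using J_carr J_add J_mult
    by (intro idealI subgroup.intro) (auto simp: ring_axioms a_inv_def[symmetric] subset_iff)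
  moreover have "set xs \<subseteq> J"
    using mem by (auto simp: in_set_conv_nth)
  ultimately have "Idl (set xs) \<subseteq> J"
    by (rule genideal_minimal)
  then show ?thesis
    using y by (auto simp: J_def)
qed

text \<open>If the sum of the \<open>a i \<otimes> xs ! i\<close> is zero, the classes of the
  \<open>a i\<close> and the zero classes have the same image \<open>I \<cdot> I\<close> under the
  conormal map, so injectivity puts every \<open>a i\<close> into \<open>I\<close>.\<close>

lemma (in cring) lech_independent_sequence:
  assumes "lech_independent R xs" shows "lech_sequence R xs"
proof (intro_locales, rule lech_sequence_axioms.intro)
  show xs: "set xs \<subseteq> carrier R"
    using assms by (simp add: lech_independent_def)
  let ?N = "{..<length xs}"
  define I where "I = Idl (set xs)"
  interpret I: ideal I R
    unfolding I_def using genideal_ideal[OF xs] .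
  interpret II: ideal "I \<cdot> I" R
    using ideal_prod_is_ideal I.is_ideal by simp
  have inj: "inj_on (conormal_map R xs) (?N \<rightarrow>\<^sub>E carrier (R Quot I))"
    using assms by (simp add: lech_independent_def Let_def I_def bij_betw_def)
  have nth: "xs ! j \<in> carrier R" "xs ! j \<in> I" if "j < length xs" for j
    using xs that nth_mem genideal_self[OF xs] unfolding I_def by blast+
  have map: "conormal_map R xs (\<lambda>i\<in>?N. I +> a i) = I \<cdot> I"
    if a: "a \<in> ?N \<rightarrow> carrier R" and sum: "(\<Oplus>i\<in>?N. a i \<otimes> xs ! i) = \<zero>" for a
  proof -
    \<comment> \<open>Another choice of representatives changes the sum by terms
      \<open>h i \<otimes> xs ! i\<close> with \<open>h i\<close> in \<open>I\<close>, which lie in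
      \<open>I \<cdot> I\<close>; so all members of the union coincide.\<close>
    have "(I \<cdot> I) +> (\<Oplus>i\<in>?N. b i \<otimes> xs ! i) = I \<cdot> I" if b: "b \<in> Pi ?N (\<lambda>i\<in>?N. I +> a i)" for b
    proof (rule II.a_rcos_const)
      have "\<exists>h\<in>I. b i = h \<oplus> a i" if "i \<in> ?N" for i
        using b that by (force simp: a_r_coset_def' Pi_iff)
      then obtain h where h: "\<And>i. i \<in> ?N \<Longrightarrow> h i \<in> I \<and> b i = h i \<oplus> a i"
        by metis
      have cl: "(\<lambda>i. h i \<otimes> xs ! i) \<in> ?N \<rightarrow> carrier R" "(\<lambda>i. a i \<otimes> xs ! i) \<in> ?N \<rightarrow> carrier R"
        using a h nth I.Icarr by (auto simp: Pi_iff)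
      have "(\<Oplus>i\<in>?N. b i \<otimes> xs ! i) = (\<Oplus>i\<in>?N. h i \<otimes> xs ! i \<oplus> a i \<otimes> xs ! i)"
        using a h nth I.Icarr by (intro finsum_cong') (auto simp: l_distr Pi_iff)
      also have "\<dots> = (\<Oplus>i\<in>?N. h i \<otimes> xs ! i)"
        using sum cl by (simp add: finsum_addf)
      also have "\<dots> \<in> I \<cdot> I"
        using h nth by (intro II.finsum_mem) (auto intro: ideal_prod.prod)
      finally show "(\<Oplus>i\<in>?N. b i \<otimes> xs ! i) \<in> I \<cdot> I" .
    qed
    moreover have "a \<in> Pi ?N (\<lambda>i\<in>?N. I +> a i)"
      using a I.a_rcos_self by (auto simp: Pi_iff)
    ultimately show ?thesis
      unfolding conormal_map_def Let_def I_def[symmetric] by blast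
  qed
  fix a assume a: "a \<in> ?N \<rightarrow> carrier R" and sum: "(\<Oplus>i\<in>?N. a i \<otimes> xs ! i) = \<zero>"
  have "(\<Oplus>i\<in>?N. \<zero> \<otimes> xs ! i) = \<zero>"
    using finsum_cong'[of ?N ?N "\<lambda>_. \<zero>" "\<lambda>j. \<zero> \<otimes> xs ! j"] nth by (simp add: finsum_zero)
  then have "conormal_map R xs (\<lambda>i\<in>?N. I +> a i) = conormal_map R xs (\<lambda>i\<in>?N. I +> \<zero>)"
    using map[OF a sum] map[of "\<lambda>_. \<zero>"] by simp
  moreover have "(\<lambda>i\<in>?N. I +> b i) \<in> ?N \<rightarrow>\<^sub>E carrier (R Quot I)" if "b \<in> ?N \<rightarrow> carrier R" for b
    using that by (auto simp: FactRing_def A_RCOSETS_def' Pi_iff)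
  ultimately have eq: "(\<lambda>i\<in>?N. I +> a i) = (\<lambda>i\<in>?N. I +> \<zero>)"
    using a by (intro inj_onD[OF inj]) auto
  show "\<forall>i<length xs. \<exists>b\<in>?N \<rightarrow> carrier R. a i = (\<Oplus>j\<in>?N. b j \<otimes> xs ! j)"
  proof (intro allI impI)
    fix i assume i: "i < length xs"
    have "I +> a i = I +> \<zero>"
      using fun_cong[OF eq, of i] i by simp
    also have "\<dots> = I"
      by (rule I.a_rcos_const) simp
    finally have "a i \<in> I"
      using a i I.rcos_const_imp_mem by auto
    then show "\<exists>b\<in>?N \<rightarrow> carrier R. a i = (\<Oplus>j\<in>?N. b j \<otimes> xs ! j)"
      using genideal_span[OF xs] by (simp add: I_def)
  qed
qed

context cring
begin

section \<open>Finite free modules\<close>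

lemma lin_finsum_maps:
  assumes N: "module R N" and "finite A" "\<And>i. i \<in> A \<Longrightarrow> f i \<in> linear_maps R M N"
  shows "(\<lambda>x. finsum N (\<lambda>i. f i x) A) \<in> linear_maps R M N"
proof (rule linI)
  have fc: "f i x \<in> carrier N" if "i \<in> A" "x \<in> carrier M" for i x
    using lin_closed[OF assms(3)] that .
  show "finsum N (\<lambda>i. f i x) A \<in> carrier N" if "x \<in> carrier M" for x
    using N fc that by (intro mod_finsum_closed) auto
  show "finsum N (\<lambda>i. f i (x \<oplus>\<^bsub>M\<^esub> y)) A = finsum N (\<lambda>i. f i x) A \<oplus>\<^bsub>N\<^esub> finsum N (\<lambda>i. f i y) A"
    if "x \<in> carrier M" "y \<in> carrier M" for x y
  proof -
    have "finsum N (\<lambda>i. f i (x \<oplus>\<^bsub>M\<^esub> y)) A = finsum N (\<lambda>i. f i x \<oplus>\<^bsub>N\<^esub> f i y) A"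
      using N fc lin_add[OF assms(3)] that
      by (intro abelian_monoid.finsum_cong'[OF mod_monoid[OF N]]) (auto simp: mod_simps)
    also have "\<dots> = finsum N (\<lambda>i. f i x) A \<oplus>\<^bsub>N\<^esub> finsum N (\<lambda>i. f i y) A"
      using fc that by (intro abelian_monoid.finsum_addf[OF mod_monoid[OF N]]) auto
    finally show ?thesis .
  qed
  show "finsum N (\<lambda>i. f i (r \<odot>\<^bsub>M\<^esub> x)) A = r \<odot>\<^bsub>N\<^esub> finsum N (\<lambda>i. f i x) A"
    if "r \<in> carrier R" "x \<in> carrier M" for r x
  proof -
    have "r \<odot>\<^bsub>N\<^esub> finsum N (\<lambda>i. f i x) A = finsum N (\<lambda>i. r \<odot>\<^bsub>N\<^esub> f i x) A"
      using assms(2) fc that by (intro module.finsum_smult_ldistr[OF N]) auto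
    also have "\<dots> = finsum N (\<lambda>i. f i (r \<odot>\<^bsub>M\<^esub> x)) A"
      using N fc lin_smult[OF assms(3)] that
      by (intro abelian_monoid.finsum_cong'[OF mod_monoid[OF N]]) (auto simp: mod_simps)
    finally show ?thesis ..
  qed
qed

lemma lin_cong:
  assumes "f \<in> linear_maps R M N" "module R M" "\<And>x. x \<in> carrier M \<Longrightarrow> g x = f x"
  shows "g \<in> linear_maps R M N"
  using assms by (intro linI) (simp_all add: lin_closed lin_add lin_smult mod_simps)

lemma lin_scale:
  assumes "module R N" "f \<in> linear_maps R M N" "r \<in> carrier R"
  shows "(\<lambda>x. r \<odot>\<^bsub>N\<^esub> f x) \<in> linear_maps R M N"
proof (rule linI)
  show "r \<odot>\<^bsub>N\<^esub> f (s \<odot>\<^bsub>M\<^esub> x) = s \<odot>\<^bsub>N\<^esub> (r \<odot>\<^bsub>N\<^esub> f x)" if "s \<in> carrier R" "x \<in> carrier M" for s x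
    using assms that
    by (simp add: lin_smult lin_closed module.smult_assoc1[of R, symmetric] m_comm)
qed (use assms in \<open>simp_all add: lin_closed lin_add mod_simps\<close>)

definition unit_point :: "nat set \<Rightarrow> ('a, 'c) point" where
  "unit_point S = Coords (\<lambda>T. if T = S then \<one> else \<zero>)"

lemma unit_point_closed: "S \<in> B \<Longrightarrow> unit_point S \<in> carrier (free_module R B)"
  by (simp add: unit_point_def free_points_def)

lemma coords_finsum:
  fixes u :: "'i \<Rightarrow> ('a, 'c) point"
  assumes "finite A" "u \<in> A \<rightarrow> carrier (free_module R B)"
  shows "the_coords (finsum (free_module R B) u A) T = (\<Oplus>i\<in>A. the_coords (u i) T)"
  using assms
  by (intro additive_finsum) (auto simp: mod_monoid[OF free_module] abelian_monoid_axioms free_points_closed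
      elim!: free_module_cases)

lemma free_module_eqI:
  assumes "p \<in> carrier (free_module R B)" "q \<in> carrier (free_module R B)"
    and "\<And>S. the_coords p S = the_coords q S"
  shows "p = q"
  using assms by (auto elim!: free_module_cases)

lemma free_module_expand:
  fixes p :: "('a, 'c) point"
  assumes B: "finite B" and p: "p \<in> carrier (free_module R B)"
  shows "p = finsum (free_module R B) (\<lambda>S. the_coords p S \<odot>\<^bsub>free_module R B\<^esub> unit_point S) B"
proof (rule free_module_eqI[OF p])
  let ?F = "free_module R B :: ('a, ('a, 'c) point) module"
  have cp: "the_coords p S \<in> carrier R" for S
    using p by (auto simp: free_points_closed elim!: free_module_cases)
  have cl: "(\<lambda>S. the_coords p S \<odot>\<^bsub>?F\<^esub> unit_point S) \<in> B \<rightarrow> carrier ?F"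
    using cp unit_point_closed by (auto intro!: mod_smult_closed[OF free_module])
  then show "finsum ?F (\<lambda>S. the_coords p S \<odot>\<^bsub>?F\<^esub> unit_point S) B \<in> carrier ?F"
    by (rule mod_finsum_closed[OF free_module])
  fix T
  have "the_coords (finsum ?F (\<lambda>S. the_coords p S \<odot>\<^bsub>?F\<^esub> unit_point S) B) T =
      (\<Oplus>S\<in>B. the_coords (the_coords p S \<odot>\<^bsub>?F\<^esub> (unit_point S)) T)"
    by (rule coords_finsum[OF B cl])
  also have "\<dots> = (\<Oplus>S\<in>B. if T = S then the_coords p S else \<zero>)"
    using cp by (intro finsum_cong') (auto simp: unit_point_def)
  also have "\<dots> = the_coords p T"
  proof (cases "T \<in> B")
    case True
    then show ?thesis
      using B cp by (intro finsum_singleton) auto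
  next
    case False
    then have "(\<Oplus>S\<in>B. if T = S then the_coords p S else \<zero>) = (\<Oplus>S\<in>B. \<zero>)"
      by (intro finsum_cong') auto
    then show ?thesis
      using False p by (auto simp: finsum_zero free_points_zero elim!: free_module_cases)
  qed
  finally show "the_coords p T =
      the_coords (finsum ?F (\<lambda>S. the_coords p S \<odot>\<^bsub>?F\<^esub> unit_point S) B) T" ..
qed

lemma lin_coord_smult:
  assumes "module R M" "m \<in> carrier M"
  shows "(\<lambda>p. the_coords p S \<odot>\<^bsub>M\<^esub> m) \<in> linear_maps R (free_module R B) M"
  using assms
  by (intro linI) (auto elim!: free_module_cases
      simp: free_points_closed mod_simps module.smult_l_distr[of R] module.smult_assoc1[of R])

text \<open>Preimages of the basis elements extend linearly; finiteness of \<open>B\<close> makes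
  the extension a finite sum.\<close>

lemma projective_free_module:
  assumes B: "finite B" shows "projective (free_module R B :: ('a, ('a, 'c) point) module)"
  unfolding projective_def
proof (intro conjI allI impI)
  let ?F = "free_module R B :: ('a, ('a, 'c) point) module"
  fix M N :: "('a, ('a, 'c) point) module" and g f
  assume M: "module R M" and N: "module R N" and g: "g \<in> linear_maps R M N"
    and f: "f \<in> linear_maps R ?F N" and sub: "f ` carrier ?F \<subseteq> g ` carrier M"
  have "\<exists>m\<in>carrier M. f (unit_point S) = g m" if "S \<in> B" for S
    using sub unit_point_closed[OF that] by blast
  then obtain m where m: "\<And>S. S \<in> B \<Longrightarrow> m S \<in> carrier M" "\<And>S. S \<in> B \<Longrightarrow> f (unit_point S) = g (m S)"
    by metis
  show "\<exists>h\<in>linear_maps R ?F M. \<forall>x\<in>carrier ?F. g (h x) = f x"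
  proof (intro bexI[of _ "\<lambda>p. finsum M (\<lambda>S. the_coords p S \<odot>\<^bsub>M\<^esub> m S) B"] ballI)
    show "(\<lambda>p. finsum M (\<lambda>S. the_coords p S \<odot>\<^bsub>M\<^esub> m S) B) \<in> linear_maps R ?F M"
      using lin_finsum_maps[OF M B lin_coord_smult[OF M m(1)]] .
    fix p assume p: "p \<in> carrier ?F"
    have cp: "the_coords p S \<in> carrier R" for S
      using p by (auto simp: free_points_closed elim!: free_module_cases)
    have "g (finsum M (\<lambda>S. the_coords p S \<odot>\<^bsub>M\<^esub> m S) B) = finsum N (\<lambda>S. g (the_coords p S \<odot>\<^bsub>M\<^esub> m S)) B"
      using cp m(1) M by (intro lin_finsum[OF M N g B]) (auto simp: mod_simps)
    also have "\<dots> = finsum N (\<lambda>S. f (the_coords p S \<odot>\<^bsub>?F\<^esub> unit_point S)) B"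
    proof (rule abelian_monoid.finsum_cong'[OF mod_monoid[OF N] refl])
      show "(\<lambda>S. f (the_coords p S \<odot>\<^bsub>?F\<^esub> unit_point S)) \<in> B \<rightarrow> carrier N"
        using lin_closed[OF f] mod_smult_closed[OF free_module cp unit_point_closed] by blast
      show "g (the_coords p S \<odot>\<^bsub>M\<^esub> m S) = f (the_coords p S \<odot>\<^bsub>?F\<^esub> unit_point S)" if "S \<in> B" for S
        using lin_smult[OF f cp unit_point_closed[OF that]] lin_smult[OF g cp m(1)[OF that]] m(2)[OF that]
        by simp
    qed
    also have "\<dots> = f (finsum ?F (\<lambda>S. the_coords p S \<odot>\<^bsub>?F\<^esub> unit_point S) B)"
      using cp unit_point_closed
      by (intro lin_finsum[OF free_module N f B, symmetric]) (auto intro!: mod_smult_closed[OF free_module])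
    also have "\<dots> = f p"
      using free_module_expand[OF B p] by simp
    finally show "g (finsum M (\<lambda>S. the_coords p S \<odot>\<^bsub>M\<^esub> m S) B) = f p" .
  qed
qed (rule free_module)

text \<open>When one index is split off, its row and its column cancel. The zero diagonal is a
  separate hypothesis because antisymmetry alone gives only that twice \<open>g j j\<close>
  vanishes.\<close>

lemma finsum_antisymmetric:
  fixes M :: "('a, 'm) module"
  assumes M: "module R M" and "finite A"
    and "\<And>j k. j \<in> A \<Longrightarrow> k \<in> A \<Longrightarrow> g j k \<in> carrier M"
    and "\<And>j k. j \<in> A \<Longrightarrow> k \<in> A \<Longrightarrow> g j k = \<ominus>\<^bsub>M\<^esub> g k j" and "\<And>j. j \<in> A \<Longrightarrow> g j j = \<zero>\<^bsub>M\<^esub>"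
  shows "finsum M (\<lambda>j. finsum M (g j) A) A = \<zero>\<^bsub>M\<^esub>"
  using assms(2-)
proof (induction A)
  case empty
  show ?case
    by (simp add: abelian_monoid.finsum_empty[OF mod_monoid[OF M]])
next
  case (insert a A)
  note mon = mod_monoid[OF M]
  have g: "g j k \<in> carrier M" if "j \<in> insert a A" "k \<in> insert a A" for j k
    using insert.prems(1) that .
  have gc: "finsum M (g j) A \<in> carrier M" if "j \<in> insert a A" for j
    using g that by (intro mod_finsum_closed[OF M]) auto
  have row: "finsum M (g j) (insert a A) = g j a \<oplus>\<^bsub>M\<^esub> finsum M (g j) A" if "j \<in> insert a A" for j
    using insert.hyps g that by (intro abelian_monoid.finsum_insert[OF mon]) auto
  have IH: "finsum M (\<lambda>j. finsum M (g j) A) A = \<zero>\<^bsub>M\<^esub>"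
    by (rule insert.IH) (blast intro: insert.prems)+
  have "finsum M (\<lambda>j. finsum M (g j) (insert a A)) (insert a A) =
      finsum M (g a) (insert a A) \<oplus>\<^bsub>M\<^esub> finsum M (\<lambda>j. finsum M (g j) (insert a A)) A"
    using insert.hyps g by (intro abelian_monoid.finsum_insert[OF mon]) (auto intro!: mod_finsum_closed[OF M])
  also have "finsum M (g a) (insert a A) = finsum M (g a) A"
    using row[of a] insert.prems(3)[of a] gc[of a] M by (simp add: mod_simps)
  also have "finsum M (\<lambda>j. finsum M (g j) (insert a A)) A = finsum M (\<lambda>j. g j a \<oplus>\<^bsub>M\<^esub> finsum M (g j) A) A"
    using row g gc M by (intro abelian_monoid.finsum_cong'[OF mon]) (auto simp: mod_simps)
  also have "\<dots> = finsum M (\<lambda>j. g j a) A \<oplus>\<^bsub>M\<^esub> \<zero>\<^bsub>M\<^esub>"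
    unfolding IH[symmetric] using g gc by (intro abelian_monoid.finsum_addf[OF mon]) auto
  also have "finsum M (\<lambda>j. g j a) A = finsum M (\<lambda>j. \<ominus>\<^bsub>M\<^esub> g a j) A"
  proof (rule abelian_monoid.finsum_cong'[OF mon refl])
    show "(\<lambda>j. \<ominus>\<^bsub>M\<^esub> g a j) \<in> A \<rightarrow> carrier M"
      using g M by (auto simp: mod_simps)
    show "g j a = \<ominus>\<^bsub>M\<^esub> g a j" if "j \<in> A" for j
      using insert.prems(2) that by blast
  qed
  also have "\<dots> = \<ominus>\<^bsub>M\<^esub> finsum M (g a) A"
    using lin_finsum[OF M M lin_neg[OF M lin_id] insert.hyps(1), of "g a"] g by (auto simp: Pi_iff)
  finally show ?case
    using gc[of a] M by (simp add: mod_simps)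
qed

section \<open>Contractions on the exterior algebra\<close>

definition kdeg :: "nat \<Rightarrow> int \<Rightarrow> nat set set" where
  "kdeg n i = {S. S \<subseteq> {..<n} \<and> int (card S) = i}"

lemma finite_kdeg: "finite (kdeg n i)"
  unfolding kdeg_def by (rule finite_subset[of _ "Pow {..<n}"]) auto

text \<open>Interior product with the \<open>j\<close>-th dual basis vector. The Koszul differential
  is the sum of these operators with the scalars \<open>xs ! j\<close>, which separates scalars from
  signs.\<close>

definition contract :: "nat \<Rightarrow> ('a, 'c) point \<Rightarrow> ('a, 'c) point" where
  "contract j p = Coords (\<lambda>T. if j \<in> T then \<zero>
     else if even (card {k \<in> T. k < j}) then the_coords p (insert j T)
     else \<ominus> the_coords p (insert j T))"

lemma contract_lin:
  assumes "j < n"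
  shows "contract j \<in> linear_maps R (free_module R (kdeg n i)) (free_module R (kdeg n (i - 1)))"
proof (rule linI)
  fix p :: "('a, 'c) point" assume "p \<in> carrier (free_module R (kdeg n i))"
  then obtain v where v: "p = Coords v" "v \<in> free_points (kdeg n i)"
    by (rule free_module_cases)
  have "v (insert j T) = \<zero>" if "T \<notin> kdeg n (i - 1)" "j \<notin> T" for T
  proof (rule free_points_zero[OF v(2)])
    have "finite T \<Longrightarrow> int (card (insert j T)) = int (card T) + 1"
      using that(2) by simp
    then show "insert j T \<notin> kdeg n i"
      using that(1) finite_subset[of T "{..<n}"] by (auto simp: kdeg_def)
  qed
  then show "contract j p \<in> carrier (free_module R (kdeg n (i - 1)))"
    using v by (auto simp: contract_def free_points_def[of "kdeg n (i - 1)"] free_points_closed)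
qed (auto elim!: free_module_cases simp: contract_def free_points_closed fun_eq_iff minus_add r_minus
    intro: a_comm)

text \<open>For \<open>j < k\<close>, adding \<open>k\<close> to \<open>T\<close> leaves the number
  of elements below \<open>j\<close> unchanged, while adding \<open>j\<close> raises the number
  below \<open>k\<close> by one; this produces the sign.\<close>

lemma contract_anticommute:
  assumes "p \<in> carrier (free_module R (kdeg n i))" "j < n" "k < n"
  shows "contract j (contract k p) = \<ominus>\<^bsub>free_module R (kdeg n (i - 2))\<^esub> contract k (contract j p)"
    "contract j (contract j p) = \<zero>\<^bsub>free_module R (kdeg n (i - 2))\<^esub>"
proof -
  let ?F = "free_module R (kdeg n (i - 2))"
  have cl: "contract j (contract k p) \<in> carrier ?F" if "j < n" "k < n" for j k
    using lin_closed[OF contract_lin[OF that(1), of "i - 1"] lin_closed[OF contract_lin[OF that(2)] assms(1)]]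
    by simp
  have pc: "the_coords p S \<in> carrier R" for S
    using assms(1) by (auto simp: free_points_closed elim!: free_module_cases)
  show sq: "contract j (contract j p) = \<zero>\<^bsub>?F\<^esub>"
    by (auto simp: contract_def fun_eq_iff)
  have lt: "contract j (contract k p) = \<ominus>\<^bsub>?F\<^esub> contract k (contract j p)" if jk: "j < n" "k < n" "j < k" for j k
  proof (rule free_module_eqI)
    show "contract j (contract k p) \<in> carrier ?F" "\<ominus>\<^bsub>?F\<^esub> contract k (contract j p) \<in> carrier ?F"
      using cl[OF jk(1,2)] mod_inv_closed[OF free_module cl[OF jk(2,1)]] .
    fix T
    obtain w where w: "contract k (contract j p) = Coords w" "w \<in> free_points (kdeg n (i - 2))"
      using cl[OF jk(2,1)] by (rule free_module_cases)
    have coord: "the_coords (\<ominus>\<^bsub>?F\<^esub> contract k (contract j p)) T = \<ominus> the_coords (contract k (contract j p)) T"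
      using w by simp
    show "the_coords (contract j (contract k p)) T = the_coords (\<ominus>\<^bsub>?F\<^esub> contract k (contract j p)) T"
    \<comment> \<open>The coordinate at a set containing \<open>j\<close> or \<open>k\<close> is
      zero on both sides, and so is that at an infinite set, which is no subset of
      \<open>{..<n}\<close>.\<close>
    proof (cases "finite T \<and> j \<notin> T \<and> k \<notin> T")
      case True
      have "{l \<in> insert k T. l < j} = {l \<in> T. l < j}" "{l \<in> insert j T. l < k} = insert j {l \<in> T. l < k}"
        using jk(3) by auto
      moreover have "card (insert j {l \<in> T. l < k}) = Suc (card {l \<in> T. l < k})"
        using True by (intro card_insert_disjoint) auto
      ultimately show ?thesis
        unfolding coord using True pc jk(3) by (auto simp: contract_def insert_commute)
    next
      case False
      have "infinite T \<Longrightarrow> the_coords q T = \<zero>" if "q \<in> carrier ?F" for q :: "('a, 'c) point"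
        using that finite_subset[of T "{..<n}"]
        by (auto elim!: free_module_cases intro!: free_points_zero simp: kdeg_def)
      moreover have "j \<in> T \<or> k \<in> T \<Longrightarrow> the_coords (contract j (contract k p)) T = \<zero> \<and>
          the_coords (contract k (contract j p)) T = \<zero>"
        by (auto simp: contract_def)
      ultimately show ?thesis
        unfolding coord using cl[OF jk(1,2)] cl[OF jk(2,1)] False by auto
    qed
  qed
  show "contract j (contract k p) = \<ominus>\<^bsub>?F\<^esub> contract k (contract j p)"
  proof (cases j k rule: linorder_cases)
    case less
    then show ?thesis using lt assms by blast
  next
    case equal
    then show ?thesis using sq mod_minus_zero[OF free_module] by metis
  next
    case greater
    then have "contract k (contract j p) = \<ominus>\<^bsub>?F\<^esub> contract j (contract k p)"
      using lt assms by blast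
    then show ?thesis
      using cl[OF assms(2,3)] abelian_group.minus_minus[OF mod_group[OF free_module]] by metis
  qed
qed

end

context lech_sequence
begin

section \<open>The Koszul complex and its deep elements\<close>

lemma obj_koszul [simp]: "obj (koszul R xs) i = free_module R (kdeg (length xs) i)"
  by (simp add: koszul_def kdeg_def)

lemma contract_idx:
  "p \<in> carrier (obj (koszul R xs) i) \<Longrightarrow> (\<lambda>j. contract j p) \<in> idx \<rightarrow> carrier (obj (koszul R xs) (i - 1))"
  using lin_closed[OF contract_lin] by auto

text \<open>Exhibits every boundary as a combination of the generators with the contractions as
  coefficients, which is the shape that \<open>deep\<close> and \<open>imult\<close> ask
  for.\<close>

lemma dif_koszul:
  fixes p :: "('a, 'c) point"
  assumes p: "p \<in> carrier (obj (koszul R xs) i)"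
  shows "dif (koszul R xs) i p = comb (obj (koszul R xs) (i - 1)) (\<lambda>j. contract j p)"
proof -
  let ?F = "free_module R (kdeg (length xs) (i - 1)) :: ('a, ('a, 'c) point) module"
  note cl = smult_idx_closed[OF free_module contract_idx[OF p, unfolded obj_koszul]]
  note ccl = comb_closed[OF free_module contract_idx[OF p, unfolded obj_koszul]]
  have pc: "the_coords p S \<in> carrier R" for S
    using p by (auto simp: free_points_closed elim!: free_module_cases)
  have "the_coords (comb ?F (\<lambda>j. contract j p)) T = the_coords (dif (koszul R xs) i p) T" for T
  proof -
    have "the_coords (comb ?F (\<lambda>j. contract j p)) T = (\<Oplus>j\<in>idx. the_coords (xs ! j \<odot>\<^bsub>?F\<^esub> contract j p) T)"
      unfolding comb_def by (rule coords_finsum[OF finite_lessThan cl])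
    also have "\<dots> = (\<Oplus>j\<in>idx. if j \<in> T then \<zero> else
        let c = xs ! j \<otimes> the_coords p (insert j T) in if even (card {k \<in> T. k < j}) then c else \<ominus> c)"
      using pc nth_closed by (intro finsum_cong') (auto simp: contract_def Let_def r_minus)
    also have "\<dots> = (\<Oplus>j\<in>idx - T.
        let c = xs ! j \<otimes> the_coords p (insert j T) in if even (card {k \<in> T. k < j}) then c else \<ominus> c)"
      using pc nth_closed by (intro add.finprod_mono_neutral_cong_right) (auto simp: Let_def)
    finally show ?thesis
      by (simp add: koszul_def)
  qed
  moreover obtain v where "comb ?F (\<lambda>j. contract j p) = Coords v"
    using ccl by (rule free_module_cases)
  moreover obtain w where "dif (koszul R xs) i p = Coords w"
    by (simp add: koszul_def)
  ultimately show ?thesis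
    by (simp add: fun_eq_iff)
qed

text \<open>Twice the differential is a double sum of iterated contractions with coefficients
  \<open>xs ! j \<otimes> xs ! k\<close>, antisymmetric in \<open>j\<close> and
  \<open>k\<close>.\<close>

lemma chain_complex_koszul: "chain_complex R (koszul R xs :: ('a, 'c) cpx)"
proof (rule chain_complexI)
  let ?K = "koszul R xs :: ('a, 'c) cpx"
  show mod: "module R (obj ?K i)" for i
    by (simp add: free_module)
  have "(\<lambda>p. comb (obj ?K (i - 1)) (\<lambda>j. contract j p)) \<in> linear_maps R (obj ?K i) (obj ?K (i - 1))" for i
    unfolding comb_def using contract_lin nth_closed
    by (intro lin_finsum_maps[OF mod] lin_scale[OF mod]) auto
  then show lin: "dif ?K i \<in> linear_maps R (obj ?K i) (obj ?K (i - 1))" for i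
    by (rule lin_cong[OF _ mod]) (rule dif_koszul)
  fix i p assume p: "p \<in> carrier (obj ?K i)"
  let ?G = "obj ?K (i - 2)"
  have cc: "contract j (contract k p) \<in> carrier ?G" if "j \<in> idx" "k \<in> idx" for j k
    using that contract_idx[OF funcset_mem[OF contract_idx[OF p] that(2)]] by auto
  have dj: "dif ?K (i - 1) (contract j p) = comb ?G (\<lambda>k. contract k (contract j p))" if "j \<in> idx" for j
    using dif_koszul[OF funcset_mem[OF contract_idx[OF p] that]] by simp
  have "dif ?K (i - 1) (dif ?K i p) = comb ?G (\<lambda>j. dif ?K (i - 1) (contract j p))"
    unfolding dif_koszul[OF p] using lin_comb[OF mod mod lin contract_idx[OF p]] by simp
  also have "\<dots> = finsum ?G (\<lambda>j. finsum ?G (\<lambda>k. (xs ! j \<otimes> xs ! k) \<odot>\<^bsub>?G\<^esub> contract k (contract j p)) idx) idx"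
    unfolding comb_def
  proof (rule abelian_monoid.finsum_cong'[OF mod_monoid[OF mod] refl])
    show "(\<lambda>j. finsum ?G (\<lambda>k. (xs ! j \<otimes> xs ! k) \<odot>\<^bsub>?G\<^esub> contract k (contract j p)) idx) \<in> idx \<rightarrow> carrier ?G"
      using cc nth_closed by (auto intro!: mod_finsum_closed[OF mod] mod_smult_closed[OF mod] simp del: obj_koszul)
    fix j assume j: "j \<in> idx"
    have "xs ! j \<odot>\<^bsub>?G\<^esub> comb ?G (\<lambda>k. contract k (contract j p)) =
        finsum ?G (\<lambda>k. xs ! j \<odot>\<^bsub>?G\<^esub> (xs ! k \<odot>\<^bsub>?G\<^esub> contract k (contract j p))) idx"
      unfolding comb_def using cc j nth_closed
      by (intro module.finsum_smult_ldistr[OF mod]) (auto intro!: mod_smult_closed[OF mod] simp del: obj_koszul)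
    also have "\<dots> = finsum ?G (\<lambda>k. (xs ! j \<otimes> xs ! k) \<odot>\<^bsub>?G\<^esub> contract k (contract j p)) idx"
      using cc j nth_closed
      by (intro abelian_monoid.finsum_cong'[OF mod_monoid[OF mod]])
        (auto simp del: obj_koszul simp: module.smult_assoc1[OF mod] intro!: mod_smult_closed[OF mod])
    finally show "xs ! j \<odot>\<^bsub>?G\<^esub> dif ?K (i - 1) (contract j p) =
        finsum ?G (\<lambda>k. (xs ! j \<otimes> xs ! k) \<odot>\<^bsub>?G\<^esub> contract k (contract j p)) idx"
      unfolding dj[OF j] .
  qed
  also have "\<dots> = \<zero>\<^bsub>?G\<^esub>"
  proof (rule finsum_antisymmetric[OF mod])
    note anti = contract_anticommute[of p "length xs" i, folded obj_koszul, OF p]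
    fix j k assume jk: "j \<in> idx" "k \<in> idx"
    show "(xs ! j \<otimes> xs ! k) \<odot>\<^bsub>?G\<^esub> contract k (contract j p) \<in> carrier ?G"
      using cc jk nth_closed by (auto intro!: mod_smult_closed[OF mod] simp del: obj_koszul)
    have "contract k (contract j p) = \<ominus>\<^bsub>?G\<^esub> contract j (contract k p)"
      using anti(1)[of k j] jk by simp
    then show "(xs ! j \<otimes> xs ! k) \<odot>\<^bsub>?G\<^esub> contract k (contract j p) =
        \<ominus>\<^bsub>?G\<^esub> ((xs ! k \<otimes> xs ! j) \<odot>\<^bsub>?G\<^esub> contract j (contract k p))"
      using cc jk nth_closed mod_smult_minus[OF mod] by (simp add: m_comm del: obj_koszul)
    show "(xs ! j \<otimes> xs ! j) \<odot>\<^bsub>?G\<^esub> contract j (contract j p) = \<zero>\<^bsub>?G\<^esub>"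
      using anti(2)[of j] jk nth_closed module.smult_r_null[OF mod] by (simp del: obj_koszul)
  qed simp
  finally show "dif ?K (i - 1) (dif ?K i p) = \<zero>\<^bsub>?G\<^esub>" .
qed

lemma good_koszul: "good (koszul R xs :: ('a, 'c) cpx)"
proof -
  have "kdeg (length xs) i = {}" if "i < 0" for i
    using that by (auto simp: kdeg_def)
  moreover have "carrier (free_module R {}) = {\<zero>\<^bsub>free_module R {}\<^esub>}"
    by (auto elim!: free_module_cases simp: free_points_def)
  ultimately have "kproj (koszul R xs :: ('a, 'c) cpx)"
    by (intro kprojI[of _ 0]) (auto simp: chain_complex_koszul projective_free_module finite_kdeg)
  then show ?thesis
    by (simp add: good_def lech_free_module)
qed

text \<open>Starting from the basis element of the last \<open>m\<close> indices, each step
  contracts away the smallest index; none lies below it, so every sign is positive, and after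
  \<open>m\<close> steps the empty set is reached. Allowing all \<open>m\<close> up to the length
  excludes each of these thickenings directly.\<close>

lemma deep_koszul:
  "m \<le> length xs \<Longrightarrow> p \<le> m \<Longrightarrow>
    deep (koszul R xs :: ('a, 'c) cpx) p (int m - int p) (unit_point {length xs - m + p..<length xs})"
proof (induction p)
  case 0
  then have "{length xs - m..<length xs} \<in> kdeg (length xs) (int m)"
    by (auto simp: kdeg_def)
  then show ?case
    by (simp add: deep_0 unit_point_closed)
next
  case (Suc p)
  let ?s = "length xs - m + p" and ?K = "koszul R xs :: ('a, 'c) cpx"
  define i where "i = int m - int (Suc p)"
  have i: "int m - int p = i + 1" by (simp add: i_def)
  have "card {?s..<length xs} = m - p"
    using Suc.prems by simp
  then have "{?s..<length xs} \<in> kdeg (length xs) (i + 1)"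
    using Suc.prems unfolding kdeg_def i[symmetric] by auto
  then have z: "unit_point {?s..<length xs} \<in> carrier (obj ?K (i + 1))"
    unfolding obj_koszul by (rule unit_point_closed)
  have "deep ?K (Suc p) i (contract ?s (unit_point {?s..<length xs}))"
  proof (rule deep_Suc[where t = "\<lambda>j. contract j (unit_point {?s..<length xs})", OF _ z])
    show "deep ?K p (i + 1) (unit_point {?s..<length xs})"
      unfolding i[symmetric] using Suc.prems by (intro Suc.IH) auto
    show "(\<lambda>j. contract j (unit_point {?s..<length xs})) \<in> idx \<rightarrow> carrier (obj ?K i)"
      using contract_idx[OF z] by simp
    show "dif ?K (i + 1) (unit_point {?s..<length xs}) = comb (obj ?K i) (\<lambda>j. contract j (unit_point {?s..<length xs}))"
      using dif_koszul[OF z] by simp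
    show "?s \<in> idx"
      using Suc.prems by auto
  qed
  moreover have "contract ?s (unit_point {?s..<length xs}) = (unit_point {Suc ?s..<length xs} :: ('a, 'c) point)"
  proof -
    have split: "{?s..<length xs} = insert ?s {Suc ?s..<length xs}"
      using Suc.prems by auto
    have "T = {Suc ?s..<length xs}" if "?s \<notin> T" "insert ?s T = {?s..<length xs}" for T
    proof -
      have "T = insert ?s T - {?s}"
        using that(1) by simp
      also have "\<dots> = {Suc ?s..<length xs}"
        unfolding that(2) by auto
      finally show ?thesis .
    qed
    note T = this
    have "the_coords (contract ?s (unit_point {?s..<length xs}) :: ('a, 'c) point) T =
        (if T = {Suc ?s..<length xs} then \<one> else \<zero>)" for T
    proof (cases "T = {Suc ?s..<length xs}")
      case True
      have e: "{k. Suc ?s \<le> k \<and> k < length xs \<and> k < ?s} = {}" by auto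
      show ?thesis
        using True split by (simp add: contract_def unit_point_def e)
    next
      case False
      then have "?s \<in> T \<or> insert ?s T \<noteq> {?s..<length xs}"
        using T by blast
      then show ?thesis
        using False by (auto simp: contract_def unit_point_def)
    qed
    then show ?thesis
      by (simp add: contract_def unit_point_def)
  qed
  ultimately show ?case by (simp add: i_def)
qed

text \<open>Addition is a linear map on \<open>sum_module M M\<close>, and linear maps preserve
  \<open>imult\<close>.\<close>

lemma imult_add:
  fixes M :: "('a, ('a, 'c) point) module"
  shows "module R M \<Longrightarrow> x \<in> imult M \<Longrightarrow> y \<in> imult M \<Longrightarrow> x \<oplus>\<^bsub>M\<^esub> y \<in> imult M"
proof -
  assume M: "module R M" and x: "x \<in> imult M" and y: "y \<in> imult M"
  have "(\<lambda>p. point_fst p \<oplus>\<^bsub>M\<^esub> point_snd p) \<in> linear_maps R (sum_module M M) M"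
    by (rule lin_sum[OF M lin_fst lin_snd])
  from lin_imult[OF sum_module[OF M M] M this imult_sum_module[OF M M x y]]
  show "x \<oplus>\<^bsub>M\<^esub> y \<in> imult M" by simp
qed

text \<open>The differential vanishes modulo \<open>I\<close>, so an element of the Koszul complex
  can reduce only by lying in \<open>I\<close> times the module.\<close>

lemma dif_koszul_imult:
  "p \<in> carrier (obj (koszul R xs) (i + 1)) \<Longrightarrow> dif (koszul R xs) (i + 1) p \<in> imult (obj (koszul R xs) i)"
  using dif_koszul[of p "i + 1"] contract_idx[of p "i + 1"] imultI by (simp del: obj_koszul)

text \<open>The identity would factor through some \<open>Q\<close> in which the image of
  \<open>?e\<close> reduces. Mapping back and correcting by the homotopy puts \<open>?e\<close> into
  \<open>I\<close> times degree 0, whose only coordinate then gives \<open>\<one>\<close> in the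
  ideal.\<close>

lemma koszul_notin_thickening:
  assumes proper: "Idl (set xs) \<noteq> carrier R" and m: "m \<le> length xs"
  shows "(koszul R xs :: ('a, 'c) cpx) \<notin> thickening R m"
proof
  let ?K = "koszul R xs :: ('a, 'c) cpx"
  assume "?K \<in> thickening R m"
  note K = chain_complex_koszul[where 'c = 'c]
  let ?e = "unit_point {} :: ('a, 'c) point"
  have "deep ?K m 0 ?e"
    using deep_koszul[OF m order_refl] m by simp
  then obtain Q \<phi> b where Q: "good Q" and \<phi>: "chain_map R ?K Q \<phi>" and b: "chain_map R Q ?K b"
    and heq: "heq ?K ?K (gcomp b \<phi>) (\<lambda>i x. x)" and red: "reduces Q 0 (\<phi> 0 ?e)"
    using thickening_reduces[OF \<open>?K \<in> thickening R m\<close> good_koszul chain_map_id] by blast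
  note QC = goodD(2)[OF Q]
  obtain v w where v: "v \<in> carrier (obj Q 1)" and w: "w \<in> imult (obj Q 0)"
    and \<phi>e: "\<phi> 0 ?e = dif Q 1 v \<oplus>\<^bsub>obj Q 0\<^esub> w"
    using red by (auto simp: reduces_def)
  let ?M = "obj ?K 0"
  have M: "module R ?M"
    using cpx_module[OF K] .
  have e: "?e \<in> carrier ?M"
    by (simp add: unit_point_closed kdeg_def)
  have "b 0 (\<phi> 0 ?e) = dif ?K 1 (b 1 v) \<oplus>\<^bsub>?M\<^esub> b 0 w"
    unfolding \<phi>e using v imult_closed[OF cpx_module[OF QC] w] QC
    by (simp add: cmap_simps[OF b] cpx_simps del: obj_koszul)
  moreover have "dif ?K 1 (b 1 v) \<in> imult ?M"
    using dif_koszul_imult[of "b 1 v" 0] cmap_closed[OF b v refl] by simp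
  moreover have "b 0 w \<in> imult ?M"
    using chain_map_imult[OF QC K b w] .
  ultimately have be: "b 0 (\<phi> 0 ?e) \<in> imult ?M"
    using imult_add[OF M] by simp
  obtain h where h: "homotopy ?K ?K (\<lambda>i x. x) (gcomp b \<phi>) h"
    using heq_sym[OF heq] homotopic_iff unfolding heq_def by blast
  \<comment> \<open>Degree \<open>- 1\<close> is trivial, so the homotopy contributes only
    \<open>d (h ?e)\<close>, which again lies in \<open>imult ?M\<close>.\<close>
  have de: "dif ?K 0 ?e = \<zero>\<^bsub>obj ?K (- 1)\<^esub>"
  proof -
    have "carrier (obj ?K (- 1)) = {\<zero>\<^bsub>obj ?K (- 1)\<^esub>}"
      by (auto elim!: free_module_cases simp: free_points_def kdeg_def)
    then show ?thesis
      using cpx_dif_closed[OF K e, of "- 1"] by (simp del: obj_koszul)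
  qed
  have he: "h 0 ?e \<in> carrier (obj ?K 1)"
    using htp_closed[OF h e] by simp
  have "?e = b 0 (\<phi> 0 ?e) \<oplus>\<^bsub>?M\<^esub> (dif ?K 1 (h 0 ?e) \<oplus>\<^bsub>?M\<^esub> \<zero>\<^bsub>?M\<^esub>)"
    using htp_eq[OF h e] htp_zero[OF h K K, of "- 1" "- 1"] de by (simp del: obj_koszul)
  moreover have "dif ?K 1 (h 0 ?e) \<in> imult ?M"
    using dif_koszul_imult[of "h 0 ?e" 0] he by simp
  ultimately have "?e \<in> imult ?M"
    using imult_add[OF M] imult_zero[OF M] be by metis
  then have "Scalar (the_coords ?e {}) \<in> imult (regular_module R :: ('a, ('a, 'c) point) module)"
    using lin_imult[OF free_module regular_module lin_coord, of ?e "kdeg (length xs) 0" "{}"] by simp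
  then obtain u where u: "u \<in> idx \<rightarrow> carrier (regular_module R :: ('a, ('a, 'c) point) module)"
    "Scalar \<one> = comb (regular_module R :: ('a, ('a, 'c) point) module) u"
    by (auto simp: unit_point_def elim: imultE)
  define a where "a = (\<lambda>k. the_scalar (u k))"
  have "Scalar (a k) = u k \<and> a k \<in> carrier R" if "k \<in> idx" for k
    using funcset_mem[OF u(1) that] by (auto simp: a_def)
  then have a: "a \<in> idx \<rightarrow> carrier R" "\<And>k. k \<in> idx \<Longrightarrow> Scalar (a k) = u k"
    by auto
  have "Scalar \<one> = comb (regular_module R :: ('a, ('a, 'c) point) module) (\<lambda>k. Scalar (a k))"
    unfolding u(2) using a(2) by (intro comb_cong[OF regular_module u(1), symmetric]) simp
  from trans[OF this comb_regular[OF a(1)]] have one: "\<one> = (\<Oplus>i\<in>idx. a i \<otimes> xs ! i)"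
    by simp
  interpret I: ideal "Idl (set xs)" R
    using genideal_ideal[OF xs_closed] .
  have "xs ! i \<in> Idl (set xs)" if "i \<in> idx" for i
    using that genideal_self[OF xs_closed] nth_mem by auto
  then have "(\<Oplus>i\<in>idx. a i \<otimes> xs ! i) \<in> Idl (set xs)"
    using a(1) by (intro I.finsum_mem) (auto simp: Pi_iff I.I_l_closed)
  then show False
    using one I.one_imp_carrier proper by simp
qed

end

section \<open>The upper bound\<close>

context cring
begin

section \<open>Morphisms between complexes of projectives\<close>

lemma hrel_singleton:
  "hrel P X Y {(W, s, f)} x y \<longleftrightarrow> (\<exists>c. chain_map R P W c \<and> heq P X (gcomp s c) x \<and> heq P Y (gcomp f c) y)"
  unfolding hrel_def by blast

text \<open>A roof out of a bounded below complex of projectives is determined by a homotopy class of chain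
  maps: compose with a homotopy section of the quasi-isomorphism.\<close>

lemma roof_rel_iff:
  fixes X Y :: "('a, 'c) cpx"
  assumes X: "kproj X" and Y: "chain_complex R Y" and r: "r \<in> roofs R X Y" and r': "r' \<in> roofs R X Y"
    and g: "hrel X X Y {r} (\<lambda>i x. x) g"
  shows "(r, r') \<in> roof_rel R X Y \<longleftrightarrow> hrel X X Y {r'} (\<lambda>i x. x) g"
proof -
  note XC = kproj_cpx[OF X]
  obtain W s f where W: "r = (W, s, f)" by (cases r)
  obtain W' s' f' where W': "r' = (W', s', f')" by (cases r')
  note d = roofsD[OF r[unfolded W]] and d' = roofsD[OF r'[unfolded W']]
  obtain c where c: "chain_map R X W c" "heq X X (gcomp s c) (\<lambda>i x. x)" "heq X Y (gcomp f c) g"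
    using g unfolding W hrel_singleton by blast
  show ?thesis
  proof
    assume rel: "(r, r') \<in> roof_rel R X Y"
    obtain c' where c': "chain_map R X W' c'" "heq X X (gcomp s' c') (\<lambda>i x. x)"
      using heq_lift[OF X d'(1) XC d'(2) chain_map_id] .
    have "heq X Y (gcomp f c) (gcomp f' c')"
      using roof_rel_value[OF X XC Y rel[unfolded W W'] c(1) c'(1) heq_trans[OF c(2) heq_sym[OF c'(2)]]] .
    then have "heq X Y (gcomp f' c') g"
      using heq_trans[OF heq_sym c(3)] by blast
    then show "hrel X X Y {r'} (\<lambda>i x. x) g"
      unfolding W' hrel_singleton using c' by blast
  next
    assume "hrel X X Y {r'} (\<lambda>i x. x) g"
    then obtain c' where c': "chain_map R X W' c'" "heq X X (gcomp s' c') (\<lambda>i x. x)" "heq X Y (gcomp f' c') g"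
      unfolding W' hrel_singleton by blast
    have "quasi_iso R X X (gcomp s c)"
      using quasi_iso_homotopic_id[OF XC _ heqD(5)[OF c(2)]] heqD(3)[OF c(2)] by blast
    moreover have "homotopic R X X (gcomp s c) (gcomp s' c')" "homotopic R X Y (gcomp f c) (gcomp f' c')"
      using heqD(5)[OF heq_trans[OF c(2) heq_sym[OF c'(2)]]] heqD(5)[OF heq_trans[OF c(3) heq_sym[OF c'(3)]]]
      by blast+
    ultimately show "(r, r') \<in> roof_rel R X Y"
      using r r' XC c(1) c'(1) unfolding W W' roof_rel_def by blast
  qed
qed

lemma hrel_roof_unique:
  fixes X Y :: "('a, 'c) cpx"
  assumes X: "kproj X" and Y: "chain_complex R Y" and r: "r \<in> roofs R X Y"
    and g: "hrel X X Y {r} (\<lambda>i x. x) g" and g': "hrel X X Y {r} (\<lambda>i x. x) g'"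
  shows "heq X Y g g'"
proof -
  note XC = kproj_cpx[OF X]
  obtain W s f where W: "r = (W, s, f)" by (cases r)
  obtain c where c: "chain_map R X W c" "heq X X (gcomp s c) (\<lambda>i x. x)" "heq X Y (gcomp f c) g"
    using g unfolding W hrel_singleton by blast
  obtain c' where c': "chain_map R X W c'" "heq X X (gcomp s c') (\<lambda>i x. x)" "heq X Y (gcomp f c') g'"
    using g' unfolding W hrel_singleton by blast
  have "heq X Y (gcomp f c) (gcomp f c')"
    using roof_rel_value[OF X XC Y roof_rel_refl[OF XC Y r, unfolded W] c(1) c'(1) heq_trans[OF c(2) heq_sym[OF c'(2)]]] .
  then show ?thesis
    using c(3) c'(3) heq_sym heq_trans by blast
qed

lemma roof_class:
  fixes X Y :: "('a, 'c) cpx"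
  assumes X: "kproj X" and Y: "chain_complex R Y" and r: "r \<in> roofs R X Y"
    and g: "hrel X X Y {r} (\<lambda>i x. x) g"
  shows "roof_rel R X Y `` {r} = {r' \<in> roofs R X Y. hrel X X Y {r'} (\<lambda>i x. x) g}"
  using roof_rel_iff[OF X Y r _ g] roof_rel_roofs by blast

text \<open>Describes the class through the homotopy class of \<open>g\<close> alone, so that
  equality of morphisms is checked by homotopies.\<close>

lemma derived_map_class:
  fixes X Y :: "('a, 'c) cpx"
  assumes X: "kproj X" and Y: "chain_complex R Y" and g: "chain_map R X Y g"
  shows "derived_map R X Y g = {r \<in> roofs R X Y. hrel X X Y {r} (\<lambda>i x. x) g}"
proof -
  note XC = kproj_cpx[OF X]
  have "(X, \<lambda>i x. x, g) \<in> roofs R X Y"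
    using XC g by (simp add: roofs_def quasi_iso_id)
  moreover have "hrel X X Y {(X, \<lambda>i x. x, g)} (\<lambda>i x. x) g"
    unfolding hrel_singleton
    using XC Y g by (intro exI[of _ "\<lambda>i x. x"]) (simp add: heq_refl chain_map_id)
  ultimately show ?thesis
    unfolding derived_map_def by (rule roof_class[OF X Y])
qed

lemma derived_map_cong:
  fixes X Y :: "('a, 'c) cpx"
  assumes X: "kproj X" and fg: "heq X Y f g"
  shows "derived_map R X Y f = derived_map R X Y g"
proof -
  note d = heqD[OF fg]
  have "hrel X X Y F (\<lambda>i x. x) f \<longleftrightarrow> hrel X X Y F (\<lambda>i x. x) g" for F
    using hrel_cong[OF _ heq_refl[OF d(1) d(1) chain_map_id]] fg heq_sym[OF fg] by blast
  then show ?thesis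
    using derived_map_class[OF X d(2)] d(3,4) by simp
qed

text \<open>The composite is formed from all representatives and all completions of the square. Each
  roof so obtained induces the homotopy class of \<open>gcomp g f\<close>, so the union of their
  classes is a single class.\<close>

lemma derived_comp_map:
  fixes X Y Z :: "('a, 'c) cpx"
  assumes X: "kproj X" and Y: "kproj Y" and Z: "chain_complex R Z"
    and f: "chain_map R X Y f" and g: "chain_map R Y Z g"
  shows "derived_comp R X Y Z (derived_map R Y Z g) (derived_map R X Y f) = derived_map R X Z (gcomp g f)"
proof -
  note XC = kproj_cpx[OF X] and YC = kproj_cpx[OF Y]
  define S where "S = {(U, gcomp s p, gcomp g' q) | U p q W s f' V t g'.
       (W, s, f') \<in> derived_map R X Y f \<and> (V, t, g') \<in> derived_map R Y Z g \<and> chain_complex R U \<and>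
       quasi_iso R U W p \<and> chain_map R U V q \<and> homotopic R U Y (gcomp f' p) (gcomp t q)}"
  have S: "r \<in> roofs R X Z \<and> hrel X X Z {r} (\<lambda>i x. x) (gcomp g f)" if "r \<in> S" for r
  proof -
    obtain U p q W s f' V t g' where r: "r = (U, gcomp s p, gcomp g' q)"
      and W: "(W, s, f') \<in> derived_map R X Y f" and V: "(V, t, g') \<in> derived_map R Y Z g"
      and U: "chain_complex R U" and p: "quasi_iso R U W p" and q: "chain_map R U V q"
      and pq: "homotopic R U Y (gcomp f' p) (gcomp t q)"
      using \<open>r \<in> S\<close> unfolding S_def by blast
    have Wr: "(W, s, f') \<in> roofs R X Y" and Wf: "hrel X X Y {(W, s, f')} (\<lambda>i x. x) f"
      using W unfolding derived_map_class[OF X YC f] by auto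
    have Vr: "(V, t, g') \<in> roofs R Y Z" and Vg: "hrel Y Y Z {(V, t, g')} (\<lambda>i x. x) g"
      using V unfolding derived_map_class[OF Y Z g] by auto
    note dW = roofsD[OF Wr] and dV = roofsD[OF Vr]
    note pm = quasi_iso_map[OF U dW(1) p]
    have sp: "quasi_iso R U X (gcomp s p)"
      using quasi_iso_gcomp[OF U dW(1) XC p dW(2)] .
    have rr: "r \<in> roofs R X Z"
      unfolding r roofs_def using U sp chain_map_gcomp[OF q dV(3)] by blast
    obtain \<tau> where \<tau>: "chain_map R X U \<tau>" "heq X X (gcomp (gcomp s p) \<tau>) (\<lambda>i x. x)"
      using heq_lift[OF X U XC sp chain_map_id] .
    obtain \<rho> where \<rho>: "chain_map R Y V \<rho>" "heq Y Y (gcomp t \<rho>) (\<lambda>i x. x)" "heq Y Z (gcomp g' \<rho>) g"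
      using Vg unfolding hrel_singleton by blast
    have "hrel X X Y {(W, s, f')} (\<lambda>i x. x) (gcomp f' (gcomp p \<tau>))"
      unfolding hrel_singleton
      using chain_map_gcomp[OF \<tau>(1) pm] \<tau>(2) heq_refl[OF XC YC chain_map_gcomp[OF chain_map_gcomp[OF \<tau>(1) pm] dW(3)]]
      by (intro exI[of _ "gcomp p \<tau>"]) (simp add: gcomp_assoc)
    then have 1: "heq X Y (gcomp f' (gcomp p \<tau>)) f"
      using hrel_roof_unique[OF X YC Wr _ Wf] by blast
    have pq': "heq U Y (gcomp f' p) (gcomp t q)"
      using U YC pq pm q dW dV by (simp add: heq_def chain_map_gcomp)
    have 2: "heq X Y (gcomp t (gcomp q \<tau>)) (gcomp f' (gcomp p \<tau>))"
      using heq_comp_right[OF heq_sym[OF pq'] XC \<tau>(1)] by (simp add: gcomp_assoc)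
    have 3: "heq X Y (gcomp t (gcomp \<rho> f)) f"
      using heq_comp_right[OF \<rho>(2) XC f] by (simp add: gcomp_assoc)
    \<comment> \<open>The two maps agree after composition with the quasi-isomorphism
      \<open>t\<close>, and lifts along it are unique.\<close>
    have "heq X V (gcomp q \<tau>) (gcomp \<rho> f)"
      using heq_lift_unique[OF X dV(1,2) chain_map_gcomp[OF \<tau>(1) q] chain_map_gcomp[OF f \<rho>(1)]
        heq_trans[OF 2 heq_trans[OF 1 heq_sym[OF 3]]]] .
    then have "heq X Z (gcomp g' (gcomp q \<tau>)) (gcomp g' (gcomp \<rho> f))"
      by (rule heq_comp_left[OF _ Z dV(3)])
    moreover have "heq X Z (gcomp g' (gcomp \<rho> f)) (gcomp g f)"
      using heq_comp_right[OF \<rho>(3) XC f] by (simp add: gcomp_assoc)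
    ultimately have "heq X Z (gcomp g' (gcomp q \<tau>)) (gcomp g f)"
      by (rule heq_trans)
    then have "hrel X X Z {r} (\<lambda>i x. x) (gcomp g f)"
      unfolding r hrel_singleton using \<tau> by (intro exI[of _ \<tau>]) (simp add: gcomp_assoc)
    with rr show ?thesis ..
  qed
  have SI: "(U, gcomp s p, gcomp g' q) \<in> S"
    if "(W, s, f') \<in> derived_map R X Y f" "(V, t, g') \<in> derived_map R Y Z g" "chain_complex R U"
      "quasi_iso R U W p" "chain_map R U V q" "homotopic R U Y (gcomp f' p) (gcomp t q)"
    for U p q W s f' V t g'
    unfolding S_def using that by blast
  \<comment> \<open>Completing by identities shows that the union is not taken over the empty
    set.\<close>
  have "(X, gcomp (\<lambda>i x. x) (\<lambda>i x. x), gcomp g f) \<in> S"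
    by (rule SI[OF derived_map_mem[OF XC YC f] derived_map_mem[OF YC Z g] XC quasi_iso_id[OF XC] f])
      (simp add: homotopic_refl[OF XC YC f])
  then have "S \<noteq> {}" by blast
  have "derived_comp R X Y Z (derived_map R Y Z g) (derived_map R X Y f) = roof_rel R X Z `` S"
    unfolding derived_comp_def S_def ..
  also have "\<dots> = (\<Union>r\<in>S. roof_rel R X Z `` {r})"
    by blast
  also have "\<dots> = (\<Union>r\<in>S. derived_map R X Z (gcomp g f))"
    using S roof_class[OF X Z] derived_map_class[OF X Z chain_map_gcomp[OF f g]] by (intro SUP_cong refl) simp
  also have "\<dots> = derived_map R X Z (gcomp g f)"
    using \<open>S \<noteq> {}\<close> by simp
  finally show ?thesis .
qed

lemma derived_iso_map:
  fixes X Y :: "('a, 'c) cpx"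
  assumes X: "kproj X" and Y: "kproj Y" and f: "chain_map R X Y f" and g: "chain_map R Y X g"
    and gf: "heq X X (gcomp g f) (\<lambda>i x. x)" and fg: "heq Y Y (gcomp f g) (\<lambda>i x. x)"
  shows "derived_iso R X Y (derived_map R X Y f)"
  unfolding derived_iso_def
proof (intro conjI bexI)
  note XC = kproj_cpx[OF X] and YC = kproj_cpx[OF Y]
  show "derived_map R X Y f \<in> derived_hom R X Y" "derived_map R Y X g \<in> derived_hom R Y X"
    using derived_map_hom XC YC f g by auto
  show "derived_comp R X Y X (derived_map R Y X g) (derived_map R X Y f) = derived_map R X X (\<lambda>i x. x)"
    using derived_comp_map[OF X Y XC f g] derived_map_cong[OF X gf] by simp
  show "derived_comp R Y X Y (derived_map R X Y f) (derived_map R Y X g) = derived_map R Y Y (\<lambda>i x. x)"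
    using derived_comp_map[OF Y X YC g f] derived_map_cong[OF Y fg] by simp
qed

lemma derived_iso_id:
  fixes X :: "('a, 'c) cpx"
  assumes X: "kproj X" shows "derived_iso R X X (derived_map R X X (\<lambda>i x. x))"
  using heq_refl[OF kproj_cpx[OF X] kproj_cpx[OF X] chain_map_id]
  by (intro derived_iso_map[OF X X chain_map_id chain_map_id]) simp_all

lemma shift_map_gcomp: "shift_map j (gcomp g f) = gcomp (shift_map j g) (shift_map j f)"
  by (simp add: shift_map_def fun_eq_iff)

lemma chain_map_shift:
  assumes "chain_complex R X" "chain_complex R Y" "chain_map R X Y f"
  shows "chain_map R (shift j X) (shift j Y) (shift_map j f)"
proof (rule chain_mapI)
  show "shift_map j f i \<in> linear_maps R (obj (shift j X) i) (obj (shift j Y) i)" for i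
    using cmap_lin[OF assms(3)] by (simp add: shift_map_def)
qed (use assms in \<open>simp add: shift_map_def cmap_simps cpx_simps algebra_simps\<close>)

text \<open>The homotopy changes its sign because \<open>shift 1\<close> negates the
  differential.\<close>

lemma heq_shift:
  assumes "heq X Y f g" shows "heq (shift 1 X) (shift 1 Y) (shift_map 1 f) (shift_map 1 g)"
proof -
  note d = heqD[OF assms]
  obtain h where h: "homotopy X Y f g h"
    using homotopic_iff[OF d(1-4)] d(5) by blast
  have "homotopy (shift 1 X) (shift 1 Y) (shift_map 1 f) (shift_map 1 g) (\<lambda>i x. \<ominus>\<^bsub>obj Y i\<^esub> h (i - 1) x)"
  proof (rule homotopyI)
    show "(\<lambda>x. \<ominus>\<^bsub>obj Y i\<^esub> h (i - 1) x) \<in> linear_maps R (obj (shift 1 X) i) (obj (shift 1 Y) (i + 1))" for i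
      using lin_neg[OF cpx_module[OF d(2)] htp_lin[OF h, of "i - 1"]] by simp
    fix i x assume "x \<in> carrier (obj (shift 1 X) i)"
    then have x: "x \<in> carrier (obj X (i - 1))" by simp
    have dx: "dif X (i - 1) x \<in> carrier (obj X (i - 2))"
      using cpx_dif_closed[OF d(1) x] by simp
    have hdx: "h (i - 2) (dif X (i - 1) x) \<in> carrier (obj Y (i - 1))"
      using htp_closed[OF h dx] by simp
    have "f (i - 1) x = g (i - 1) x \<oplus>\<^bsub>obj Y (i - 1)\<^esub>
        (dif Y i (h (i - 1) x) \<oplus>\<^bsub>obj Y (i - 1)\<^esub> h (i - 2) (dif X (i - 1) x))"
      using htp_eq[OF h x] by simp
    then show "shift_map 1 f i x = shift_map 1 g i x \<oplus>\<^bsub>obj (shift 1 Y) i\<^esub>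
        (dif (shift 1 Y) (i + 1) (\<ominus>\<^bsub>obj Y i\<^esub> h (i - 1) x) \<oplus>\<^bsub>obj (shift 1 Y) i\<^esub>
         \<ominus>\<^bsub>obj Y (i - 1)\<^esub> h (i - 1 - 1) (dif (shift 1 X) i x))"
      using x dx hdx htp_closed[OF h x, of i] d
      by (simp add: shift_map_def cpx_simps mod_simps htp_inv[OF h])
  qed
  moreover note sh = chain_complex_shift[OF d(1), of 1] chain_complex_shift[OF d(2), of 1]
    chain_map_shift[OF d(1-3), of 1] chain_map_shift[OF d(1,2,4), of 1]
  ultimately have "homotopic R (shift 1 X) (shift 1 Y) (shift_map 1 f) (shift_map 1 g)"
    using homotopic_iff[OF sh] by blast
  then show ?thesis
    using sh by (simp add: heq_def)
qed

lemma derived_shift_map: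
  fixes X Y :: "('a, 'c) cpx"
  assumes X: "kproj X" and Y: "kproj Y" and f: "chain_map R X Y f"
  shows "derived_shift R X Y (derived_map R X Y f) =
    derived_map R (shift 1 X) (shift 1 Y) (shift_map 1 f)"
proof -
  note XC = kproj_cpx[OF X] and YC = kproj_cpx[OF Y]
  let ?X = "shift 1 X" and ?Y = "shift 1 Y"
  note SX = kproj_shift[OF X, of 1] and SYC = chain_complex_shift[OF YC, of 1]
  define S where "S = {(shift 1 W, shift_map 1 s, shift_map 1 f') | W s f'. (W, s, f') \<in> derived_map R X Y f}"
  have S: "r \<in> roofs R ?X ?Y \<and> hrel ?X ?X ?Y {r} (\<lambda>i x. x) (shift_map 1 f)" if "r \<in> S" for r
  proof -
    obtain W s f' where r: "r = (shift 1 W, shift_map 1 s, shift_map 1 f')"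
      and W: "(W, s, f') \<in> derived_map R X Y f"
      using \<open>r \<in> S\<close> unfolding S_def by blast
    have Wr: "(W, s, f') \<in> roofs R X Y" and Wf: "hrel X X Y {(W, s, f')} (\<lambda>i x. x) f"
      using W unfolding derived_map_class[OF X YC f] by auto
    note dW = roofsD[OF Wr]
    have rr: "r \<in> roofs R ?X ?Y"
      unfolding r roofs_def
      using chain_complex_shift[OF dW(1)] quasi_iso_shift[OF dW(1) XC dW(2)] chain_map_shift[OF dW(1) YC dW(3)]
      by blast
    obtain c where c: "chain_map R X W c" "heq X X (gcomp s c) (\<lambda>i x. x)" "heq X Y (gcomp f' c) f"
      using Wf unfolding hrel_singleton by blast
    have "shift_map 1 (\<lambda>i x. x :: ('a, 'c) point) = (\<lambda>i x. x)"
      by (simp add: shift_map_def)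
    then have "hrel ?X ?X ?Y {r} (\<lambda>i x. x) (shift_map 1 f)"
      unfolding r hrel_singleton
      using chain_map_shift[OF XC dW(1) c(1), of 1] heq_shift[OF c(2)] heq_shift[OF c(3)]
      by (intro exI[of _ "shift_map 1 c"]) (simp add: shift_map_gcomp)
    with rr show ?thesis ..
  qed
  have "S \<noteq> {}"
    unfolding S_def using derived_map_mem[OF XC YC f] by blast
  have "derived_shift R X Y (derived_map R X Y f) = roof_rel R ?X ?Y `` S"
    unfolding derived_shift_def S_def ..
  also have "\<dots> = (\<Union>r\<in>S. roof_rel R ?X ?Y `` {r})"
    by blast
  also have "\<dots> = (\<Union>r\<in>S. derived_map R ?X ?Y (shift_map 1 f))"
    using S roof_class[OF SX SYC] derived_map_class[OF SX SYC chain_map_shift[OF XC YC f]]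
    by (intro SUP_cong refl) simp
  also have "\<dots> = derived_map R ?X ?Y (shift_map 1 f)"
    using \<open>S \<noteq> {}\<close> by simp
  finally show ?thesis .
qed

text \<open>A complex homotopy equivalent to the cone may replace it: \<open>c\<close> is the third
  vertical isomorphism, the others are identities, and the squares reduce to homotopies of chain
  maps.\<close>

lemma exact_triangle_cone:
  fixes A B Z :: "('a, 'c) cpx"
  assumes A: "kproj A" and B: "kproj B" and Z: "kproj Z" and f: "chain_map R A B f"
    and q: "chain_map R (cone A B f) Z q" and c: "chain_map R Z (cone A B f) c"
    and qc: "heq Z Z (gcomp q c) (\<lambda>i x. x)"
    and cq: "heq (cone A B f) (cone A B f) (gcomp c q) (\<lambda>i x. x)"
  shows "exact_triangle R A B Z (derived_map R A B f) (derived_map R B Z (gcomp q (cone_incl A)))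
    (derived_map R Z (shift 1 A) (gcomp cone_proj c))"
proof -
  let ?C = "cone A B f"
  note AC = kproj_cpx[OF A] and BC = kproj_cpx[OF B] and ZC = kproj_cpx[OF Z]
  note C = kproj_cone[OF A B f] and CC = chain_complex_cone[OF AC BC f]
  note incl = chain_map_cone_incl[OF AC BC f] and proj = chain_map_cone_proj[OF AC BC f]
  note SA = kproj_shift[OF A, of 1] and SAC = chain_complex_shift[OF AC, of 1]
  note v = chain_map_gcomp[OF incl q] and w = chain_map_gcomp[OF c proj]
  let ?id = "\<lambda>i x. x :: ('a, 'c) point"
  have sq1: "derived_comp R A B B (derived_map R B B ?id) (derived_map R A B f) =
      derived_comp R A A B (derived_map R A B f) (derived_map R A A ?id)"
    using derived_comp_map[OF A B BC f chain_map_id] derived_comp_map[OF A A BC chain_map_id f] by simp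
  have "heq B ?C (gcomp c (gcomp q (cone_incl A))) (cone_incl A)"
    using heq_comp_right[OF cq BC incl] by (simp add: gcomp_assoc)
  then have sq2: "derived_comp R B Z ?C (derived_map R Z ?C c) (derived_map R B Z (gcomp q (cone_incl A))) =
      derived_comp R B B ?C (derived_map R B ?C (cone_incl A)) (derived_map R B B ?id)"
    using derived_comp_map[OF B Z CC v c] derived_comp_map[OF B B CC chain_map_id incl] derived_map_cong[OF B]
    by simp
  have "shift_map 1 ?id = ?id"
    by (simp add: shift_map_def)
  then have sq3: "derived_comp R Z (shift 1 A) (shift 1 A) (derived_shift R A A (derived_map R A A ?id))
        (derived_map R Z (shift 1 A) (gcomp cone_proj c)) =
      derived_comp R Z ?C (shift 1 A) (derived_map R ?C (shift 1 A) cone_proj) (derived_map R Z ?C c)"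
    using derived_shift_map[OF A A chain_map_id] derived_comp_map[OF Z SA SAC w chain_map_id]
      derived_comp_map[OF Z C SAC c proj] by simp
  have "derived_iso R Z ?C (derived_map R Z ?C c)"
    using derived_iso_map[OF Z C c q qc cq] .
  then show ?thesis
    unfolding exact_triangle_def
    using derived_map_hom[OF AC BC f] derived_map_hom[OF BC ZC v] derived_map_hom[OF ZC SAC w]
      AC BC ZC f derived_iso_id[OF A] derived_iso_id[OF B] sq1 sq2 sq3
    by (intro conjI exI[of _ A] exI[of _ B] exI[of _ f] exI[of _ "derived_map R A A ?id"]
        exI[of _ "derived_map R B B ?id"] exI[of _ "derived_map R Z ?C c"]) assumption+
qed

section \<open>Bounded complexes of finite free modules\<close>

lemma carrier_free_module_empty: "carrier (free_module R {}) = {\<zero>\<^bsub>free_module R {}\<^esub>}"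
  by (auto elim!: free_module_cases simp: free_points_def)

lemma kproj_sum_of_shifts: "kproj (sum_of_shifts R js :: ('a, 'c) cpx)"
  by (induction js) (auto simp: kproj_zero_cpx kproj_ring_cpx kproj_shift kproj_sum_cpx)

lemma chain_map_inverse:
  assumes f: "chain_map R X Y f" and X: "chain_complex R X" and Y: "chain_complex R Y"
    and bij: "\<And>i. bij_betw (f i) (carrier (obj X i)) (carrier (obj Y i))"
  obtains g where "chain_map R Y X g" "heq X X (gcomp g f) (\<lambda>i x. x)" "heq Y Y (gcomp f g) (\<lambda>i x. x)"
proof -
  define g where "g = (\<lambda>i. inv_into (carrier (obj X i)) (f i))"
  have gf: "g i (f i x) = x" if "x \<in> carrier (obj X i)" for i x
    using bij_betw_inv_into_left[OF bij that] by (simp add: g_def)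
  have fg: "f i (g i y) = y" if "y \<in> carrier (obj Y i)" for i y
    using bij_betw_inv_into_right[OF bij that] by (simp add: g_def)
  have gc: "g i y \<in> carrier (obj X i)" if "y \<in> carrier (obj Y i)" for i y
    using bij_betw_apply[OF bij_betw_inv_into[OF bij] that] by (simp add: g_def)
  have g: "chain_map R Y X g"
  proof (rule chain_mapI)
    show "g i \<in> linear_maps R (obj Y i) (obj X i)" for i
    proof (rule linI[OF gc])
      fix x y assume xy: "x \<in> carrier (obj Y i)" "y \<in> carrier (obj Y i)"
      have "g i (f i (g i x \<oplus>\<^bsub>obj X i\<^esub> g i y)) = g i x \<oplus>\<^bsub>obj X i\<^esub> g i y"
        using gf xy gc mod_add_closed[OF cpx_module[OF X]] by blast
      then show "g i (x \<oplus>\<^bsub>obj Y i\<^esub> y) = g i x \<oplus>\<^bsub>obj X i\<^esub> g i y"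
        using xy gc by (simp add: cmap_add[OF f] fg)
    next
      fix r x assume rx: "r \<in> carrier R" "x \<in> carrier (obj Y i)"
      have "g i (f i (r \<odot>\<^bsub>obj X i\<^esub> g i x)) = r \<odot>\<^bsub>obj X i\<^esub> g i x"
        using gf rx gc mod_smult_closed[OF cpx_module[OF X]] by blast
      then show "g i (r \<odot>\<^bsub>obj Y i\<^esub> x) = r \<odot>\<^bsub>obj X i\<^esub> g i x"
        using rx gc by (simp add: cmap_smult[OF f] fg)
    qed
    fix i y assume y: "y \<in> carrier (obj Y i)"
    have "g (i - 1) (f (i - 1) (dif X i (g i y))) = dif X i (g i y)"
      using gf cpx_dif_closed[OF X gc[OF y] refl] .
    then show "g (i - 1) (dif Y i y) = dif X i (g i y)"
      using gc[OF y] y by (simp add: cmap_dif[OF f] fg)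
  qed
  show thesis
    using that[OF g] heq_cong[OF X X chain_map_gcomp[OF f g] chain_map_id]
      heq_cong[OF Y Y chain_map_gcomp[OF g f] chain_map_id] gf fg by simp
qed

text \<open>The band consists of the \<open>n\<close> degrees from \<open>p\<close> on. Outside it
  only a one-element carrier is asked for, as the Koszul complex and its truncations represent zero
  modules differently.\<close>

definition free_band :: "int \<Rightarrow> nat \<Rightarrow> ('a, 'c) cpx \<Rightarrow> bool" where
  "free_band p n M \<longleftrightarrow> chain_complex R M \<and>
     (\<forall>i. p \<le> i \<and> i < p + int n \<longrightarrow> (\<exists>B. finite B \<and> obj M i = free_module R B)) \<and>
     (\<forall>i. \<not> (p \<le> i \<and> i < p + int n) \<longrightarrow> carrier (obj M i) = {\<zero>\<^bsub>obj M i\<^esub>})"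

lemma free_bandD:
  assumes "free_band p n M"
  shows "chain_complex R M"
    and "\<lbrakk>p \<le> i; i < p + int n\<rbrakk> \<Longrightarrow> \<exists>B. finite B \<and> obj M i = free_module R B"
    and "\<not> (p \<le> i \<and> i < p + int n) \<Longrightarrow> carrier (obj M i) = {\<zero>\<^bsub>obj M i\<^esub>}"
  using assms by (auto simp: free_band_def)

lemma kproj_free_band:
  fixes M :: "('a, 'c) cpx"
  assumes M: "free_band p n M" shows "kproj M"
proof (rule kprojI[of _ p])
  show MC: "chain_complex R M"
    using free_bandD(1)[OF M] .
  show "projective (obj M i)" for i
  proof (cases "p \<le> i \<and> i < p + int n")
    case True
    then obtain B where "finite B" "obj M i = free_module R B"
      using free_bandD(2)[OF M] by blast
    then show ?thesis
      by (simp add: projective_free_module)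
  next
    case False
    then show ?thesis
      using projective_trivial[OF cpx_module[OF MC]] free_bandD(3)[OF M] by blast
  qed
  show "\<forall>i<p. carrier (obj M i) = {\<zero>\<^bsub>obj M i\<^esub>}"
    using free_bandD(3)[OF M] by simp
qed

text \<open>Follows the nesting of \<open>sum_of_shifts\<close>, whose innermost summand is the zero
  complex.\<close>

fun tuple_point :: "nat set list \<Rightarrow> (nat set \<Rightarrow> 'a) \<Rightarrow> ('a, 'c) point" where
  "tuple_point [] v = Scalar \<zero>"
| "tuple_point (S # Ss) v = Couple (Scalar (v S)) (tuple_point Ss v)"

lemma sum_of_shifts_obj_eq:
  fixes p :: int
  defines "T \<equiv> \<lambda>bs::nat set list. obj (sum_of_shifts R (replicate (length bs) p) :: ('a, 'c) cpx) p"
  shows "\<lbrakk>\<And>S. v S \<in> carrier R\<rbrakk> \<Longrightarrow> tuple_point bs v \<in> carrier (T bs)"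
    and "tuple_point bs (\<lambda>S. v S \<oplus> w S) = tuple_point bs v \<oplus>\<^bsub>T bs\<^esub> tuple_point bs w"
    and "r \<in> carrier R \<Longrightarrow> tuple_point bs (\<lambda>S. r \<otimes> v S) = r \<odot>\<^bsub>T bs\<^esub> tuple_point bs v"
  unfolding T_def
  by (induction bs) (simp_all add: ring_cpx_def zero_cpx_def)

lemma tuple_point_inj:
  "tuple_point bs v = tuple_point bs w \<Longrightarrow> S \<in> set bs \<Longrightarrow> v S = w S"
  by (induction bs) auto

lemma tuple_point_surj:
  fixes y :: "('a, 'c) point"
  assumes "distinct bs" "y \<in> carrier (obj (sum_of_shifts R (replicate (length bs) p)) p)"
  shows "\<exists>v\<in>free_points (set bs). tuple_point bs v = y"
  using assms
proof (induction bs arbitrary: y)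
  case Nil
  then show ?case
    by (intro bexI[of _ "\<lambda>_. \<zero>"]) (auto simp: zero_cpx_def free_points_def)
next
  case (Cons S bs)
  obtain r z where y: "y = Couple (Scalar r) z" "r \<in> carrier R"
    "z \<in> carrier (obj (sum_of_shifts R (replicate (length bs) p)) p)"
    using Cons.prems(2) by (auto simp: ring_cpx_def elim!: sum_module_cases)
  obtain v where v: "v \<in> free_points (set bs)" "tuple_point bs v = z"
    using Cons.IH[OF _ y(3)] Cons.prems(1) by auto
  \<comment> \<open>The list is distinct, so a new value at \<open>S\<close> does not disturb the
    tuple over the remaining entries.\<close>
  have "tuple_point cs (v(S := r)) = (tuple_point cs v :: ('a, 'c) point)" if "S \<notin> set cs" for cs
    using that by (induction cs) auto
  then have "tuple_point bs (v(S := r)) = z"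
    using v(2) Cons.prems(1) by simp
  moreover have "v(S := r) \<in> free_points (set (S # bs))"
    using v(1) y(2) by (auto simp: free_points_def)
  ultimately show ?case
    using y by (intro bexI[of _ "v(S := r)"]) (simp_all del: fun_upd_apply add: fun_upd_same)
qed

lemma sum_of_shifts_trivial:
  "i \<noteq> p \<Longrightarrow> carrier (obj (sum_of_shifts R (replicate k p)) i) =
    {\<zero>\<^bsub>obj (sum_of_shifts R (replicate k p)) i\<^esub>}"
  by (induction k) (auto simp: zero_cpx_def ring_cpx_def elim!: sum_module_cases)

lemma chain_map_concentrated:
  assumes X: "chain_complex R X" and Y: "chain_complex R Y" and f: "f \<in> linear_maps R (obj X p) (obj Y p)"
    and X0: "\<And>i. i \<noteq> p \<Longrightarrow> carrier (obj X i) = {\<zero>\<^bsub>obj X i\<^esub>}"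
    and Y0: "\<And>i. i \<noteq> p \<Longrightarrow> carrier (obj Y i) = {\<zero>\<^bsub>obj Y i\<^esub>}"
  shows "chain_map R X Y (\<lambda>i x. if i = p then f x else \<zero>\<^bsub>obj Y i\<^esub>)"
proof (rule chain_mapI)
  let ?f = "\<lambda>i x. if i = p then f x else \<zero>\<^bsub>obj Y i\<^esub>"
  show lin: "?f i \<in> linear_maps R (obj X i) (obj Y i)" for i
    using f lin_const_zero[OF cpx_module[OF Y]] by (cases "i = p") simp_all
  fix i x assume x: "x \<in> carrier (obj X i)"
  note dx = cpx_dif_closed[OF X x refl] and fx = lin_closed[OF lin x]
  note dfx = cpx_dif_closed[OF Y fx refl] and fdx = lin_closed[OF lin dx]
  show "?f (i - 1) (dif X i x) = dif Y i (?f i x)"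
  proof (cases "i - 1 = p")
    case True
    then have "x = \<zero>\<^bsub>obj X i\<^esub>"
      using X0[of i] x by simp
    then show ?thesis
      using True lin_zero[OF cpx_module[OF X] cpx_module[OF Y] lin]
        lin_zero[OF cpx_module[OF X] cpx_module[OF X] cpx_dif[OF X]]
        lin_zero[OF cpx_module[OF Y] cpx_module[OF Y] cpx_dif[OF Y]] by metis
  next
    case False
    then show ?thesis
      using Y0[of "i - 1"] dfx fdx by (metis singletonD)
  qed
qed

text \<open>An enumeration of the basis identifies a finite free module in degree \<open>p\<close>
  with a sum of copies of \<open>R\<close> shifted by \<open>p\<close>; the complement in the
  retract condition is zero.\<close>

lemma free_band_1_thickening:
  fixes M :: "('a, 'c) cpx"
  assumes M: "free_band p 1 M" shows "M \<in> thickening R (Suc 0)"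
proof -
  obtain B where B: "finite B" "obj M p = free_module R B"
    using free_bandD(2)[OF M, of p] by auto
  obtain bs where bs: "set bs = B" "distinct bs"
    using finite_distinct_list[OF B(1)] by blast
  let ?E = "sum_of_shifts R (replicate (length bs) p) :: ('a, 'c) cpx"
  let ?S = "sum_cpx M (zero_cpx R)"
  note MC = free_bandD(1)[OF M]
  note Ek = kproj_sum_of_shifts[of "replicate (length bs) p", where 'c = 'c]
  note Sk = kproj_sum_cpx[OF kproj_free_band[OF M] kproj_zero_cpx]
  note EC = kproj_cpx[OF Ek] and SC = kproj_cpx[OF Sk]
  define f where "f = (\<lambda>x :: ('a, 'c) point. tuple_point bs (the_coords (point_fst x)) :: ('a, 'c) point)"
  have zero: "carrier (obj (zero_cpx R :: ('a, 'c) cpx) i) = {Scalar \<zero>}" for i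
    by (simp add: zero_cpx_def)
  have Sp: "\<exists>v\<in>free_points B. x = Couple (Coords v) (Scalar \<zero>)" if "x \<in> carrier (obj ?S p)" for x
    using that zero[of p] B(2) by (auto elim!: sum_module_cases free_module_cases)
  have S0: "carrier (obj ?S i) = {\<zero>\<^bsub>obj ?S i\<^esub>}" if "i \<noteq> p" for i
    using free_bandD(3)[OF M, of i] that by (auto simp: zero_cpx_def elim!: sum_module_cases)
  have lin: "f \<in> linear_maps R (obj ?S p) (obj ?E p)"
  proof (rule linI)
    show "f x \<in> carrier (obj ?E p)" if x: "x \<in> carrier (obj ?S p)" for x
    proof -
      obtain v where v: "v \<in> free_points B" "x = Couple (Coords v) (Scalar \<zero>)"
        using Sp[OF x] by blast
      show ?thesis
        using sum_of_shifts_obj_eq(1)[OF free_points_closed[OF v(1)]] v(2) by (simp add: f_def)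
    qed
    show "f (x \<oplus>\<^bsub>obj ?S p\<^esub> y) = f x \<oplus>\<^bsub>obj ?E p\<^esub> f y"
      if "x \<in> carrier (obj ?S p)" "y \<in> carrier (obj ?S p)" for x y
      using Sp[OF that(1)] Sp[OF that(2)] sum_of_shifts_obj_eq(2) by (auto simp: f_def B(2))
    show "f (r \<odot>\<^bsub>obj ?S p\<^esub> x) = r \<odot>\<^bsub>obj ?E p\<^esub> f x" if "r \<in> carrier R" "x \<in> carrier (obj ?S p)" for r x
      using Sp[OF that(2)] sum_of_shifts_obj_eq(3)[OF that(1)] by (auto simp: f_def B(2))
  qed
  let ?f = "\<lambda>i x. if i = p then f x else \<zero>\<^bsub>obj ?E i\<^esub>"
  have cm: "chain_map R ?S ?E ?f"
    using chain_map_concentrated[OF SC EC lin S0 sum_of_shifts_trivial] by simp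
  have "bij_betw (?f i) (carrier (obj ?S i)) (carrier (obj ?E i))" for i
  proof (cases "i = p")
    case True
    have "inj_on f (carrier (obj ?S p))"
    proof (rule inj_onI)
      fix x y assume "x \<in> carrier (obj ?S p)" "y \<in> carrier (obj ?S p)" and eq: "f x = f y"
      then obtain v w where v: "v \<in> free_points B" "x = Couple (Coords v) (Scalar \<zero>)"
        and w: "w \<in> free_points B" "y = Couple (Coords w) (Scalar \<zero>)"
        using Sp by blast
      have "v S = w S" for S
        using eq tuple_point_inj[of bs v w S] v w bs(1) free_points_zero[OF v(1), of S]
          free_points_zero[OF w(1), of S]
        by (cases "S \<in> B") (simp_all add: f_def)
      then show "x = y"
        using v w by (simp add: fun_eq_iff)
    qed
    moreover have "\<exists>x\<in>carrier (obj ?S p). f x = y" if y: "y \<in> carrier (obj ?E p)" for y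
    proof -
      obtain v where "v \<in> free_points B" "tuple_point bs v = y"
        using tuple_point_surj[OF bs(2) y] bs(1) by blast
      then show ?thesis
        using zero[of p] B(2) by (intro bexI[of _ "Couple (Coords v) (Scalar \<zero>)"]) (simp_all add: f_def)
    qed
    ultimately show ?thesis
      using True lin_closed[OF lin] by (auto simp: bij_betw_def image_iff intro!: set_eqI)
  next
    case False
    then show ?thesis
      using S0[OF False] by (simp add: bij_betw_def sum_of_shifts_trivial[OF False])
  qed
  then obtain g where g: "chain_map R ?E ?S g" "heq ?S ?S (gcomp g ?f) (\<lambda>i x. x)" "heq ?E ?E (gcomp ?f g) (\<lambda>i x. x)"
    using chain_map_inverse[OF cm SC EC] by blast
  have "derived_isomorphic R ?S ?E"
    unfolding derived_isomorphic_def using SC EC derived_iso_map[OF Sk Ek cm g] by blast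
  then show ?thesis
    using MC chain_complex_zero_cpx[where 'c = 'c] by auto
qed

section \<open>Splitting off the lowest degree\<close>

definition stalk :: "int \<Rightarrow> ('a, 'c) cpx \<Rightarrow> ('a, 'c) cpx" where
  "stalk p M = \<lparr>obj = (\<lambda>i. if i = p then obj M i else zero_module R),
     dif = (\<lambda>i x. if i - 1 = p then \<zero>\<^bsub>obj M p\<^esub> else Scalar \<zero>)\<rparr>"

text \<open>If \<open>M\<close> is zero below \<open>p\<close>, this is the quotient of
  \<open>M\<close> by the subcomplex \<open>stalk p M\<close>.\<close>

definition truncate_above :: "int \<Rightarrow> ('a, 'c) cpx \<Rightarrow> ('a, 'c) cpx" where
  "truncate_above p M = \<lparr>obj = (\<lambda>i. if p < i then obj M i else zero_module R),
     dif = (\<lambda>i x. if p < i - 1 then dif M i x else Scalar \<zero>)\<rparr>"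

lemma stalk_simps [simp]:
  "obj (stalk p M) p = obj M p" "i \<noteq> p \<Longrightarrow> obj (stalk p M) i = zero_module R"
  "dif (stalk p M) i x = \<zero>\<^bsub>obj (stalk p M) (i - 1)\<^esub>"
  by (auto simp: stalk_def)

lemma truncate_simps [simp]:
  "p < i \<Longrightarrow> obj (truncate_above p M) i = obj M i" "\<not> p < i \<Longrightarrow> obj (truncate_above p M) i = zero_module R"
  "p < i - 1 \<Longrightarrow> dif (truncate_above p M) i = dif M i"
  "\<not> p < i - 1 \<Longrightarrow> dif (truncate_above p M) i x = Scalar \<zero>"
  by (auto simp: truncate_above_def)

lemma chain_complex_stalk:
  fixes M :: "('a, 'c) cpx"
  assumes M: "chain_complex R M" shows "chain_complex R (stalk p M)"
proof (rule chain_complexI)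
  show mod: "module R (obj (stalk p M) i)" for i
    using cpx_module[OF M] zero_module by (cases "i = p") auto
  show "dif (stalk p M) i \<in> linear_maps R (obj (stalk p M) i) (obj (stalk p M) (i - 1))" for i
    using lin_const_zero[OF mod] by (rule lin_cong[OF _ mod]) simp
qed simp

lemma chain_complex_truncate:
  fixes M :: "('a, 'c) cpx"
  assumes M: "chain_complex R M" shows "chain_complex R (truncate_above p M)"
proof (rule chain_complexI)
  let ?Z = "truncate_above p M"
  show mod: "module R (obj ?Z i)" for i
    using cpx_module[OF M] zero_module by (cases "p < i") auto
  show "dif ?Z i \<in> linear_maps R (obj ?Z i) (obj ?Z (i - 1))" for i
  proof (cases "p < i - 1")
    case True
    then show ?thesis
      using cpx_dif[OF M, of i] by simp
  next
    case False
    show ?thesis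
      by (rule lin_cong[OF lin_const_zero[OF mod, of "i - 1"] mod]) (use False in simp)
  qed
  show "dif ?Z (i - 1) (dif ?Z i x) = \<zero>\<^bsub>obj ?Z (i - 2)\<^esub>" if "x \<in> carrier (obj ?Z i)" for i x
    using that cpx_dif_dif[OF M, of x i "i - 1"] by (cases "p < i - 2") simp_all
qed

lemma free_band_stalk:
  fixes M :: "('a, 'c) cpx"
  assumes M: "free_band p (Suc n) M" shows "free_band p 1 (stalk p M)"
  unfolding free_band_def
proof (intro conjI allI impI)
  show "chain_complex R (stalk p M)"
    using chain_complex_stalk[OF free_bandD(1)[OF M]] .
  show "\<exists>B. finite B \<and> obj (stalk p M) i = free_module R B" if "p \<le> i \<and> i < p + int 1" for i
    using that free_bandD(2)[OF M, of p] by (cases "i = p") auto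
  show "carrier (obj (stalk p M) i) = {\<zero>\<^bsub>obj (stalk p M) i\<^esub>}" if "\<not> (p \<le> i \<and> i < p + int 1)" for i
    using that by (cases "i = p") auto
qed

lemma free_band_truncate:
  fixes M :: "('a, 'c) cpx"
  assumes M: "free_band p (Suc n) M" shows "free_band (p + 1) n (truncate_above p M)"
  unfolding free_band_def
proof (intro conjI allI impI)
  let ?Z = "truncate_above p M"
  show "chain_complex R ?Z"
    using chain_complex_truncate[OF free_bandD(1)[OF M]] .
  show "\<exists>B. finite B \<and> obj ?Z i = free_module R B" if "p + 1 \<le> i \<and> i < p + 1 + int n" for i
    using that free_bandD(2)[OF M, of i] by simp
  show "carrier (obj ?Z i) = {\<zero>\<^bsub>obj ?Z i\<^esub>}" if "\<not> (p + 1 \<le> i \<and> i < p + 1 + int n)" for i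
    using that free_bandD(3)[OF M, of i] by (cases "p < i") auto
qed

text \<open>The inclusion of the stalk splits in every degree, so its cone is homotopy equivalent to
  the truncation. The middle term is a sum with the zero complex, to match the shape required by
  \<open>thickening\<close>.\<close>

lemma exact_triangle_truncate:
  fixes M :: "('a, 'c) cpx"
  assumes M: "free_band p (Suc n) M"
  obtains u v w where
    "exact_triangle R (stalk p M) (sum_cpx (zero_cpx R) M) (truncate_above p M) u v w"
proof -
  note MC = free_bandD(1)[OF M] and Mk = kproj_free_band[OF M]
  let ?A = "stalk p M" and ?O = "zero_cpx R :: ('a, 'c) cpx" and ?Z = "truncate_above p M"
  let ?B = "sum_cpx ?O M"
  note Ak = kproj_free_band[OF free_band_stalk[OF M]] and Zk = kproj_free_band[OF free_band_truncate[OF M]]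
  note Bk = kproj_sum_cpx[OF kproj_zero_cpx Mk]
  note AC = kproj_cpx[OF Ak] and BC = kproj_cpx[OF Bk] and ZC = kproj_cpx[OF Zk]
  note Mmod = cpx_module[OF MC] and OC = chain_complex_zero_cpx[where 'c = 'c]
  have O: "obj ?O i = zero_module R" "dif ?O i x = Scalar \<zero>" for i x
    by (simp_all add: zero_cpx_def)
  have M0: "x = \<zero>\<^bsub>obj M i\<^esub>" if "x \<in> carrier (obj M i)" "i < p" for x i
    using free_bandD(3)[OF M, of i] that by simp
  define \<iota> where "\<iota> = (\<lambda>i x. if i = p then x else \<zero>\<^bsub>obj M i\<^esub>)"
  have \<iota>: "chain_map R ?A M \<iota>"
  proof (rule chain_mapI)
    show "\<iota> i \<in> linear_maps R (obj ?A i) (obj M i)" for i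
      using lin_id[of "obj M p"] lin_const_zero[OF Mmod] by (cases "i = p") (simp_all add: \<iota>_def)
    show "\<iota> (i - 1) (dif ?A i x) = dif M i (\<iota> i x)" if "x \<in> carrier (obj ?A i)" for i x
      using that M0[of "dif M i x" "i - 1"] MC by (cases "i = p") (auto simp: \<iota>_def cpx_simps)
  qed
  define f where "f = (\<lambda>i x. Couple (zmap ?O i x) (\<iota> i x))"
  have f: "chain_map R ?A ?B f"
    unfolding f_def using chain_map_pair[OF chain_map_zmap[OF OC] \<iota>] .
  let ?C = "cone ?A ?B f"
  note CC = chain_complex_cone[OF AC BC f]
  have Ccases: "\<exists>a m. x = Couple a (Couple (Scalar \<zero>) m) \<and> a \<in> carrier (obj ?A (i - 1)) \<and> m \<in> carrier (obj M i)"
    if "x \<in> carrier (obj ?C i)" for x i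
    using that by (auto simp: O elim!: sum_module_cases)
  define q where "q = (\<lambda>i x. if p < i then point_snd (point_snd x) else (Scalar \<zero> :: ('a, 'c) point))"
  have q: "chain_map R ?C ?Z q"
  proof (rule chain_mapI)
    show "q i \<in> linear_maps R (obj ?C i) (obj ?Z i)" for i
      by (cases "p < i") (intro linI; force simp: q_def O dest!: Ccases)+
    show "q (i - 1) (dif ?C i x) = dif ?Z i (q i x)" if xC: "x \<in> carrier (obj ?C i)" for i x
    proof -
      obtain a m where x: "x = Couple a (Couple (Scalar \<zero>) m)" "a \<in> carrier (obj ?A (i - 1))" "m \<in> carrier (obj M i)"
        using Ccases[OF xC] by blast
      then show ?thesis
        using MC by (cases "p < i - 1") (simp_all add: q_def f_def \<iota>_def O zmap_def cpx_simps mod_simps)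
    qed
  qed
  \<comment> \<open>The entry \<open>- d z\<close> in degree \<open>p + 1\<close> makes up for the
    differential into degree \<open>p\<close> that the truncation drops: in the cone it cancels
    \<open>d z\<close>.\<close>
  define c where "c = (\<lambda>i z. Couple (if i = p + 1 then \<ominus>\<^bsub>obj M p\<^esub> dif M i z else Scalar \<zero>)
    (Couple (Scalar \<zero>) (if p < i then z else \<zero>\<^bsub>obj M i\<^esub>)))"
  have c: "chain_map R ?Z ?C c"
  proof (rule chain_mapI)
    show "c i \<in> linear_maps R (obj ?Z i) (obj ?C i)" for i
    proof (cases i "p + 1" rule: linorder_cases)
      case less
      then show ?thesis
        using Mmod by (intro linI) (auto simp: c_def O mod_simps)
    next
      case equal
      then show ?thesis
        using MC by (intro linI) (auto simp: c_def O cpx_simps mod_simps mod_ac)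
    next
      case greater
      then show ?thesis
        by (intro linI) (auto simp: c_def O)
    qed
    show "c (i - 1) (dif ?Z i z) = dif ?C i (c i z)" if "z \<in> carrier (obj ?Z i)" for i z
    proof -
      consider "i < p + 1" | "i = p + 1" | "i = p + 2" | "p + 2 < i" by linarith
      then show ?thesis
        using that MC
        by cases (auto simp: c_def f_def \<iota>_def O zmap_def cpx_simps mod_simps)
    qed
  qed
  have qc: "heq ?Z ?Z (gcomp q c) (\<lambda>i x. x)"
  proof (rule heq_cong[OF ZC ZC chain_map_gcomp[OF c q] chain_map_id])
    show "gcomp q c i x = x" if "x \<in> carrier (obj ?Z i)" for i x
      using that by (cases "p < i") (auto simp: q_def c_def)
  qed
  \<comment> \<open>The module in degree \<open>p\<close> of \<open>M\<close> occurs twice in the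
    cone, in degree \<open>p\<close> from \<open>M\<close> and in degree \<open>p + 1\<close> from
    the stalk; \<open>h\<close> takes the first copy to the second, and the differential takes it
    back.\<close>
  define h where "h = (\<lambda>i x. Couple (if i = p then point_snd (point_snd x) else Scalar \<zero>)
    (Couple (Scalar \<zero>) \<zero>\<^bsub>obj M (i + 1)\<^esub>))"
  have "homotopy ?C ?C (\<lambda>i x. x) (gcomp c q) h"
  proof (rule homotopyI)
    show "h i \<in> linear_maps R (obj ?C i) (obj ?C (i + 1))" for i
      using Mmod by (cases "i = p") (intro linI; force simp: h_def O mod_simps dest!: Ccases)+
    fix i x assume "x \<in> carrier (obj ?C i)"
    then obtain a m where x: "x = Couple a (Couple (Scalar \<zero>) m)" "a \<in> carrier (obj ?A (i - 1))" "m \<in> carrier (obj M i)"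
      using Ccases by blast
    consider "i < p" | "i = p" | "i = p + 1" | "p + 1 < i" by linarith
    then show "x = gcomp c q i x \<oplus>\<^bsub>obj ?C i\<^esub> (dif ?C (i + 1) (h i x) \<oplus>\<^bsub>obj ?C i\<^esub> h (i - 1) (dif ?C i x))"
    proof cases
      case 1
      then have "m = \<zero>\<^bsub>obj M i\<^esub>" "a = Scalar \<zero>"
        using x M0 by auto
      then show ?thesis
        using 1 x(1) MC by (simp add: c_def q_def h_def f_def \<iota>_def O zmap_def cpx_simps mod_simps)
    next
      case 2
      then have "a = Scalar \<zero>"
        using x by auto
      then show ?thesis
        using 2 x MC by (simp add: c_def q_def h_def f_def \<iota>_def O zmap_def cpx_simps mod_simps)
    next
      case 3
      then show ?thesis
        using x MC
        by (simp add: c_def q_def h_def f_def \<iota>_def O zmap_def cpx_simps mod_simps mod_ac mod_cancel)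
          (simp add: add.commute[of 1] cpx_simps mod_simps)
    next
      case 4
      then have "a = Scalar \<zero>"
        using x by auto
      then show ?thesis
        using 4 x MC by (simp add: c_def q_def h_def f_def \<iota>_def O zmap_def cpx_simps mod_simps)
    qed
  qed
  then have "heq ?C ?C (\<lambda>i x. x) (gcomp c q)"
    using homotopic_iff[OF CC CC chain_map_id chain_map_gcomp[OF q c]] CC chain_map_id chain_map_gcomp[OF q c]
    unfolding heq_def by blast
  then show thesis
    using exact_triangle_cone[OF Ak Bk Zk f q c qc heq_sym] that by blast
qed

text \<open>Each triangle removes the lowest degree at the cost of one object of the first
  thickening, so the number of degrees bounds the number of steps.\<close>

lemma free_band_thickening:
  fixes M :: "('a, 'c) cpx"
  shows "free_band p (Suc n) M \<Longrightarrow> M \<in> thickening R (Suc n)"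
proof (induction n arbitrary: p M)
  case 0
  then show ?case
    using free_band_1_thickening[of p M] by simp
next
  case (Suc n)
  obtain u v w where tri: "exact_triangle R (stalk p M) (sum_cpx (zero_cpx R) M) (truncate_above p M) u v w"
    using exact_triangle_truncate[OF Suc.prems] .
  have "truncate_above p M \<in> thickening R (Suc n)"
    using Suc.IH[OF free_band_truncate[OF Suc.prems]] .
  moreover have "stalk p M \<in> thickening R (Suc 0)"
    using free_band_1_thickening[OF free_band_stalk[OF Suc.prems]] .
  ultimately show ?case
    using tri free_bandD(1)[OF Suc.prems] chain_complex_zero_cpx[where 'c = 'c]
    unfolding thickening.simps(3) mem_Collect_eq
    by (intro conjI exI[of _ "stalk p M"] exI[of _ "zero_cpx R"] exI[of _ "truncate_above p M"]
        exI[of _ u] exI[of _ v] exI[of _ w]) assumption+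
qed

end

theorem corollary3p7:
  fixes R :: "('a, 'r) ring_scheme" and m :: "'a set" and xs :: "'a list"
  assumes "noetherian_ring R" and "local_ring R m"
    and "lech_independent R xs"
    and "genideal R (set xs) \<noteq> carrier R"
  shows "level R (koszul R xs :: ('a, 'b) cpx) = enat (length xs) + 1"
proof -
  let ?K = "koszul R xs :: ('a, 'b) cpx"
  interpret cring R
    using assms(2) by (simp add: local_ring_def)
  interpret lech_sequence R xs
    using lech_independent_sequence[OF assms(3)] .
  \<comment> \<open>The Koszul complex occupies the degrees from 0 to the length of
    \<open>xs\<close>, one more than the length in number; this is the origin of the
    \<open>+ 1\<close>.\<close>
  have "free_band 0 (Suc (length xs)) ?K"
    unfolding free_band_def
  proof (intro conjI allI impI)
    show "chain_complex R ?K"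
      by (rule chain_complex_koszul)
    show "\<exists>B. finite B \<and> obj ?K i = free_module R B" for i
      using finite_kdeg by auto
    fix i :: int assume i: "\<not> (0 \<le> i \<and> i < 0 + int (Suc (length xs)))"
    have "S \<notin> kdeg (length xs) i" for S
    proof
      assume S: "S \<in> kdeg (length xs) i"
      then have "card S \<le> length xs"
        using card_mono[OF finite_lessThan, of S "length xs"] by (simp add: kdeg_def)
      moreover have "int (card S) = i"
        using S by (simp add: kdeg_def)
      ultimately show False
        using i by linarith
    qed
    then have "kdeg (length xs) i = {}" by blast
    then show "carrier (obj ?K i) = {\<zero>\<^bsub>obj ?K i\<^esub>}"
      unfolding obj_koszul by (simp only: carrier_free_module_empty)
  qed
  then have "?K \<in> thickening R (Suc (length xs))"
    by (rule free_band_thickening)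
  moreover have "Suc (length xs) \<le> n" if "?K \<in> thickening R n" for n
    using koszul_notin_thickening[OF assms(4), of n] that by (meson not_less_eq_eq)
  ultimately have "level R ?K = enat (Suc (length xs))"
    unfolding level_def by (intro Inf_eqI) auto
  then show ?thesis
    by (simp add: one_enat_def)
qed

end
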